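(* Consider, for a parameter $\eta>0$, the problem \[ v''+\frac{1}{r}v'+\eta f(v)=0,\quad 0<r<1,\qquad v'(0)=v(1)=0 . \] Assume $f\in C^2([0,\infty))$ satisfies $f(0)=f'(0)=0$ and $f(v)>0$ for $v>0$; $f$ is log-concave, i.e. $f''(v)f(v)-f'(v)^2<0$ for all $v>0$; $f$ is convex-concave, i.e. there is $\beta>0$ with $f''(v)>0$ on $(0,\beta)$ and $f''(v)<0$ on $(\beta,\infty)$; $\lim_{v\to\infty}f(v)=f_0>0$; and \[ vf'(v)>f(v)\quad\text{on } (0,\beta). \] Then there is a critical value $\eta_0>0$ such that the problem has no positive solutions for $\eta<\eta_0$, exactly one positive solution for $\eta=\eta_0$, and exactly two positive solutions for $\eta>\eta_0$. Moreover, all positive solutions lie on a single smooth solution curve, which for $\eta>\eta_0$ consists of two branches $v^-(r,\eta)<v^+(r,\eta)$; $v^+(r,\eta)$ is strictly increasing in $\eta$ and $\lim_{\eta\to\infty}v^+(r,\eta)=\infty$ for every $r\in[0,1)$, while $\lim_{\eta\to\infty}v^-(0,\eta)=0$. Writing $v_0=v^-(\cdot,\eta_0)=v^+(\cdot,\eta_0)$, the turning point $(\eta_0,v_0)$ is the only critical point on the solution curve, and $(\eta_0,v_0)$ is a non-degenerate critical point.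
   Context: A solution pair $(\eta,v)$ is a critical point if the linearized problem $w''+\frac1r w'+\eta f'(v(r))w=0$ on $(0,1)$, $w'(0)=w(1)=0$, has a nontrivial solution. A critical point $(\eta_0,v_0)$ is called non-degenerate if the space of solutions of this linearized problem is one-dimensional, spanned by some $w_0$, and moreover $\int_0^1 f(v_0(r))w_0(r)\,r\,dr\neq 0$ and $\int_0^1 f''(v_0(r))w_0^3(r)\,r\,dr\neq 0$ (equivalently, $\int_B f(v_0)w_0\,dx\ne0$ and $\int_B f''(v_0)w_0^3\,dx\ne0$ over the unit disk $B\subset\mathbb{R}^2$). Positive solutions are solutions with $v(r)>0$ for $0\le r<1$. *)

theory Defs
  imports "HOL-Analysis.Analysis" "HOL-Library.FuncSet"
begin

definition is_solution :: "(real \<Rightarrow> real) \<Rightarrow> real \<Rightarrow> (real \<Rightarrow> real) \<Rightarrow> bool" where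
  "is_solution f \<eta> v \<longleftrightarrow>
     (\<exists>v' v''. (\<forall>r\<in>{0..1}. (v has_real_derivative v' r) (at r within {0..1})) \<and>
        (\<forall>r\<in>{0<..<1}. (v' has_real_derivative v'' r) (at r) \<and>
                        v'' r + v' r / r + \<eta> * f (v r) = 0) \<and>
        v' 0 = 0 \<and> v 1 = 0)"

definition is_pos_solution :: "(real \<Rightarrow> real) \<Rightarrow> real \<Rightarrow> (real \<Rightarrow> real) \<Rightarrow> bool" where
  "is_pos_solution f \<eta> v \<longleftrightarrow> is_solution f \<eta> v \<and> (\<forall>r\<in>{0..<1}. v r > 0)"

text \<open>Solutions w of the linearized problem  w'' + w'/r + eta f'(v(r)) w = 0,
  w'(0) = w(1) = 0; here f1 is the derivative f'.\<close>
definition lin_solution :: "(real \<Rightarrow> real) \<Rightarrow> real \<Rightarrow> (real \<Rightarrow> real) \<Rightarrow> (real \<Rightarrow> real) \<Rightarrow> bool" where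
  "lin_solution f1 \<eta> v w \<longleftrightarrow>
     (\<exists>w' w''. (\<forall>r\<in>{0..1}. (w has_real_derivative w' r) (at r within {0..1})) \<and>
        (\<forall>r\<in>{0<..<1}. (w' has_real_derivative w'' r) (at r) \<and>
                        w'' r + w' r / r + \<eta> * f1 (v r) * w r = 0) \<and>
        w' 0 = 0 \<and> w 1 = 0)"

definition nontrivial_on01 :: "(real \<Rightarrow> real) \<Rightarrow> bool" where
  "nontrivial_on01 w \<longleftrightarrow> (\<exists>r\<in>{0..1}. w r \<noteq> 0)"

definition is_critical_point :: "(real \<Rightarrow> real) \<Rightarrow> real \<Rightarrow> (real \<Rightarrow> real) \<Rightarrow> bool" where
  "is_critical_point f1 \<eta> v \<longleftrightarrow> (\<exists>w. lin_solution f1 \<eta> v w \<and> nontrivial_on01 w)"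

text \<open>Non-degenerate critical point (f1 = f', f2 = f'').\<close>
definition nondegenerate_critical_point ::
  "(real \<Rightarrow> real) \<Rightarrow> (real \<Rightarrow> real) \<Rightarrow> (real \<Rightarrow> real) \<Rightarrow> real \<Rightarrow> (real \<Rightarrow> real) \<Rightarrow> bool" where
  "nondegenerate_critical_point f f1 f2 \<eta> v \<longleftrightarrow>
     (\<exists>w0. lin_solution f1 \<eta> v w0 \<and> nontrivial_on01 w0 \<and>
        (\<forall>w. lin_solution f1 \<eta> v w \<longrightarrow> (\<exists>c. \<forall>r\<in>{0..1}. w r = c * w0 r)) \<and>
        integral {0..1} (\<lambda>r. f (v r) * w0 r * r) \<noteq> 0 \<and>
        integral {0..1} (\<lambda>r. f2 (v r) * (w0 r) ^ 3 * r) \<noteq> 0)"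

definition smooth_solution_curve :: "real set \<Rightarrow> (real \<Rightarrow> real) \<Rightarrow> (real \<Rightarrow> real \<Rightarrow> real) \<Rightarrow> bool" where
  "smooth_solution_curve I etac V \<longleftrightarrow>
     open I \<and> is_interval I \<and> I \<noteq> {} \<and>
     (\<exists>etac' Vs.
        (\<forall>s\<in>I. (etac has_real_derivative etac' s) (at s)) \<and> continuous_on I etac' \<and>
        (\<forall>s\<in>I. \<forall>r\<in>{0..1}. ((\<lambda>t. V t r) has_real_derivative Vs s r) (at s)) \<and>
        continuous_on (I \<times> {0..1}) (\<lambda>p. Vs (fst p) (snd p)) \<and>
        (\<forall>s\<in>I. etac' s \<noteq> 0 \<or> (\<exists>r\<in>{0..1}. Vs s r \<noteq> 0))) \<and>
     (\<forall>s\<in>I. \<forall>t\<in>I. s \<noteq> t \<longrightarrow> etac s \<noteq> etac t \<or> (\<exists>r\<in>{0..1}. V s r \<noteq> V t r))"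

end

theory Submission
  imports Defs
begin

text \<open>Let \<open>u\<close> be the solution of \<open>u'' + u' / r + f u = 0\<close>, \<open>u 0 = a\<close>, \<open>u' 0 = 0\<close>, let \<open>R a\<close> be its zero and \<open>w\<close> its derivative
  in \<open>a\<close>. By scaling, the positive solutions for \<open>\<eta>\<close> correspond to the \<open>a > 0\<close> with \<open>(R a)\<^sup>2 = \<eta>\<close>, and
  \<open>R' a\<close> has the sign of \<open>w (R a)\<close>. Log-concavity makes \<open>w\<close> positive on \<open>[0, R a)\<close> whenever \<open>w (R a) \<ge> 0\<close>.
  At a critical point the identity \<open>\<integral> r f'' (u')\<^sup>2 w = 0\<close> (a consequence of \<open>f 0 = f' 0 = 0\<close>) and the monotonicity of
  \<open>w / (- u')\<close> yield \<open>\<integral> r f'' w\<^sup>3 < 0\<close>, hence \<open>w (R a)\<close> crosses zero upwards there. As \<open>R\<close> tends to infinity at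
  both ends of \<open>(0, \<infinity>)\<close>, it decreases up to a unique critical point and increases afterwards.\<close>

section \<open>The radial Laplacian as an integral operator\<close>

text \<open>The term \<open>u' / r\<close> is singular at \<open>0\<close>, so the problem is
  treated as a fixed point equation for the integral operator that inverts the radial Laplacian.
  Regularity at \<open>0\<close> is then built in, and the initial value is the only free constant,
  for solutions and for linearized solutions alike. In the divergence form
  \<open>(r u')' = - r f u\<close> the first-order term disappears, and the comparison arguments use
  Wronskians weighted by \<open>r\<close>. \<open>R\<close> is large at both ends for one reason,
  the bound \<open>a \<le> f a * (R a)\<^sup>2\<close>: \<open>f\<close> is bounded, and
  \<open>f a / a\<close> tends to \<open>0\<close> with \<open>a\<close> because
  \<open>f' 0 = 0\<close>. The order of the two branches is not a consequence of the shape of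
  \<open>R\<close>: monotonicity of the rescaled solution in \<open>a\<close> is obtained from
  \<open>R' > 0\<close>, hence on the upper branch only. The lower branch is compared with the upper
  one by a continuity argument in \<open>a\<close>, which must also control the point
  \<open>r = 1\<close>, where all solutions vanish.\<close>

definition radial_flux :: "(real \<Rightarrow> real) \<Rightarrow> real \<Rightarrow> real" where
  "radial_flux g t = integral {0..t} (\<lambda>s. s * g s) / t"

text \<open>Integrating \<open>(r * x')' = - r * g\<close> twice: \<open>a - radial_pot g\<close>
  solves \<open>x'' + x' / r + g = 0\<close> with \<open>x 0 = a\<close> and
  \<open>x' 0 = 0\<close>, and \<open>- radial_flux g\<close> is its derivative.\<close>

definition radial_pot :: "(real \<Rightarrow> real) \<Rightarrow> real \<Rightarrow> real" where
  "radial_pot g r = integral {0..r} (radial_flux g)"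

text \<open>Division by zero yields the correct limit: the quotient is O(t) for continuous
  \<open>g\<close>, so the flux is continuous up to \<open>0\<close>
  (\<open>continuous_on_radial_flux\<close>).\<close>

lemma radial_flux_0 [simp]: "radial_flux g 0 = 0"
  by (simp add: radial_flux_def)

lemma radial_pot_0 [simp]: "radial_pot g 0 = 0"
  by (simp add: radial_pot_def)

lemma radial_flux_cong:
  assumes "\<And>s. 0 \<le> s \<Longrightarrow> s \<le> t \<Longrightarrow> g s = h s"
  shows "radial_flux g t = radial_flux h t"
  unfolding radial_flux_def using assms by (auto intro!: arg_cong2[where f="(/)"] integral_cong)

lemma radial_pot_cong:
  assumes "\<And>s. 0 \<le> s \<Longrightarrow> s \<le> t \<Longrightarrow> g s = h s"
  shows "radial_pot g t = radial_pot h t"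
  unfolding radial_pot_def using assms by (auto intro!: integral_cong radial_flux_cong)

lemma moment_integrable:
  fixes g :: "real \<Rightarrow> real"
  assumes "continuous_on {0..T} g" "t \<le> T"
  shows "(\<lambda>s. s * g s) integrable_on {0..t}"
  using assms by (intro integrable_continuous_real continuous_intros) (auto elim: continuous_on_subset)

lemma radial_flux_diff:
  assumes "continuous_on {0..T} g" "continuous_on {0..T} h" "t \<le> T"
  shows "radial_flux (\<lambda>s. g s - h s) t = radial_flux g t - radial_flux h t"
  unfolding radial_flux_def diff_divide_distrib [symmetric]
  by (subst integral_diff[symmetric])
    (auto intro!: moment_integrable[OF _ assms(3)] assms simp: right_diff_distrib)

lemma radial_flux_cmult: "radial_flux (\<lambda>s. c * g s) t = c * radial_flux g t"
proof -
  have "(\<lambda>s. s * (c * g s)) = (\<lambda>s. c * (s * g s))" by (auto simp: fun_eq_iff)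
  then show ?thesis by (simp add: radial_flux_def)
qed

lemma moment_deriv:
  assumes "continuous_on {0..T} g" "0 < t" "t < T"
  shows "((\<lambda>t. integral {0..t} (\<lambda>s. s * g s)) has_real_derivative t * g t) (at t)"
proof -
  have "((\<lambda>t. integral {0..t} (\<lambda>s. s * g s)) has_real_derivative t * g t) (at t within {0..T})"
    using assms by (intro integral_has_real_derivative continuous_intros) auto
  then show ?thesis using at_within_Icc_at[of 0 t T] assms by simp
qed

lemma radial_flux_deriv:
  assumes "continuous_on {0..T} g" "0 < t" "t < T"
  shows "(radial_flux g has_real_derivative g t - radial_flux g t / t) (at t)"
proof -
  have "((\<lambda>t. integral {0..t} (\<lambda>s. s * g s) / t) has_real_derivative
     (t * g t * t - integral {0..t} (\<lambda>s. s * g s) * 1) / (t * t)) (at t)"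
    using assms by (intro DERIV_divide moment_deriv) auto
  moreover have "(t * g t * t - integral {0..t} (\<lambda>s. s * g s) * 1) / (t * t) = g t - radial_flux g t / t"
    using assms by (simp add: radial_flux_def field_simps)
  ultimately show ?thesis unfolding radial_flux_def[abs_def] by simp
qed

text \<open>Inside the integral \<open>s \<le> t\<close>, and this \<open>t\<close> cancels the
  denominator, so no singular factor remains.\<close>

lemma abs_moment_le:
  fixes g :: "real \<Rightarrow> real"
  assumes "continuous_on {0..t} g" "0 \<le> t" "continuous_on {0..t} k" "\<And>s. 0 \<le> s \<Longrightarrow> s \<le> t \<Longrightarrow> \<bar>g s\<bar> \<le> k s"
  shows "\<bar>radial_flux g t\<bar> \<le> integral {0..t} k"
proof (cases "t = 0")
  case False
  have "norm (integral {0..t} (\<lambda>s. s * g s)) \<le> integral {0..t} (\<lambda>s. t * k s)"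
  proof (rule integral_norm_bound_integral)
    show "(\<lambda>s. s * g s) integrable_on {0..t}" by (rule moment_integrable[OF assms(1)]) simp
    show "(\<lambda>s. t * k s) integrable_on {0..t}"
      by (intro integrable_continuous_real continuous_intros assms)
    show "norm (s * g s) \<le> t * k s" if "s \<in> {0..t}" for s
      using that assms(4)[of s] by (auto simp: abs_mult intro!: mult_mono)
  qed
  then have "\<bar>integral {0..t} (\<lambda>s. s * g s)\<bar> \<le> t * integral {0..t} k" by simp
  then show ?thesis using False assms(2) unfolding radial_flux_def
    by (simp add: field_simps)
qed simp

lemma abs_radial_flux_le:
  assumes "continuous_on {0..t} g" "0 \<le> t" "\<And>s. 0 \<le> s \<Longrightarrow> s \<le> t \<Longrightarrow> \<bar>g s\<bar> \<le> M"
  shows "\<bar>radial_flux g t\<bar> \<le> M * t"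
  using abs_moment_le[OF assms(1,2), of "\<lambda>_. M"] assms by (simp add: mult.commute)

lemma has_integral_exp_scale:
  fixes l :: real assumes "l \<noteq> 0" "0 \<le> t"
  shows "((\<lambda>s. M * exp (l * s)) has_integral M * (exp (l * t) - 1) / l) {0..t}"
proof -
  have "((\<lambda>s. M * exp (l * s)) has_integral M * exp (l * t) / l - M * exp (l * 0) / l) {0..t}"
    using assms
    by (intro fundamental_theorem_of_calculus)
       (auto intro!: derivative_eq_intros simp flip: has_real_derivative_iff_has_vector_derivative)
  then show ?thesis by (simp add: right_diff_distrib diff_divide_distrib)
qed

text \<open>Integrating the weight \<open>exp (l * s)\<close> gains a factor \<open>1 / l\<close>;
  the second integration, in \<open>abs_radial_pot_le_exp\<close>, gains another one. This is what
  makes \<open>radial_pot\<close> contract for large \<open>l\<close>.\<close>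

lemma abs_radial_flux_le_exp:
  assumes "continuous_on {0..t} g" "0 \<le> t" "0 < l" "\<And>s. 0 \<le> s \<Longrightarrow> s \<le> t \<Longrightarrow> \<bar>g s\<bar> \<le> M * exp (l * s)"
  shows "\<bar>radial_flux g t\<bar> \<le> M / l * exp (l * t)"
proof -
  have M: "M \<ge> 0" using assms(4)[of 0] assms by auto
  have "\<bar>radial_flux g t\<bar> \<le> integral {0..t} (\<lambda>s. M * exp (l * s))"
    using assms by (intro abs_moment_le continuous_intros) auto
  also have "\<dots> = M * (exp (l * t) - 1) / l"
    using has_integral_exp_scale[of l t M] assms by (intro integral_unique) auto
  also have "\<dots> \<le> M / l * exp (l * t)" using M assms by (simp add: field_simps)
  finally show ?thesis .
qed

lemma continuous_on_Icc_bound: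
  fixes g :: "real \<Rightarrow> real"
  assumes "continuous_on {a..b} g"
  obtains M where "0 < M" "\<And>s. s \<in> {a..b} \<Longrightarrow> \<bar>g s\<bar> \<le> M"
proof -
  obtain M where "\<forall>y\<in>g ` {a..b}. norm y \<le> M"
    using compact_imp_bounded[OF compact_continuous_image[OF assms compact_Icc]]
    by (auto simp: bounded_iff)
  then have "\<bar>g s\<bar> \<le> \<bar>M\<bar> + 1" if "s \<in> {a..b}" for s using that by force
  then show ?thesis by (intro that[of "\<bar>M\<bar> + 1"]) auto
qed

lemma continuous_on_radial_flux:
  assumes g: "continuous_on {0..T} g"
  shows "continuous_on {0..T} (radial_flux g)"
  unfolding continuous_on_eq_continuous_within
proof
  fix t assume t: "t \<in> {0..T}"
  show "continuous (at t within {0..T}) (radial_flux g)"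
  proof (cases "t = 0")
    case True
    obtain M where M: "\<And>s. s \<in> {0..T} \<Longrightarrow> \<bar>g s\<bar> \<le> M"
      using continuous_on_Icc_bound[OF g] by blast
    have "(radial_flux g \<longlongrightarrow> 0) (at 0 within {0..T})"
    proof (rule Lim_null_comparison)
      show "\<forall>\<^sub>F x in at 0 within {0..T}. norm (radial_flux g x) \<le> M * x"
        unfolding eventually_at_filter
      proof (rule always_eventually, clarsimp)
        fix x assume "0 \<le> x" "x \<le> T"
        then show "\<bar>radial_flux g x\<bar> \<le> M * x"
          using g M by (intro abs_radial_flux_le) (auto elim: continuous_on_subset)
      qed
      have "((\<lambda>x. M * x) \<longlongrightarrow> M * 0) (at 0 within {0..T})" by (intro tendsto_intros)
      then show "((\<lambda>x. M * x) \<longlongrightarrow> 0) (at 0 within {0..T})" by simp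
    qed
    then show ?thesis using True by (simp add: continuous_within)
  next
    case False
    have "continuous_on {0..T} (\<lambda>t. integral {0..t} (\<lambda>s. s * g s))"
      by (intro indefinite_integral_continuous_1 moment_integrable[OF g]) simp
    then have "continuous (at t within {0..T}) (\<lambda>t. integral {0..t} (\<lambda>s. s * g s))"
      using t by (simp add: continuous_on_eq_continuous_within)
    then show ?thesis unfolding radial_flux_def[abs_def]
      using False by (intro continuous_intros) auto
  qed
qed

lemma radial_pot_deriv:
  assumes "continuous_on {0..T} g" "r \<in> {0..T}"
  shows "(radial_pot g has_real_derivative radial_flux g r) (at r within {0..T})"
  unfolding radial_pot_def[abs_def]
  by (intro integral_has_real_derivative continuous_on_radial_flux assms)

lemma continuous_on_radial_pot:
  assumes "continuous_on {0..T} g" shows "continuous_on {0..T} (radial_pot g)"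
  using radial_pot_deriv[OF assms] by (meson DERIV_continuous_on)

lemma radial_pot_diff:
  assumes "continuous_on {0..T} g" "continuous_on {0..T} h" "t \<le> T"
  shows "radial_pot (\<lambda>s. g s - h s) t = radial_pot g t - radial_pot h t"
proof -
  have "continuous_on {0..t} (radial_flux g)" "continuous_on {0..t} (radial_flux h)"
    using assms by (auto intro: continuous_on_subset[OF continuous_on_radial_flux])
  moreover have "radial_pot (\<lambda>s. g s - h s) t = integral {0..t} (\<lambda>r. radial_flux g r - radial_flux h r)"
    unfolding radial_pot_def using assms by (intro integral_cong radial_flux_diff) auto
  ultimately show ?thesis
    unfolding radial_pot_def by (simp add: integral_diff integrable_continuous_real)
qed

lemma radial_pot_cmult: "radial_pot (\<lambda>s. c * g s) t = c * radial_pot g t"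
  by (simp add: radial_pot_def radial_flux_cmult[abs_def])

lemma abs_radial_pot_le:
  assumes "continuous_on {0..t} g" "0 \<le> t" "\<And>s. 0 \<le> s \<Longrightarrow> s \<le> t \<Longrightarrow> \<bar>g s\<bar> \<le> M"
  shows "\<bar>radial_pot g t\<bar> \<le> M * t\<^sup>2"
proof -
  have M: "M \<ge> 0" using assms(3)[of 0] assms(2) by linarith
  have "norm (radial_pot g t) \<le> (M * t) * (t - 0)" unfolding radial_pot_def
  proof (rule integral_bound)
    fix s assume "s \<in> {0..t}"
    then have "\<bar>radial_flux g s\<bar> \<le> M * s" using assms
      by (intro abs_radial_flux_le) (auto elim: continuous_on_subset)
    also have "\<dots> \<le> M * t" using M \<open>s \<in> {0..t}\<close> by (simp add: mult_left_mono)
    finally show "norm (radial_flux g s) \<le> M * t" by simp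
  qed (use assms in \<open>auto intro!: continuous_on_radial_flux\<close>)
  then show ?thesis by (simp add: power2_eq_square mult_ac)
qed

lemma abs_radial_pot_le_exp:
  assumes "continuous_on {0..t} g" "0 \<le> t" "0 < l" "\<And>s. 0 \<le> s \<Longrightarrow> s \<le> t \<Longrightarrow> \<bar>g s\<bar> \<le> M * exp (l * s)"
  shows "\<bar>radial_pot g t\<bar> \<le> M / l\<^sup>2 * exp (l * t)"
proof -
  have M: "M \<ge> 0" using assms(4)[of 0] assms by auto
  have hi: "((\<lambda>s. (M / l) * exp (l * s)) has_integral (M / l) * (exp (l * t) - 1) / l) {0..t}"
    by (rule has_integral_exp_scale) (use assms in auto)
  have "norm (radial_pot g t) \<le> integral {0..t} (\<lambda>s. M / l * exp (l * s))" unfolding radial_pot_def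
  proof (rule integral_norm_bound_integral)
    show "radial_flux g integrable_on {0..t}"
      by (intro integrable_continuous_real continuous_on_radial_flux assms)
    show "(\<lambda>s. M / l * exp (l * s)) integrable_on {0..t}" using hi by blast
    show "norm (radial_flux g s) \<le> M / l * exp (l * s)" if "s \<in> {0..t}" for s
      using that assms abs_radial_flux_le_exp[of s g l M] continuous_on_subset[OF assms(1), of "{0..s}"]
      by auto
  qed
  also have "\<dots> = (M / l) * (exp (l * t) - 1) / l" using hi by (rule integral_unique)
  also have "\<dots> \<le> M / l\<^sup>2 * exp (l * t)" using M assms by (simp add: field_simps power2_eq_square)
  finally show ?thesis by simp
qed

text \<open>The weight \<open>exp (l * s)\<close> makes \<open>radial_pot\<close> a contraction, so it suffices to look at the maximum of
  \<open>\<bar>d s\<bar> * exp (- l * s)\<close>.\<close>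
lemma radial_gronwall:
  fixes T :: real
  assumes T: "0 \<le> T" and g: "continuous_on {0..T} g" and d: "continuous_on {0..T} d"
    and L: "0 \<le> L" "2 * L \<le> l\<^sup>2" "1 \<le> l" and B: "0 \<le> B"
    and le: "\<And>r. 0 \<le> r \<Longrightarrow> r \<le> T \<Longrightarrow> \<bar>d r\<bar> \<le> A + \<bar>radial_pot g r\<bar>"
    and gd: "\<And>r. 0 \<le> r \<Longrightarrow> r \<le> T \<Longrightarrow> \<bar>g r\<bar> \<le> L * \<bar>d r\<bar> + B"
    and r: "0 \<le> r" "r \<le> T"
  shows "\<bar>d r\<bar> \<le> 2 * (A + B) * exp (l * T)"
proof -
  have A: "A \<ge> 0" using le[of 0] T by auto
  have "continuous_on {0..T} (\<lambda>s. \<bar>d s\<bar> * exp (- l * s))" by (intro continuous_intros d)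
  then obtain p where p: "p \<in> {0..T}" "\<And>s. s \<in> {0..T} \<Longrightarrow> \<bar>d s\<bar> * exp (- l * s) \<le> \<bar>d p\<bar> * exp (- l * p)"
    using continuous_attains_sup[of "{0..T}" "\<lambda>s. \<bar>d s\<bar> * exp (- l * s)"] T by auto
  define M where "M = \<bar>d p\<bar> * exp (- l * p)"
  have dM: "\<bar>d s\<bar> \<le> M * exp (l * s)" if "s \<in> {0..T}" for s
    using p(2)[OF that] by (simp add: M_def exp_minus field_simps)
  have M0: "0 \<le> M" by (simp add: M_def)
  have ge1: "exp (l * s) \<ge> 1" if "s \<ge> 0" for s using that L by simp
  have "\<bar>radial_pot g p\<bar> \<le> (L * M + B) / l\<^sup>2 * exp (l * p)"
  proof (rule abs_radial_pot_le_exp)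
    fix s assume s: "0 \<le> s" "s \<le> p"
    then have "\<bar>g s\<bar> \<le> L * \<bar>d s\<bar> + B" using p by (intro gd) auto
    also have "\<dots> \<le> L * (M * exp (l * s)) + B * exp (l * s)"
      using s p dM[of s] L B ge1[of s] by (intro add_mono mult_left_mono) (auto intro: mult_right_mono[of 1 _ B, simplified] mult_left_mono[of 1 _ B, simplified])
    finally show "\<bar>g s\<bar> \<le> (L * M + B) * exp (l * s)" by (simp add: algebra_simps)
  qed (use p L in \<open>auto intro: continuous_on_subset[OF g]\<close>)
  then have "\<bar>d p\<bar> \<le> A + (L * M + B) / l\<^sup>2 * exp (l * p)" using le[of p] p by auto
  also have "\<dots> \<le> (A + (L * M + B) / l\<^sup>2) * exp (l * p)"
    using mult_left_mono[OF ge1[of p] A] p by (simp add: algebra_simps)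
  finally have "M \<le> A + (L * M + B) / l\<^sup>2"
    unfolding M_def by (simp add: exp_minus field_simps)
  \<comment> \<open>The bound \<open>2 * L \<le> l\<^sup>2\<close> makes the Lipschitz part at most
    \<open>M / 2\<close>, which is absorbed on the left; \<open>1 \<le> l\<close> keeps the rest
    below \<open>B\<close>.\<close>
  also have "(L * M + B) / l\<^sup>2 \<le> M / 2 + B"
  proof -
    have l2: "1 \<le> l\<^sup>2" using L by (simp add: power2_eq_square mult_ge1_I)
    have "L * M \<le> l\<^sup>2 * (M / 2)" using mult_right_mono[OF L(2) M0] by simp
    moreover have "B \<le> l\<^sup>2 * B" using mult_right_mono[OF l2 B] by simp
    ultimately have "L * M + B \<le> (M / 2 + B) * l\<^sup>2" by (simp add: algebra_simps)
    then show ?thesis using l2 by (subst pos_divide_le_eq) auto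
  qed
  finally have "M \<le> 2 * (A + B)" by simp
  then have "M * exp (l * r) \<le> 2 * (A + B) * exp (l * T)"
    using L r A B by (intro mult_mono) auto
  then show ?thesis using dM[of r] r by simp
qed

text \<open>Banach's theorem is applied to \<open>y r = exp (- l * r) * x r\<close> among the
  bounded continuous functions. With this weight the map contracts by \<open>1/2\<close> on the
  whole half-line, so a global solution arises at once, without continuation from interval to
  interval.\<close>

lemma radial_pot_fixpoint_exists:
  fixes G :: "real \<Rightarrow> real \<Rightarrow> real" and a :: real
  assumes G_cont: "\<And>x. continuous_on {0..} x \<Longrightarrow> continuous_on {0..} (\<lambda>s. G s (x s))"
    and G_lip: "\<And>s x y. 0 \<le> s \<Longrightarrow> \<bar>G s x - G s y\<bar> \<le> L * \<bar>x - y\<bar>"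
    and G_0: "\<And>s. 0 \<le> s \<Longrightarrow> G s 0 = 0" and L: "0 \<le> L"
  shows "\<exists>x. continuous_on {0..} x \<and> (\<forall>r\<ge>0. x r = a - radial_pot (\<lambda>s. G s (x s)) r)"
proof -
  define l where "l = 2 * L + 1"
  have l: "l \<ge> 1" "2 * L \<le> l\<^sup>2" "l > 0" using L by (auto simp: l_def power2_eq_square algebra_simps)
  define W where "W y s = exp (l * s) * apply_bcontfun y s" for y :: "real \<Rightarrow>\<^sub>C real" and s
  define N where "N y r = exp (- l * r) * (a - radial_pot (\<lambda>s. G s (W y s)) r)" for y r
  have Wc: "continuous_on S (W y)" for y S
    unfolding W_def[abs_def] by (intro continuous_intros continuous_on_apply_bcontfun)
  have GWc: "continuous_on {0..T} (\<lambda>s. G s (W y s))" for y T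
    by (rule continuous_on_subset[OF G_cont[OF Wc]]) auto
  have bound: "\<bar>radial_pot (\<lambda>s. G s (W y s)) r - radial_pot (\<lambda>s. G s (W z s)) r\<bar> \<le> L * dist y z / l\<^sup>2 * exp (l * r)"
    if "r \<ge> 0" for y z r
  proof -
    have "\<bar>radial_pot (\<lambda>s. G s (W y s) - G s (W z s)) r\<bar> \<le> L * dist y z / l\<^sup>2 * exp (l * r)"
    proof (rule abs_radial_pot_le_exp)
      fix s :: real assume s: "0 \<le> s" "s \<le> r"
      have "\<bar>G s (W y s) - G s (W z s)\<bar> \<le> L * \<bar>W y s - W z s\<bar>" by (rule G_lip) fact
      also have "\<bar>W y s - W z s\<bar> = exp (l * s) * dist (apply_bcontfun y s) (apply_bcontfun z s)"
        by (simp add: W_def dist_real_def abs_mult flip: right_diff_distrib)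
      also have "\<dots> \<le> exp (l * s) * dist y z" by (intro mult_left_mono dist_bounded) simp
      finally show "\<bar>G s (W y s) - G s (W z s)\<bar> \<le> L * dist y z * exp (l * s)"
        using mult_left_mono[OF _ L] by (fastforce simp: mult_ac)
    qed (use that l in \<open>auto intro!: continuous_intros GWc\<close>)
    then show ?thesis by (subst (asm) radial_pot_diff[OF GWc GWc order_refl])
  qed
  \<comment> \<open>Hence \<open>N 0\<close> is the bounded function
    \<open>exp (- l * r) * a\<close>. As \<open>N y\<close> stays within \<open>dist y 0 / 2\<close>
    of it, bounded functions are mapped to bounded functions; this is the purpose of
    \<open>G s 0 = 0\<close>.\<close>
  have G0: "radial_pot (\<lambda>s. G s (W 0 s)) r = 0" if "r \<ge> 0" for r
  proof -
    have "radial_pot (\<lambda>s. G s (W 0 s)) r = radial_pot (\<lambda>s. 0 * 0) r"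
      by (rule radial_pot_cong) (simp add: W_def G_0)
    then show ?thesis by (subst (asm) radial_pot_cmult) simp
  qed
  have half: "L * D / l\<^sup>2 \<le> D / 2" if "D \<ge> 0" for D
    using mult_right_mono[OF l(2) that] l by (simp add: field_simps)
  have Ndiff: "\<bar>N y r - N z r\<bar> \<le> dist y z / 2" if "r \<ge> 0" for y z r
  proof -
    have "\<bar>N y r - N z r\<bar> = exp (- l * r) * \<bar>radial_pot (\<lambda>s. G s (W y s)) r - radial_pot (\<lambda>s. G s (W z s)) r\<bar>"
      unfolding N_def right_diff_distrib[symmetric] abs_mult by simp
    also have "\<dots> \<le> exp (- l * r) * (L * dist y z / l\<^sup>2 * exp (l * r))"
      by (intro mult_left_mono bound that) simp
    also have "\<dots> = L * dist y z / l\<^sup>2" by (simp add: exp_minus)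
    also have "\<dots> \<le> dist y z / 2" by (rule half) simp
    finally show ?thesis .
  qed
  have N0: "N 0 r = exp (- l * r) * a" if "r \<ge> 0" for r using that by (simp add: N_def G0)
  \<comment> \<open>The type of bounded continuous functions lives on the whole line, so functions
    on the half-line are extended by their value at \<open>0\<close>.\<close>
  have Nc: "(\<lambda>r. N y (max 0 r)) \<in> bcontfun" for y
  proof (rule bcontfun_normI)
    have "continuous_on {0..} (radial_pot (\<lambda>s. G s (W y s)))"
      unfolding continuous_on_eq_continuous_within
    proof
      fix t :: real assume "t \<in> {0..}"
      then have "continuous (at t within {0..t+1}) (radial_pot (\<lambda>s. G s (W y s)))"
        using continuous_on_radial_pot[OF GWc[of "t+1" y]] by (auto simp: continuous_on_eq_continuous_within)
      moreover have "at t within {0..t+1} = at t within {0..}"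
        by (rule at_within_nhd[of _ "{t-1<..<t+1}"]) auto
      ultimately show "continuous (at t within {0..}) (radial_pot (\<lambda>s. G s (W y s)))" by simp
    qed
    then have "continuous_on {0..} (N y)" unfolding N_def[abs_def] by (intro continuous_intros)
    then show "continuous_on UNIV (\<lambda>r. N y (max 0 r))"
      by (rule continuous_on_compose2) (auto intro!: continuous_intros)
    show "norm (N y (max 0 r)) \<le> \<bar>a\<bar> + dist y 0 / 2" for r
    proof -
      have "exp (- l * max 0 r) * \<bar>a\<bar> \<le> 1 * \<bar>a\<bar>" by (rule mult_right_mono) (use l in auto)
      then have "\<bar>N 0 (max 0 r)\<bar> \<le> \<bar>a\<bar>" by (simp add: N0 abs_mult)
      then show ?thesis using Ndiff[of "max 0 r" y 0] abs_triangle_ineq2[of "N y (max 0 r)" "N 0 (max 0 r)"]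
        by (simp del: dist_0_norm dist_norm)
    qed
  qed
  define \<Phi> where "\<Phi> y = Bcontfun (\<lambda>r. N y (max 0 r))" for y
  have \<Phi>: "apply_bcontfun (\<Phi> y) r = N y (max 0 r)" for y r
    unfolding \<Phi>_def using Nc by (simp add: Bcontfun_inverse)
  have "\<exists>!y. \<Phi> y = y"
  proof (rule banach_fix_type)
    show "\<forall>y z. dist (\<Phi> y) (\<Phi> z) \<le> 1/2 * dist y z"
    proof (intro allI dist_bound)
      fix y z x
      show "dist (apply_bcontfun (\<Phi> y) x) (apply_bcontfun (\<Phi> z) x) \<le> 1/2 * dist y z"
        using Ndiff[of "max 0 x" y z] by (simp add: \<Phi> dist_real_def)
    qed
  qed auto
  then obtain y where y: "\<Phi> y = y" by blast
  have "W y r = a - radial_pot (\<lambda>s. G s (W y s)) r" if "r \<ge> 0" for r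
  proof -
    have "apply_bcontfun y r = N y r" using \<Phi>[of y r] y that by simp
    then show ?thesis unfolding W_def[of y r] by (simp add: N_def exp_minus)
  qed
  then show ?thesis using Wc[of "{0..}" y] by blast
qed

lemma radial_pot_solves:
  fixes r :: real and x :: "real \<Rightarrow> real"
  assumes g: "continuous_on {0..} g" and x: "\<And>r. r \<ge> 0 \<Longrightarrow> x r = a - radial_pot g r"
  shows "r \<ge> 0 \<Longrightarrow> (x has_real_derivative - radial_flux g r) (at r within {0..})" (is "_ \<Longrightarrow> ?A r")
    and "r > 0 \<Longrightarrow> (x has_real_derivative - radial_flux g r) (at r)" (is "_ \<Longrightarrow> ?B")
    and "r > 0 \<Longrightarrow> (radial_flux g has_real_derivative g r - radial_flux g r / r) (at r)" (is "_ \<Longrightarrow> ?C")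
proof -
  have gT: "continuous_on {0..T} g" for T by (rule continuous_on_subset[OF g]) auto
  have A: "?A r" if r: "r \<ge> 0" for r
  proof -
    have "((\<lambda>r. a - radial_pot g r) has_real_derivative - radial_flux g r) (at r within {0..r+1})"
      using DERIV_diff[OF DERIV_const radial_pot_deriv[OF gT[of "r+1"], of r], of a] r by simp
    then have "(x has_real_derivative - radial_flux g r) (at r within {0..r+1})"
      by (rule has_field_derivative_transform_within[where d = 1]) (use x r in auto)
    moreover have "at r within {0..r+1} = at r within {0..}"
      by (rule at_within_nhd[of _ "{r-1<..<r+1}"]) auto
    ultimately show ?thesis by simp
  qed
  show "r \<ge> 0 \<Longrightarrow> ?A r" by (rule A)
  show ?B if "r > 0"
  proof -
    have "at r within {0..} = at r" using that by (intro at_within_interior) auto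
    then show ?thesis using A[of r] that by simp
  qed
  show ?C if "r > 0" using that gT[of "r+1"] by (intro radial_flux_deriv[of "r+1"]) auto
qed

text \<open>The regularity condition \<open>x' 0 = 0\<close> excludes the logarithmic part of \<open>x\<close>: otherwise
  \<open>r * x' r\<close> would tend to a nonzero constant, and the mean value theorem would make
  the difference quotients of \<open>x\<close> at \<open>0\<close> unbounded.\<close>
lemma radial_ode_imp_pot:
  assumes T: "T > 0" and g: "continuous_on {0..T} g"
    and x: "\<And>r. r \<in> {0..T} \<Longrightarrow> (x has_real_derivative x' r) (at r within {0..T})"
    and x': "\<And>r. r \<in> {0<..<T} \<Longrightarrow> (x' has_real_derivative x'' r) (at r)"
    and eq: "\<And>r. r \<in> {0<..<T} \<Longrightarrow> x'' r + x' r / r + g r = 0"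
    and 0: "x' 0 = 0" and r: "r \<in> {0..T}"
  shows "x r = x 0 - radial_pot g r"
proof -
  have xat: "(x has_real_derivative x' r) (at r)" if "r \<in> {0<..<T}" for r
    using x[of r] that at_within_Icc_at[of 0 r T] by auto
  have xc: "continuous_on {0..T} x" using x by (meson DERIV_continuous_on)
  \<comment> \<open>By the equation \<open>p\<close> is a constant \<open>c\<close>, that is
    \<open>x' r = c / r - radial_flux g r\<close>; \<open>c\<close> is the coefficient of the
    logarithm.\<close>
  define p where "p r = r * x' r + integral {0..r} (\<lambda>s. s * g s)" for r
  have pd: "(p has_real_derivative 0) (at r)" if r: "r \<in> {0<..<T}" for r
  proof -
    have "(p has_real_derivative 1 * x' r + x'' r * r + r * g r) (at r)"
      unfolding p_def[abs_def] using r by (intro DERIV_add DERIV_mult x' moment_deriv[OF g] DERIV_ident) auto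
    moreover have "1 * x' r + x'' r * r + r * g r = r * (x'' r + x' r / r + g r)"
      using r by (simp add: field_simps)
    ultimately show ?thesis using eq[OF r] by simp
  qed
  have "\<exists>c. \<forall>r\<in>{0<..<T}. p r = c"
    by (rule has_field_derivative_zero_constant) (auto intro!: has_field_derivative_at_within[OF pd])
  then obtain c where c: "\<And>r. r \<in> {0<..<T} \<Longrightarrow> p r = c" by blast
  have x'c: "x' r = c / r - radial_flux g r" if "r \<in> {0<..<T}" for r
    using c[OF that] that by (simp add: p_def radial_flux_def field_simps)
  obtain M where M: "\<And>s. s \<in> {0..T} \<Longrightarrow> \<bar>radial_flux g s\<bar> \<le> M"
    using continuous_on_Icc_bound[OF continuous_on_radial_flux[OF g]] by blast
  have "c = 0"
  proof (rule ccontr)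
    assume "c \<noteq> 0"
    have "((\<lambda>r. (x r - x 0) / (r - 0)) \<longlongrightarrow> 0) (at 0 within {0..T})"
      using x[of 0] T 0 by (simp add: has_field_derivative_iff)
    then have "\<forall>\<^sub>F r in at 0 within {0..T}. \<bar>(x r - x 0) / r\<bar> < 1"
      by (auto dest!: tendstoD[of _ _ _ 1] simp: dist_real_def)
    then obtain d where d: "d > 0" "\<And>r. r \<in> {0..T} \<Longrightarrow> r \<noteq> 0 \<Longrightarrow> \<bar>r\<bar> < d \<Longrightarrow> \<bar>(x r - x 0) / r\<bar> < 1"
      by (auto simp: eventually_at dist_real_def)
    \<comment> \<open>Chosen so that \<open>(\<bar>M\<bar> + 1) * e = \<bar>c\<bar> / 2\<close>,
      which contradicts the bound \<open>\<bar>c\<bar> < (M + 1) * z\<close> obtained below for some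
      \<open>z < r \<le> e\<close>.\<close>
    define e where "e = \<bar>c\<bar> / (2 * (\<bar>M\<bar> + 1))"
    have "e > 0" using \<open>c \<noteq> 0\<close> by (simp add: e_def)
    define r where "r = min (min (d/2) (T/2)) e"
    have r: "r > 0" "r < d" "r < T" "r \<le> e" using d T \<open>e > 0\<close> by (auto simp: r_def min_def)
    obtain z where z: "0 < z" "z < r" "x r - x 0 = (r - 0) * x' z"
    proof -
      have "\<exists>l z. 0 < z \<and> z < r \<and> (x has_real_derivative l) (at z) \<and> x r - x 0 = (r - 0) * l"
        using r by (intro MVT) (auto intro: continuous_on_subset[OF xc] xat simp: real_differentiable_def intro!: exI[of _ "x' _"])
      then obtain l z where lz: "0 < z" "z < r" "(x has_real_derivative l) (at z)" "x r - x 0 = (r - 0) * l" by blast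
      moreover have "l = x' z" using lz r by (intro DERIV_unique[OF _ xat]) auto
      ultimately show ?thesis using that by blast
    qed
    have "\<bar>x' z\<bar> < 1" using d(2)[of r] r z by simp
    moreover have "x' z = c / z - radial_flux g z" using z r by (intro x'c) auto
    moreover have "\<bar>radial_flux g z\<bar> \<le> M" using z r by (intro M) auto
    ultimately have "\<bar>c / z\<bar> < M + 1" by linarith
    then have "\<bar>c\<bar> < (M + 1) * z" using z by (simp add: field_simps)
    also have "\<dots> \<le> (\<bar>M\<bar> + 1) * r" using z by (intro mult_mono) auto
    also have "\<dots> \<le> \<bar>c\<bar> / 2" using r(4) by (simp add: e_def field_simps)
    finally show False by simp
  qed
  define q where "q r = x r + radial_pot g r" for r
  have qc: "continuous_on {0..T} q" unfolding q_def[abs_def] by (intro continuous_intros xc continuous_on_radial_pot g)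
  have qd: "(q has_real_derivative 0) (at r)" if r: "0 < r" "r < T" for r
  proof -
    have "(radial_pot g has_real_derivative radial_flux g r) (at r)"
      using radial_pot_deriv[OF g, of r] r at_within_Icc_at[of 0 r T] by auto
    then have "(q has_real_derivative x' r + radial_flux g r) (at r)"
      unfolding q_def[abs_def] using r by (intro DERIV_add xat) auto
    then show ?thesis using x'c[of r] r \<open>c = 0\<close> by simp
  qed
  have "q r = q 0"
    by (rule DERIV_isconst2[OF T qc qd]) (use r in auto)
  then show ?thesis by (simp add: q_def)
qed

section \<open>The radial initial value problem and its dependence on the initial value\<close>

lemma radial_flux_uniform_le:
  assumes "continuous_on {0..T} g" "continuous_on {0..T} h" "0 \<le> r" "r \<le> T"
    and "\<And>s. 0 \<le> s \<Longrightarrow> s \<le> T \<Longrightarrow> \<bar>g s - h s\<bar> \<le> e"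
  shows "\<bar>radial_flux g r - radial_flux h r\<bar> \<le> e * T"
proof -
  have e: "e \<ge> 0" using assms(5)[of 0] assms by linarith
  have "\<bar>radial_flux (\<lambda>s. g s - h s) r\<bar> \<le> e * r"
    using assms by (intro abs_radial_flux_le continuous_intros) (auto elim: continuous_on_subset)
  also have "\<dots> \<le> e * T" using e assms by (intro mult_left_mono) auto
  finally show ?thesis using radial_flux_diff[OF assms(1,2,4)] by simp
qed

text \<open>Separate continuity would not suffice; the continuity in \<open>a\<close> is uniform for
  \<open>r\<close> in compact intervals, and this splits the error into two halves.\<close>

lemma joint_continuity:
  fixes x :: "real \<Rightarrow> real \<Rightarrow> real"
  assumes c: "\<And>a. continuous_on {0..} (x a)"
    and u: "\<And>a T e. e > 0 \<Longrightarrow> T \<ge> 0 \<Longrightarrow> \<exists>d>0. \<forall>b. \<bar>b - a\<bar> < d \<longrightarrow> (\<forall>r\<in>{0..T}. \<bar>x b r - x a r\<bar> \<le> e)"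
  shows "continuous_on (UNIV \<times> {0..}) (\<lambda>p. x (fst p) (snd p))"
  unfolding continuous_on_iff
proof (intro ballI allI impI)
  fix p :: "real \<times> real" and e :: real assume p: "p \<in> UNIV \<times> {0..}" and e: "0 < e"
  obtain d1 where d1: "d1 > 0" "\<And>b r. \<bar>b - fst p\<bar> < d1 \<Longrightarrow> r \<in> {0..snd p + 1} \<Longrightarrow> \<bar>x b r - x (fst p) r\<bar> \<le> e/2"
    using u[of "e/2" "snd p + 1" "fst p"] e p by (auto simp: mem_Times_iff)
  obtain d2 where d2: "d2 > 0" "\<And>r. r \<ge> 0 \<Longrightarrow> \<bar>r - snd p\<bar> < d2 \<Longrightarrow> \<bar>x (fst p) r - x (fst p) (snd p)\<bar> < e/2"
  proof -
    have "\<exists>d>0. \<forall>r\<in>{0..}. dist r (snd p) < d \<longrightarrow> dist (x (fst p) r) (x (fst p) (snd p)) < e/2"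
      using c[of "fst p"] half_gt_zero[OF e] p unfolding continuous_on_iff mem_Times_iff by blast
    then show ?thesis using that by (auto simp: dist_real_def)
  qed
  show "\<exists>d>0. \<forall>q\<in>UNIV \<times> {0..}. dist q p < d \<longrightarrow> dist (x (fst q) (snd q)) (x (fst p) (snd p)) < e"
  proof (intro exI conjI ballI impI)
    show "0 < min (min d1 d2) 1" using d1 d2 by simp
    fix q :: "real \<times> real" assume q: "q \<in> UNIV \<times> {0..}" and dd: "dist q p < min (min d1 d2) 1"
    have "dist (fst q) (fst p) \<le> dist q p" "dist (snd q) (snd p) \<le> dist q p"
      by (rule dist_fst_le, rule dist_snd_le)
    then have *: "\<bar>fst q - fst p\<bar> < min (min d1 d2) 1" "\<bar>snd q - snd p\<bar> < min (min d1 d2) 1"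
      using dd by (auto simp: dist_real_def)
    have "\<bar>x (fst q) (snd q) - x (fst p) (snd q)\<bar> \<le> e/2" using * q by (intro d1) (auto simp: mem_Times_iff)
    moreover have "\<bar>x (fst p) (snd q) - x (fst p) (snd p)\<bar> < e/2" using * q by (intro d2) (auto simp: mem_Times_iff)
    ultimately show "dist (x (fst q) (snd q)) (x (fst p) (snd p)) < e" unfolding dist_real_def by linarith
  qed
qed

lemma cont_Ici:
  fixes x :: "real \<Rightarrow> real"
  assumes "\<And>T. continuous_on {0..T} x" shows "continuous_on {0..} x"
  unfolding continuous_on_eq_continuous_within
proof
  fix t :: real assume "t \<in> {0..}"
  then have "continuous (at t within {0..t+1}) x"
    using assms[of "t+1"] by (auto simp: continuous_on_eq_continuous_within)
  moreover have "at t within {0..t+1} = at t within {0..}"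
    by (rule at_within_nhd[of _ "{t-1<..<t+1}"]) auto
  ultimately show "continuous (at t within {0..}) x" by simp
qed

text \<open>The global bound on \<open>F1\<close> lets every solution exist for all
  \<open>r \<ge> 0\<close>, so no maximal interval has to be tracked. \<open>F 0 = 0\<close>
  supplies the hypothesis \<open>G_0\<close> of \<open>radial_pot_fixpoint_exists\<close>.\<close>

locale radial_flow =
  fixes F F1 :: "real \<Rightarrow> real" and L :: real
  assumes F_deriv: "\<And>x. (F has_real_derivative F1 x) (at x)"
    and F1_cont: "continuous_on UNIV F1"
    and F1_bound: "\<And>x. \<bar>F1 x\<bar> \<le> L"
    and F_0: "F 0 = 0"
begin

lemma L_nonneg: "0 \<le> L" using F1_bound[of 0] by linarith

lemma F_lip: "\<bar>F x - F y\<bar> \<le> L * \<bar>x - y\<bar>"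
  using field_differentiable_bound[of UNIV F F1 L x y] F_deriv F1_bound by (auto simp: real_norm_def)

lemma F_cont: "continuous_on S F"
  using F_deriv by (meson DERIV_continuous_on continuous_on_subset has_field_derivative_at_within)

lemma F1_cont': "continuous_on S F1"
  using F1_cont by (rule continuous_on_subset) auto

definition weight :: real where "weight = 2 * L + 1"

lemma weight: "1 \<le> weight" "2 * L \<le> weight\<^sup>2" "0 < weight"
  using L_nonneg by (auto simp: weight_def power2_eq_square algebra_simps)

definition sol :: "real \<Rightarrow> real \<Rightarrow> real" where
  "sol a = (SOME x. continuous_on {0..} x \<and> (\<forall>r\<ge>0. x r = a - radial_pot (\<lambda>s. F (x s)) r))"

definition sol' :: "real \<Rightarrow> real \<Rightarrow> real" where
  "sol' a r = - radial_flux (\<lambda>s. F (sol a s)) r"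

text \<open>The solution of the linearization at \<open>sol a\<close> with initial value
  \<open>1\<close> and initial slope \<open>0\<close>; \<open>sol_param_deriv\<close> identifies it
  with the derivative of \<open>sol\<close> in \<open>a\<close>.\<close>

definition var :: "real \<Rightarrow> real \<Rightarrow> real" where
  "var a = (SOME x. continuous_on {0..} x \<and> (\<forall>r\<ge>0. x r = 1 - radial_pot (\<lambda>s. F1 (sol a s) * x s) r))"

definition var' :: "real \<Rightarrow> real \<Rightarrow> real" where
  "var' a r = - radial_flux (\<lambda>s. F1 (sol a s) * var a s) r"

lemma sol_ex: "continuous_on {0..} (sol a) \<and> (\<forall>r\<ge>0. sol a r = a - radial_pot (\<lambda>s. F (sol a s)) r)"
proof -
  have "\<exists>x. continuous_on {0..} x \<and> (\<forall>r\<ge>0. x r = a - radial_pot (\<lambda>s. F (x s)) r)"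
  proof (rule radial_pot_fixpoint_exists[of "\<lambda>s. F" L])
    show "continuous_on {0..} (\<lambda>s. F (x s))" if "continuous_on {0..} x" for x
      by (rule continuous_on_compose2[OF F_cont[of UNIV] that]) auto
  qed (use F_lip F_0 L_nonneg in auto)
  then show ?thesis unfolding sol_def by (rule someI_ex)
qed

lemma sol_cont: "continuous_on {0..} (sol a)" and sol_eq: "r \<ge> 0 \<Longrightarrow> sol a r = a - radial_pot (\<lambda>s. F (sol a s)) r"
  using sol_ex by auto

lemma sol_contT: "continuous_on {0..T} (sol a)"
  by (rule continuous_on_subset[OF sol_cont]) auto

lemma F_sol_cont: "continuous_on {0..} (\<lambda>s. F (sol a s))" "continuous_on {0..T} (\<lambda>s. F (sol a s))"
  by (rule continuous_on_compose2[OF F_cont[of UNIV]], auto intro: sol_cont sol_contT)+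

lemma F1_sol_cont: "continuous_on {0..} (\<lambda>s. F1 (sol a s))" "continuous_on {0..T} (\<lambda>s. F1 (sol a s))"
  by (rule continuous_on_compose2[OF F1_cont], auto intro: sol_cont sol_contT)+

lemma var_ex: "continuous_on {0..} (var a) \<and> (\<forall>r\<ge>0. var a r = 1 - radial_pot (\<lambda>s. F1 (sol a s) * var a s) r)"
proof -
  have "\<exists>x. continuous_on {0..} x \<and> (\<forall>r\<ge>0. x r = 1 - radial_pot (\<lambda>s. F1 (sol a s) * x s) r)"
  proof (rule radial_pot_fixpoint_exists[of "\<lambda>s x. F1 (sol a s) * x" L])
    show "continuous_on {0..} (\<lambda>s. F1 (sol a s) * x s)" if "continuous_on {0..} x" for x
      by (intro continuous_intros that F1_sol_cont)
    show "\<bar>F1 (sol a s) * x - F1 (sol a s) * y\<bar> \<le> L * \<bar>x - y\<bar>" for s x y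
      using F1_bound[of "sol a s"] by (simp add: abs_mult mult_right_mono flip: right_diff_distrib)
  qed (use L_nonneg in auto)
  then show ?thesis unfolding var_def by (rule someI_ex)
qed

lemma var_cont: "continuous_on {0..} (var a)" and var_eq: "r \<ge> 0 \<Longrightarrow> var a r = 1 - radial_pot (\<lambda>s. F1 (sol a s) * var a s) r"
  using var_ex by auto

lemma var_contT: "continuous_on {0..T} (var a)"
  by (rule continuous_on_subset[OF var_cont]) auto

lemma F1_var_cont: "continuous_on {0..} (\<lambda>s. F1 (sol a s) * var a s)" "continuous_on {0..T} (\<lambda>s. F1 (sol a s) * var a s)"
  by (intro continuous_intros F1_sol_cont var_cont var_contT)+

lemma sol_0 [simp]: "sol a 0 = a" and var_0 [simp]: "var a 0 = 1"
  and sol'_0 [simp]: "sol' a 0 = 0" and var'_0 [simp]: "var' a 0 = 0"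
  using sol_eq[of 0 a] var_eq[of 0 a] by (auto simp: sol'_def var'_def)

lemma sol_deriv_within: "r \<ge> 0 \<Longrightarrow> (sol a has_real_derivative sol' a r) (at r within {0..})"
  and sol_deriv: "r > 0 \<Longrightarrow> (sol a has_real_derivative sol' a r) (at r)"
  using radial_pot_solves(1,2)[OF F_sol_cont(1)[of a] sol_eq] by (auto simp: sol'_def)

lemma sol'_deriv: "r > 0 \<Longrightarrow> (sol' a has_real_derivative - F (sol a r) - sol' a r / r) (at r)"
  using radial_pot_solves(3)[OF F_sol_cont(1)[of a] sol_eq, THEN DERIV_minus] by (auto simp: sol'_def[abs_def])

lemma var_deriv_within: "r \<ge> 0 \<Longrightarrow> (var a has_real_derivative var' a r) (at r within {0..})"
  and var_deriv: "r > 0 \<Longrightarrow> (var a has_real_derivative var' a r) (at r)"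
  using radial_pot_solves(1,2)[OF F1_var_cont(1)[of a] var_eq] by (auto simp: var'_def)

lemma var'_deriv: "r > 0 \<Longrightarrow> (var' a has_real_derivative - F1 (sol a r) * var a r - var' a r / r) (at r)"
  using radial_pot_solves(3)[OF F1_var_cont(1)[of a] var_eq, THEN DERIV_minus] by (auto simp: var'_def[abs_def])

lemma sol'_cont: "continuous_on {0..} (sol' a)"
  unfolding sol'_def[abs_def] by (intro continuous_intros cont_Ici continuous_on_radial_flux F_sol_cont)

lemma var'_cont: "continuous_on {0..} (var' a)"
  unfolding var'_def[abs_def] by (intro continuous_intros cont_Ici continuous_on_radial_flux F1_var_cont)

section \<open>Uniqueness and dependence on the initial value\<close>

lemma sol_unique:
  assumes x: "continuous_on {0..T} x" "\<And>r. r \<in> {0..T} \<Longrightarrow> x r = a - radial_pot (\<lambda>s. F (x s)) r"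
    and r: "r \<in> {0..T}"
  shows "x r = sol a r"
proof -
  have Fx: "continuous_on {0..T} (\<lambda>s. F (x s))"
    by (rule continuous_on_compose2[OF F_cont[of UNIV] x(1)]) auto
  have "\<bar>x r - sol a r\<bar> \<le> 2 * (0 + 0) * exp (weight * T)"
  proof (rule radial_gronwall[where d = "\<lambda>s. x s - sol a s" and g = "\<lambda>s. F (x s) - F (sol a s)" and L = L])
    fix r assume "0 \<le> r" "r \<le> T"
    then show "\<bar>x r - sol a r\<bar> \<le> 0 + \<bar>radial_pot (\<lambda>s. F (x s) - F (sol a s)) r\<bar>"
      using x(2)[of r] sol_eq[of r a] by (simp add: radial_pot_diff[OF Fx F_sol_cont(2)])
    show "\<bar>F (x r) - F (sol a r)\<bar> \<le> L * \<bar>x r - sol a r\<bar> + 0" using F_lip by simp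
  qed (use r weight L_nonneg in \<open>auto intro!: continuous_intros Fx F_sol_cont x sol_contT\<close>)
  then show ?thesis by simp
qed

lemma var_unique:
  assumes x: "continuous_on {0..T} x" "\<And>r. r \<in> {0..T} \<Longrightarrow> x r = c - radial_pot (\<lambda>s. F1 (sol a s) * x s) r"
    and r: "r \<in> {0..T}"
  shows "x r = c * var a r"
proof -
  have Fx: "continuous_on {0..T} (\<lambda>s. F1 (sol a s) * x s)"
    by (intro continuous_intros F1_sol_cont x)
  have Fv: "continuous_on {0..T} (\<lambda>s. c * (F1 (sol a s) * var a s))"
    by (intro continuous_intros F1_sol_cont var_contT)
  have "\<bar>x r - c * var a r\<bar> \<le> 2 * (0 + 0) * exp (weight * T)"
  proof (rule radial_gronwall[where d = "\<lambda>s. x s - c * var a s" and g = "\<lambda>s. F1 (sol a s) * x s - c * (F1 (sol a s) * var a s)" and L = L])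
    fix r assume "0 \<le> r" "r \<le> T"
    then show "\<bar>x r - c * var a r\<bar> \<le> 0 + \<bar>radial_pot (\<lambda>s. F1 (sol a s) * x s - c * (F1 (sol a s) * var a s)) r\<bar>"
      using x(2)[of r] var_eq[of r a]
      by (simp add: radial_pot_diff[OF Fx Fv] radial_pot_cmult right_diff_distrib)
    have "F1 (sol a r) * x r - c * (F1 (sol a r) * var a r) = F1 (sol a r) * (x r - c * var a r)"
      by (simp add: algebra_simps)
    then show "\<bar>F1 (sol a r) * x r - c * (F1 (sol a r) * var a r)\<bar> \<le> L * \<bar>x r - c * var a r\<bar> + 0"
      using F1_bound[of "sol a r"] by (simp add: abs_mult mult_right_mono)
  qed (use r weight L_nonneg in \<open>auto intro!: continuous_intros Fx Fv x var_contT\<close>)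
  then show ?thesis by simp
qed

lemma sol_lip:
  assumes r: "0 \<le> r" "r \<le> T"
  shows "\<bar>sol b r - sol a r\<bar> \<le> 2 * exp (weight * T) * \<bar>b - a\<bar>"
proof -
  have "\<bar>sol b r - sol a r\<bar> \<le> 2 * (\<bar>b - a\<bar> + 0) * exp (weight * T)"
  proof (rule radial_gronwall[where d = "\<lambda>s. sol b s - sol a s" and g = "\<lambda>s. F (sol b s) - F (sol a s)" and L = L])
    fix r assume "0 \<le> r" "r \<le> T"
    then show "\<bar>sol b r - sol a r\<bar> \<le> \<bar>b - a\<bar> + \<bar>radial_pot (\<lambda>s. F (sol b s) - F (sol a s)) r\<bar>"
      using sol_eq[of r b] sol_eq[of r a] by (simp add: radial_pot_diff[OF F_sol_cont(2) F_sol_cont(2)])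
    show "\<bar>F (sol b r) - F (sol a r)\<bar> \<le> L * \<bar>sol b r - sol a r\<bar> + 0" using F_lip by simp
  qed (use r weight L_nonneg in \<open>auto intro!: continuous_intros F_sol_cont sol_contT\<close>)
  then show ?thesis by (simp add: mult_ac)
qed

lemma var_bound:
  assumes r: "0 \<le> r" "r \<le> T"
  shows "\<bar>var a r\<bar> \<le> 2 * exp (weight * T)"
proof -
  have "\<bar>var a r\<bar> \<le> 2 * (1 + 0) * exp (weight * T)"
  proof (rule radial_gronwall[where d = "\<lambda>s. var a s" and g = "\<lambda>s. F1 (sol a s) * var a s" and L = L])
    fix r assume "0 \<le> r" "r \<le> T"
    then show "\<bar>var a r\<bar> \<le> 1 + \<bar>radial_pot (\<lambda>s. F1 (sol a s) * var a s) r\<bar>"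
      using var_eq[of r a] by simp
    show "\<bar>F1 (sol a r) * var a r\<bar> \<le> L * \<bar>var a r\<bar> + 0"
      using F1_bound[of "sol a r"] by (simp add: abs_mult mult_right_mono)
  qed (use r weight L_nonneg in \<open>auto intro!: F1_var_cont var_contT\<close>)
  then show ?thesis by simp
qed

lemma sol_uniform:
  assumes "e > 0" "T \<ge> 0"
  shows "\<exists>d>0. \<forall>b. \<bar>b - a\<bar> < d \<longrightarrow> (\<forall>r\<in>{0..T}. \<bar>sol b r - sol a r\<bar> \<le> e)"
proof (intro exI conjI allI impI ballI)
  show "e / (2 * exp (weight * T)) > 0" using assms by simp
  fix b r assume b: "\<bar>b - a\<bar> < e / (2 * exp (weight * T))" and r: "r \<in> {0..T}"
  have "\<bar>sol b r - sol a r\<bar> \<le> 2 * exp (weight * T) * \<bar>b - a\<bar>" using r by (intro sol_lip) auto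
  also have "\<dots> \<le> e" using b by (simp add: field_simps)
  finally show "\<bar>sol b r - sol a r\<bar> \<le> e" .
qed

lemma sol_bounded_near:
  assumes "T \<ge> 0"
  obtains K where "K > 0" "\<And>b r. \<bar>b - a\<bar> \<le> 1 \<Longrightarrow> r \<in> {0..T} \<Longrightarrow> sol b r \<in> {-K..K}"
proof -
  obtain M where M: "0 < M" "\<And>s. s \<in> {0..T} \<Longrightarrow> \<bar>sol a s\<bar> \<le> M"
    using continuous_on_Icc_bound[OF sol_contT] by blast
  show ?thesis
  proof (rule that[of "M + 2 * exp (weight * T)"])
    fix b r assume "\<bar>b - a\<bar> \<le> 1" "r \<in> {0..T}"
    then have "\<bar>sol b r - sol a r\<bar> \<le> 2 * exp (weight * T) * \<bar>b - a\<bar>" "2 * exp (weight * T) * \<bar>b - a\<bar> \<le> 2 * exp (weight * T)"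
      by (auto intro!: sol_lip simp: mult_left_le)
    with M(2)[OF \<open>r \<in> {0..T}\<close>] show "sol b r \<in> {-(M + 2 * exp (weight * T))..M + 2 * exp (weight * T)}"
      unfolding atLeastAtMost_iff by linarith
  qed (use M in \<open>auto intro: add_pos_pos\<close>)
qed

lemma uniform_compose_sol:
  assumes g: "continuous_on UNIV g" and "e > 0" "T \<ge> 0"
  shows "\<exists>d>0. \<forall>b. \<bar>b - a\<bar> < d \<longrightarrow> (\<forall>r\<in>{0..T}. \<bar>g (sol b r) - g (sol a r)\<bar> \<le> (e::real))"
proof -
  obtain K where K: "K > 0" "\<And>b r. \<bar>b - a\<bar> \<le> 1 \<Longrightarrow> r \<in> {0..T} \<Longrightarrow> sol b r \<in> {-K..K}"
    using sol_bounded_near[OF \<open>T \<ge> 0\<close>] by blast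
  have "uniformly_continuous_on {-K..K} g"
    by (intro compact_uniformly_continuous continuous_on_subset[OF g]) auto
  then obtain d1 where d1: "d1 > 0" "\<And>x y. x \<in> {-K..K} \<Longrightarrow> y \<in> {-K..K} \<Longrightarrow> \<bar>y - x\<bar> < d1 \<Longrightarrow> \<bar>g y - g x\<bar> < e"
    using \<open>e > 0\<close> unfolding uniformly_continuous_on_def dist_real_def by metis
  obtain d2 where d2: "d2 > 0" "\<And>b r. \<bar>b - a\<bar> < d2 \<Longrightarrow> r \<in> {0..T} \<Longrightarrow> \<bar>sol b r - sol a r\<bar> \<le> d1/2"
    using sol_uniform[of "d1/2" T a] d1 \<open>T \<ge> 0\<close> by auto
  show ?thesis
  proof (intro exI[of _ "min d2 1"] conjI allI impI ballI)
    fix b r assume b: "\<bar>b - a\<bar> < min d2 1" and r: "r \<in> {0..T}"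
    have "\<bar>sol b r - sol a r\<bar> \<le> d1/2" using b r by (intro d2) auto
    then have "\<bar>g (sol b r) - g (sol a r)\<bar> < e"
      using d1(1) b r by (intro d1 K) auto
    then show "\<bar>g (sol b r) - g (sol a r)\<bar> \<le> e" by simp
  qed (use d2 in auto)
qed

lemma var_uniform:
  assumes "e > 0" "T \<ge> 0"
  shows "\<exists>d>0. \<forall>b. \<bar>b - a\<bar> < d \<longrightarrow> (\<forall>r\<in>{0..T}. \<bar>var b r - var a r\<bar> \<le> e)"
proof -
  define C where "C = 2 * exp (weight * T)"
  have C: "C > 0" by (simp add: C_def)
  \<comment> \<open>One factor \<open>C\<close> bounds \<open>var a\<close>; the other is the
    constant \<open>2 * exp (weight * T)\<close> that \<open>radial_gronwall\<close> puts in front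
    of the perturbation \<open>B = e / C\<close>.\<close>
  have "e / (C * C) > 0" using assms C by simp
  then obtain d where d: "d > 0" "\<And>b r. \<bar>b - a\<bar> < d \<Longrightarrow> r \<in> {0..T} \<Longrightarrow> \<bar>F1 (sol b r) - F1 (sol a r)\<bar> \<le> e / (C * C)"
    using uniform_compose_sol[OF F1_cont, of "e / (C * C)" T a] assms by auto
  show ?thesis
  proof (intro exI[of _ d] conjI allI impI ballI)
    fix b r assume b: "\<bar>b - a\<bar> < d" and r: "r \<in> {0..T}"
    have "\<bar>var b r - var a r\<bar> \<le> 2 * (0 + e / C) * exp (weight * T)"
    proof (rule radial_gronwall[where d = "\<lambda>s. var b s - var a s" and g = "\<lambda>s. F1 (sol b s) * var b s - F1 (sol a s) * var a s" and L = L])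
      fix r assume r: "0 \<le> r" "r \<le> T"
      then show "\<bar>var b r - var a r\<bar> \<le> 0 + \<bar>radial_pot (\<lambda>s. F1 (sol b s) * var b s - F1 (sol a s) * var a s) r\<bar>"
        using var_eq[of r b] var_eq[of r a] by (simp add: radial_pot_diff[OF F1_var_cont(2) F1_var_cont(2)])
      have "F1 (sol b r) * var b r - F1 (sol a r) * var a r
        = F1 (sol b r) * (var b r - var a r) + (F1 (sol b r) - F1 (sol a r)) * var a r"
        by (simp add: algebra_simps)
      moreover have "\<bar>F1 (sol b r) * (var b r - var a r)\<bar> \<le> L * \<bar>var b r - var a r\<bar>"
        using F1_bound[of "sol b r"] by (simp add: abs_mult mult_right_mono)
      moreover have "\<bar>(F1 (sol b r) - F1 (sol a r)) * var a r\<bar> \<le> e / (C * C) * C"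
        unfolding abs_mult using d(2)[OF b, of r] var_bound[OF r, of a] r \<open>e / (C * C) > 0\<close>
        by (intro mult_mono) (auto simp: C_def)
      moreover have "e / (C * C) * C = e / C" using C by simp
      ultimately show "\<bar>F1 (sol b r) * var b r - F1 (sol a r) * var a r\<bar> \<le> L * \<bar>var b r - var a r\<bar> + e / C"
        by linarith
    qed (use r weight L_nonneg assms C in \<open>auto intro!: continuous_intros F1_var_cont var_contT\<close>)
    then show "\<bar>var b r - var a r\<bar> \<le> e" by (simp add: C_def)
  qed (use d in auto)
qed

lemma sol'_uniform:
  assumes "e > 0" "T \<ge> 0"
  shows "\<exists>d>0. \<forall>b. \<bar>b - a\<bar> < d \<longrightarrow> (\<forall>r\<in>{0..T}. \<bar>sol' b r - sol' a r\<bar> \<le> e)"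
proof -
  have "e / (T + 1) > 0" using assms by simp
  then obtain d where d: "d > 0" "\<And>b r. \<bar>b - a\<bar> < d \<Longrightarrow> r \<in> {0..T} \<Longrightarrow> \<bar>F (sol b r) - F (sol a r)\<bar> \<le> e / (T + 1)"
    using uniform_compose_sol[OF F_cont, of "e / (T + 1)" T a] assms by auto
  show ?thesis
  proof (intro exI[of _ d] conjI allI impI ballI)
    fix b r assume b: "\<bar>b - a\<bar> < d" and r: "r \<in> {0..T}"
    have "\<bar>radial_flux (\<lambda>s. F (sol b s)) r - radial_flux (\<lambda>s. F (sol a s)) r\<bar> \<le> e / (T + 1) * T"
      using d(2)[OF b] r by (intro radial_flux_uniform_le F_sol_cont) auto
    also have "\<dots> \<le> e" using assms by (simp add: field_simps)
    finally show "\<bar>sol' b r - sol' a r\<bar> \<le> e" by (simp add: sol'_def)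
  qed (use d in auto)
qed

lemma var'_uniform:
  assumes "e > 0" "T \<ge> 0"
  shows "\<exists>d>0. \<forall>b. \<bar>b - a\<bar> < d \<longrightarrow> (\<forall>r\<in>{0..T}. \<bar>var' b r - var' a r\<bar> \<le> e)"
proof -
  define C where "C = 2 * exp (weight * T)"
  have C: "C > 0" by (simp add: C_def)
  define e1 where "e1 = e / (T + 1) / (L + C)"
  have e1: "e1 > 0" using assms C L_nonneg by (simp add: e1_def add_nonneg_pos)
  obtain d1 where d1: "d1 > 0" "\<And>b r. \<bar>b - a\<bar> < d1 \<Longrightarrow> r \<in> {0..T} \<Longrightarrow> \<bar>F1 (sol b r) - F1 (sol a r)\<bar> \<le> e1"
    using uniform_compose_sol[OF F1_cont, of e1 T a] assms e1 by auto
  obtain d2 where d2: "d2 > 0" "\<And>b r. \<bar>b - a\<bar> < d2 \<Longrightarrow> r \<in> {0..T} \<Longrightarrow> \<bar>var b r - var a r\<bar> \<le> e1"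
    using var_uniform[of e1 T a] assms e1 by auto
  show ?thesis
  proof (intro exI[of _ "min d1 d2"] conjI allI impI ballI)
    fix b r assume b: "\<bar>b - a\<bar> < min d1 d2" and r: "r \<in> {0..T}"
    have "\<bar>radial_flux (\<lambda>s. F1 (sol b s) * var b s) r - radial_flux (\<lambda>s. F1 (sol a s) * var a s) r\<bar> \<le> e / (T + 1) * T"
    proof (rule radial_flux_uniform_le[OF F1_var_cont(2) F1_var_cont(2)])
      fix r assume r: "0 \<le> r" "r \<le> T"
      have "F1 (sol b r) * var b r - F1 (sol a r) * var a r
        = F1 (sol b r) * (var b r - var a r) + (F1 (sol b r) - F1 (sol a r)) * var a r"
        by (simp add: algebra_simps)
      moreover have "\<bar>F1 (sol b r) * (var b r - var a r)\<bar> \<le> L * e1"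
        unfolding abs_mult using F1_bound[of "sol b r"] d2(2)[of b r] b r L_nonneg by (intro mult_mono) auto
      moreover have "\<bar>(F1 (sol b r) - F1 (sol a r)) * var a r\<bar> \<le> e1 * C"
        unfolding abs_mult using d1(2)[of b r] b var_bound[OF r, of a] r e1
        by (intro mult_mono) (auto simp: C_def)
      moreover have "L * e1 + e1 * C = e / (T + 1)"
      proof -
        have "L * e1 + e1 * C = (L + C) * e1" by (simp add: algebra_simps)
        also have "\<dots> = e / (T + 1)" using C L_nonneg by (simp add: e1_def)
        finally show ?thesis .
      qed
      ultimately show "\<bar>F1 (sol b r) * var b r - F1 (sol a r) * var a r\<bar> \<le> e / (T + 1)"
        by linarith
    qed (use r in auto)
    also have "\<dots> \<le> e" using assms by (simp add: field_simps)
    finally show "\<bar>var' b r - var' a r\<bar> \<le> e" by (simp add: var'_def)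
  qed (use d1 d2 in auto)
qed

lemma sol_jcont: "continuous_on (UNIV \<times> {0..}) (\<lambda>p. sol (fst p) (snd p))"
  and sol'_jcont: "continuous_on (UNIV \<times> {0..}) (\<lambda>p. sol' (fst p) (snd p))"
  and var_jcont: "continuous_on (UNIV \<times> {0..}) (\<lambda>p. var (fst p) (snd p))"
  and var'_jcont: "continuous_on (UNIV \<times> {0..}) (\<lambda>p. var' (fst p) (snd p))"
  by (auto intro!: joint_continuity sol_cont sol_uniform sol'_cont sol'_uniform var_cont var_uniform var'_cont var'_uniform)

text \<open>The error \<open>sol b - sol a - h * var a\<close> obeys the linearized integral
  equation up to the Taylor remainder of \<open>F\<close>. As \<open>F1\<close> is uniformly
  continuous on a compact range containing the nearby solutions, the remainder is at most
  \<open>e1 * C * \<bar>h\<bar>\<close>, and \<open>radial_gronwall\<close> carries this over to the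
  error.\<close>

lemma sol_param_deriv:
  assumes "0 \<le> r"
  shows "((\<lambda>a. sol a r) has_real_derivative var a r) (at a)"
proof -
  define C where "C = 2 * exp (weight * r)"
  have C: "C > 0" by (simp add: C_def)
  have "((\<lambda>b. (sol b r - sol a r) / (b - a)) \<longlongrightarrow> var a r) (at a)"
    unfolding LIM_eq
  proof (intro allI impI)
    fix e :: real assume "0 < e"
    \<comment> \<open>One factor \<open>C\<close> comes from \<open>sol_lip\<close>, the other from
      \<open>radial_gronwall\<close>; what remains is \<open>e / 2\<close>.\<close>
    define e1 where "e1 = e / (2 * C * C)"
    have e1: "e1 > 0" using \<open>0 < e\<close> C by (simp add: e1_def)
    obtain K where K: "K > 0" "\<And>b s. \<bar>b - a\<bar> \<le> 1 \<Longrightarrow> s \<in> {0..r} \<Longrightarrow> sol b s \<in> {-K..K}"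
      using sol_bounded_near[OF \<open>0 \<le> r\<close>] by blast
    have "uniformly_continuous_on {-K..K} F1"
      by (intro compact_uniformly_continuous F1_cont') auto
    then obtain d1 where d1: "d1 > 0" "\<And>x y. x \<in> {-K..K} \<Longrightarrow> y \<in> {-K..K} \<Longrightarrow> \<bar>y - x\<bar> < d1 \<Longrightarrow> \<bar>F1 y - F1 x\<bar> < e1"
      using e1 unfolding uniformly_continuous_on_def dist_real_def by metis
    have taylor: "\<bar>F y - F x - F1 x * (y - x)\<bar> \<le> e1 * \<bar>y - x\<bar>" if xy: "x \<in> {-K..K}" "y \<in> {-K..K}" "\<bar>y - x\<bar> < d1" for x y
    proof -
      have "norm ((F y - F1 x * y) - (F x - F1 x * x)) \<le> e1 * norm (y - x)"
      proof (rule field_differentiable_bound[of "closed_segment x y" _ "\<lambda>z. F1 z - F1 x"])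
        fix z assume z: "z \<in> closed_segment x y"
        show "((\<lambda>z. F z - F1 x * z) has_real_derivative F1 z - F1 x) (at z within closed_segment x y)"
          by (rule has_field_derivative_at_within) (auto intro!: derivative_eq_intros F_deriv)
        have "z \<in> {-K..K}" "\<bar>z - x\<bar> < d1" using z xy by (auto simp: closed_segment_eq_real_ivl split: if_splits)
        then show "norm (F1 z - F1 x) \<le> e1" using d1(2)[of x z] xy by auto
      qed auto
      moreover have "(F y - F1 x * y) - (F x - F1 x * x) = F y - F x - F1 x * (y - x)" by (simp add: algebra_simps)
      ultimately show ?thesis by simp
    qed
    show "\<exists>s>0. \<forall>b. b \<noteq> a \<and> norm (b - a) < s \<longrightarrow> norm ((sol b r - sol a r) / (b - a) - var a r) < e"
    proof (intro exI conjI allI impI)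
      show "min 1 (d1 / C) > 0" using d1 C by simp
      fix b assume b: "b \<noteq> a \<and> norm (b - a) < min 1 (d1 / C)"
      define h where "h = b - a"
      have h: "h \<noteq> 0" "\<bar>h\<bar> < 1" "C * \<bar>h\<bar> < d1" using b C by (auto simp: h_def field_simps)
      have close: "\<bar>sol b s - sol a s\<bar> \<le> C * \<bar>h\<bar>" if "0 \<le> s" "s \<le> r" for s
        using sol_lip[OF that, of b a] by (simp add: C_def h_def)
      let ?d = "\<lambda>s. sol b s - sol a s - h * var a s"
      let ?g = "\<lambda>s. (F (sol b s) - F (sol a s)) - h * (F1 (sol a s) * var a s)"
      have c1: "continuous_on {0..r} (\<lambda>s. F (sol b s) - F (sol a s))" by (intro continuous_intros F_sol_cont)
      have c2: "continuous_on {0..r} (\<lambda>s. h * (F1 (sol a s) * var a s))" by (intro continuous_intros F1_var_cont)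
      have "\<bar>?d r\<bar> \<le> 2 * (0 + e1 * (C * \<bar>h\<bar>)) * exp (weight * r)"
      proof (rule radial_gronwall[where d = "\<lambda>s. sol b s - sol a s - h * var a s" and g = ?g and L = L])
        fix s assume s: "0 \<le> s" "s \<le> r"
        have "radial_pot ?g s = radial_pot (\<lambda>s. F (sol b s)) s - radial_pot (\<lambda>s. F (sol a s)) s - h * radial_pot (\<lambda>s. F1 (sol a s) * var a s) s"
          using s by (simp add: radial_pot_diff[OF c1 c2] radial_pot_diff[OF F_sol_cont(2) F_sol_cont(2)] radial_pot_cmult)
        moreover have "h * var a s = h - h * radial_pot (\<lambda>s. F1 (sol a s) * var a s) s"
          using var_eq[of s a] s by (metis mult.right_neutral right_diff_distrib)
        ultimately have "?d s = - radial_pot ?g s"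
          using sol_eq[of s b] sol_eq[of s a] s unfolding h_def by linarith
        then show "\<bar>?d s\<bar> \<le> 0 + \<bar>radial_pot ?g s\<bar>" by simp
        have "?g s = (F (sol b s) - F (sol a s) - F1 (sol a s) * (sol b s - sol a s)) + F1 (sol a s) * ?d s"
          by (simp add: algebra_simps)
        moreover have "\<bar>F (sol b s) - F (sol a s) - F1 (sol a s) * (sol b s - sol a s)\<bar> \<le> e1 * \<bar>sol b s - sol a s\<bar>"
          using K(2)[of b s] K(2)[of a s] s h close[OF s] by (intro taylor) (auto simp: h_def)
        moreover have "e1 * \<bar>sol b s - sol a s\<bar> \<le> e1 * (C * \<bar>h\<bar>)" using close[OF s] e1 by (intro mult_left_mono) auto
        moreover have "\<bar>F1 (sol a s) * ?d s\<bar> \<le> L * \<bar>?d s\<bar>"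
          using F1_bound[of "sol a s"] by (simp add: abs_mult mult_right_mono)
        ultimately show "\<bar>?g s\<bar> \<le> L * \<bar>?d s\<bar> + e1 * (C * \<bar>h\<bar>)" by linarith
      qed (use assms weight L_nonneg e1 C in \<open>auto intro!: continuous_intros F_sol_cont F1_var_cont sol_contT var_contT\<close>)
      then have "\<bar>?d r\<bar> \<le> e / 2 * \<bar>h\<bar>" using C by (simp add: e1_def C_def field_simps)
      moreover have "(sol b r - sol a r) / h - var a r = ?d r / h" using h by (simp add: field_simps)
      ultimately have "\<bar>(sol b r - sol a r) / h - var a r\<bar> \<le> e / 2" using h by (simp add: field_simps)
      then show "norm ((sol b r - sol a r) / (b - a) - var a r) < e" using \<open>0 < e\<close> by (simp add: h_def)
    qed
  qed
  then show ?thesis by (simp add: has_field_derivative_iff)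
qed

text \<open>Joint differentiability in \<open>(a, r)\<close> follows from the partial derivatives
  because the one in \<open>r\<close> is jointly continuous. The region \<open>r > 0\<close> is
  open, which avoids the one-sided derivative at \<open>0\<close>.\<close>

lemma sol_chain:
  assumes \<rho>: "(\<rho> has_real_derivative \<rho>') (at a)" and pos: "\<rho> a > 0"
  shows "((\<lambda>b. sol b (\<rho> b)) has_real_derivative var a (\<rho> a) + sol' a (\<rho> a) * \<rho>') (at a)"
proof -
  have "((\<lambda>(b, r). sol b r) has_derivative (\<lambda>(tb, tr). var a (\<rho> a) * tb + blinfun_apply (blinfun_mult_right (sol' a (\<rho> a))) tr))
     (at (a, \<rho> a) within UNIV \<times> {0<..})"
  proof (rule has_derivative_partialsI[where fy = "\<lambda>b r. blinfun_mult_right (sol' b r)"])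
    show "((\<lambda>b. sol b (\<rho> a)) has_derivative (\<lambda>tb. var a (\<rho> a) * tb)) (at a within UNIV)"
      using sol_param_deriv[of "\<rho> a" a] pos by (simp add: has_field_derivative_def)
    show "((\<lambda>r. sol b r) has_derivative blinfun_apply (blinfun_mult_right (sol' b r))) (at r within {0<..})"
      if "r \<in> {0<..}" for b r
      using sol_deriv[of r b] that
      by (auto simp: has_field_derivative_def blinfun_mult_right.rep_eq intro: has_derivative_at_withinI)
    have "continuous_on (UNIV \<times> {0<..}) (\<lambda>p. blinfun_mult_right (sol' (fst p) (snd p)))"
      by (intro bounded_linear.continuous_on[OF bounded_linear_blinfun_mult_right] continuous_on_subset[OF sol'_jcont]) auto
    then show "continuous (at (a, \<rho> a) within UNIV \<times> {0<..}) (\<lambda>(b, r). blinfun_mult_right (sol' b r))"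
      using pos by (auto simp: continuous_on_eq_continuous_within case_prod_beta')
  qed (use pos in auto)
  moreover have "at (a, \<rho> a) within UNIV \<times> {0<..} = at (a, \<rho> a)"
    using pos by (intro at_within_open) (auto intro!: open_Times)
  ultimately have "((\<lambda>(b, r). sol b r) has_derivative (\<lambda>(tb, tr). var a (\<rho> a) * tb + sol' a (\<rho> a) * tr)) (at (a, \<rho> a))"
    by simp
  moreover have "((\<lambda>b. (b, \<rho> b)) has_derivative (\<lambda>h. (h, \<rho>' * h))) (at a)"
    using \<rho> unfolding has_field_derivative_def by (intro derivative_intros)
  ultimately have "((\<lambda>b. case (b, \<rho> b) of (b, r) \<Rightarrow> sol b r) has_derivative (\<lambda>h. case (h, \<rho>' * h) of (tb, tr) \<Rightarrow> var a (\<rho> a) * tb + sol' a (\<rho> a) * tr)) (at a)"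
    by (rule has_derivative_compose[rotated])
  moreover have "(\<lambda>h. case (h, \<rho>' * h) of (tb, tr) \<Rightarrow> var a (\<rho> a) * tb + sol' a (\<rho> a) * tr)
    = (*) (var a (\<rho> a) + sol' a (\<rho> a) * \<rho>')"
    by (auto simp: fun_eq_iff algebra_simps)
  ultimately show ?thesis by (simp add: has_field_derivative_def)
qed

text \<open>Multiplication by \<open>r\<close> removes the first-order term. This form and its
  analogue for \<open>var'\<close> carry the monotonicity and Wronskian arguments.\<close>

lemma mult_sol'_deriv: "r > 0 \<Longrightarrow> ((\<lambda>r. r * sol' a r) has_real_derivative - r * F (sol a r)) (at r)"
  by (rule derivative_eq_intros sol'_deriv refl | simp add: field_simps)+

lemma mult_var'_deriv: "r > 0 \<Longrightarrow> ((\<lambda>r. r * var' a r) has_real_derivative - r * F1 (sol a r) * var a r) (at r)"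
  by (rule derivative_eq_intros var'_deriv refl | simp add: field_simps)+

end

section \<open>Shooting from the origin\<close>

lemma has_real_derivative_glue_0:
  assumes "(g has_real_derivative d) (at 0 within {0..})" "(h has_real_derivative d) (at 0)" "g 0 = h 0"
  shows "((\<lambda>x. if 0 \<le> x then g x else h x) has_real_derivative d) (at (0::real))"
proof -
  let ?k = "\<lambda>x. if 0 \<le> x then g x else h x"
  have "(?k has_real_derivative d) (at 0 within {0..})"
    by (rule has_field_derivative_transform_within[OF assms(1), of 1]) auto
  moreover have "(?k has_real_derivative d) (at 0 within {..0})"
    by (rule has_field_derivative_transform_within[OF has_field_derivative_at_within[OF assms(2)], of 1]) (use assms in auto)
  moreover have "{0..} \<union> {..0} = (UNIV :: real set)" by auto
  ultimately show ?thesis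
    unfolding has_field_derivative_iff by (rule Lim_Un_univ)
qed

lemma MVT_between:
  fixes g g' :: "real \<Rightarrow> real"
  assumes "\<And>x. min a b \<le> x \<Longrightarrow> x \<le> max a b \<Longrightarrow> (g has_real_derivative g' x) (at x)"
  obtains \<xi> where "min a b \<le> \<xi>" "\<xi> \<le> max a b" "g b - g a = (b - a) * g' \<xi>"
proof -
  consider "a < b" | "a = b" | "b < a" by linarith
  then show ?thesis
  proof cases
    case 1
    then obtain z where "z > a" "z < b" "g b - g a = (b - a) * g' z" using MVT2[of a b g g'] assms by auto
    then show ?thesis using that[of z] 1 by auto
  next
    case 2
    then show ?thesis using that[of a] by auto
  next
    case 3
    then obtain z where "z > b" "z < a" "g a - g b = (a - b) * g' z" using MVT2[of b a g g'] assms by auto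
    then show ?thesis using that[of z] 3 by (auto simp: algebra_simps)
  qed
qed

lemma at_within_Ici: "x > 0 \<Longrightarrow> at x within {0..} = at (x::real)"
  by (rule at_within_interior) simp

lemma first_zero:
  fixes g :: "real \<Rightarrow> real"
  assumes "continuous_on {a..b} g" "a \<le> b" "0 < g a" "g b \<le> 0"
  obtains \<rho> where "a < \<rho>" "\<rho> \<le> b" "g \<rho> = 0" "\<And>x. a \<le> x \<Longrightarrow> x < \<rho> \<Longrightarrow> 0 < g x"
proof -
  define Z where "Z = {a..b} \<inter> g -` {..0}"
  have cl: "closed Z" unfolding Z_def by (rule continuous_closed_preimage[OF assms(1)]) auto
  have ne: "b \<in> Z" using assms by (auto simp: Z_def)
  have bd: "bdd_below Z" by (auto simp: Z_def intro: bdd_belowI[of _ a])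
  have inZ: "Inf Z \<in> Z" using closed_contains_Inf[OF _ bd cl] ne by blast
  have pos: "0 < g x" if "a \<le> x" "x < Inf Z" for x
  proof (rule ccontr)
    assume "\<not> 0 < g x"
    then have "x \<in> Z" using that inZ by (auto simp: Z_def)
    then show False using cInf_lower[OF _ bd] that by force
  qed
  have "a \<noteq> Inf Z" using inZ assms by (auto simp: Z_def)
  then have lt: "a < Inf Z" using inZ by (auto simp: Z_def)
  have "g (Inf Z) = 0"
  proof (rule ccontr)
    assume "g (Inf Z) \<noteq> 0"
    then have neg: "g (Inf Z) < 0" using inZ by (auto simp: Z_def)
    have "\<exists>x\<ge>a. x \<le> Inf Z \<and> g x = 0"
      by (rule IVT2') (use neg assms lt inZ in \<open>auto simp: Z_def intro: continuous_on_subset[OF assms(1)]\<close>)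
    then obtain x where x: "a \<le> x" "x \<le> Inf Z" "g x = 0" by blast
    then have "x \<noteq> Inf Z" using neg by auto
    then show False using pos[of x] x by auto
  qed
  then show ?thesis using that[of "Inf Z"] lt inZ pos by (auto simp: Z_def)
qed

lemma deriv_nonpos_at_zero:
  fixes g :: "real \<Rightarrow> real"
  assumes "(g has_real_derivative D) (at \<rho>)" "g \<rho> = 0" "a < \<rho>" "\<And>x. a \<le> x \<Longrightarrow> x < \<rho> \<Longrightarrow> 0 < g x"
  shows "D \<le> 0"
proof (rule ccontr)
  assume "\<not> D \<le> 0"
  then obtain d where d: "d > 0" "\<And>h. h > 0 \<Longrightarrow> h < d \<Longrightarrow> g (\<rho> - h) < g \<rho>"
    using DERIV_pos_inc_left[OF assms(1)] by auto
  define h where "h = min (d/2) ((\<rho> - a)/2)"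
  have "h > 0" "h < d" "a \<le> \<rho> - h" using d assms(3) by (auto simp: h_def min_def field_simps)
  then show False using d(2)[of h] assms(2) assms(4)[of "\<rho> - h"] by auto
qed

lemma joint_continuity_subst:
  fixes h :: "real \<Rightarrow> real \<Rightarrow> real"
  assumes "continuous_on (UNIV \<times> {0..}) (\<lambda>p. h (fst p) (snd p))" "continuous_on UNIV g"
  shows "continuous_on (UNIV \<times> {0..R}) (\<lambda>(p, r). h (g p) r)"
proof -
  have "continuous_on (UNIV \<times> {0..R}) (\<lambda>p. (\<lambda>p. h (fst p) (snd p)) (g (fst p), snd p))"
  proof (rule continuous_on_compose2[OF assms(1)])
    show "continuous_on (UNIV \<times> {0..R}) (\<lambda>p. (g (fst p), snd p))"
      by (intro continuous_intros continuous_on_compose2[OF assms(2)]) auto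
  qed auto
  then show ?thesis by (simp add: case_prod_beta')
qed

lemma has_real_derivative_scale:
  fixes h :: "real \<Rightarrow> real"
  assumes "(h has_real_derivative D) (at (c * r) within {0..c * T})" "0 \<le> c"
  shows "((\<lambda>r. h (c * r)) has_real_derivative D * c) (at r within {0..T})"
proof -
  have "(\<lambda>r. c * r) ` {0..T} \<subseteq> {0..c * T}" using assms(2) by (auto intro: mult_left_mono)
  then have "(h has_real_derivative D) (at (c * r) within (\<lambda>r. c * r) ` {0..T})"
    using assms(1) has_field_derivative_subset by blast
  moreover have "((\<lambda>r. c * r) has_real_derivative c) (at r within {0..T})"
    by (auto intro!: derivative_eq_intros)
  ultimately show ?thesis using DERIV_image_chain[of h D "\<lambda>r. c * r" r "{0..T}" c] by (simp add: o_def)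
qed

text \<open>In the variable \<open>s = R * r\<close> the factor \<open>R\<^sup>2\<close> disappears,
  so problems on \<open>{0..1}\<close> with a parameter become initial value problems on
  \<open>{0..R}\<close> without one. It serves both the nonlinear and the linearized
  equation.\<close>

lemma scaled_radial_ode_imp_pot:
  assumes R: "R > 0" and g: "continuous_on {0..1} g"
    and y: "\<And>r. r \<in> {0..1} \<Longrightarrow> (y has_real_derivative y' r) (at r within {0..1})"
    and y': "\<And>r. r \<in> {0<..<1} \<Longrightarrow> (y' has_real_derivative y'' r) (at r)"
    and eq: "\<And>r. r \<in> {0<..<1} \<Longrightarrow> y'' r + y' r / r + R\<^sup>2 * g r = 0"
    and 0: "y' 0 = 0" and s: "s \<in> {0..R}"
  shows "y (s / R) = y 0 - radial_pot (\<lambda>s. g (s / R)) s"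
proof -
  have i: "s / R \<in> {0..1}" if "s \<in> {0..R}" for s using that R by (auto simp: field_simps)
  have j: "s / R \<in> {0<..<1}" if "s \<in> {0<..<R}" for s using that R by (auto simp: field_simps)
  have "y (s / R) = y (0 / R) - radial_pot (\<lambda>s. g (s / R)) s"
  proof (rule radial_ode_imp_pot[OF R, where x = "\<lambda>s. y (s / R)" and x' = "\<lambda>s. y' (s / R) * (1 / R)" and x'' = "\<lambda>s. y'' (s / R) * (1 / R) * (1 / R)"])
    show "continuous_on {0..R} (\<lambda>s. g (s / R))"
      by (rule continuous_on_compose2[OF g]) (use i R in \<open>auto intro!: continuous_intros\<close>)
    fix s assume s: "s \<in> {0..R}"
    show "((\<lambda>s. y (s / R)) has_real_derivative y' (s / R) * (1 / R)) (at s within {0..R})"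
      using has_real_derivative_scale[of y "y' (s / R)" "1 / R" s R] y[OF i[OF s]] R by simp
  next
    fix s assume s: "s \<in> {0<..<R}"
    have "((\<lambda>s. s / R) has_real_derivative 1 / R) (at s)" using R by (auto intro!: derivative_eq_intros)
    from DERIV_mult[OF DERIV_chain2[OF y'[OF j[OF s]] this] DERIV_const[of "1 / R"]]
    show "((\<lambda>s. y' (s / R) * (1 / R)) has_real_derivative y'' (s / R) * (1 / R) * (1 / R)) (at s)" by simp
    have "y'' (s / R) + y' (s / R) / (s / R) + R\<^sup>2 * g (s / R) = 0" by (rule eq[OF j[OF s]])
    then have "(y'' (s / R) + y' (s / R) / (s / R) + R\<^sup>2 * g (s / R)) / R\<^sup>2 = 0" by simp
    then show "y'' (s / R) * (1 / R) * (1 / R) + y' (s / R) * (1 / R) / s + g (s / R) = 0"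
      using s R by (simp add: field_simps power2_eq_square)
  qed (use 0 s in auto)
  then show ?thesis by simp
qed

section \<open>Monotonicity, bounds and extension of the nonlinearity\<close>

locale log_concave_problem =
  fixes f f1 f2 :: "real \<Rightarrow> real" and \<beta> f0 :: real
  assumes f_deriv: "\<And>x. x \<ge> 0 \<Longrightarrow> (f has_real_derivative f1 x) (at x within {0..})"
    and f1_deriv: "\<And>x. x \<ge> 0 \<Longrightarrow> (f1 has_real_derivative f2 x) (at x within {0..})"
    and f2_cont: "continuous_on {0..} f2"
    and f_0: "f 0 = 0" and f1_0: "f1 0 = 0"
    and f_pos: "\<And>v. v > 0 \<Longrightarrow> f v > 0"
    and log_concave: "\<And>v. v > 0 \<Longrightarrow> f2 v * f v - (f1 v)\<^sup>2 < 0"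
    and beta_pos: "\<beta> > 0"
    and convex_part: "\<And>v. 0 < v \<Longrightarrow> v < \<beta> \<Longrightarrow> f2 v > 0"
    and concave_part: "\<And>v. v > \<beta> \<Longrightarrow> f2 v < 0"
    and f_lim: "(f \<longlongrightarrow> f0) at_top" and f0_pos: "f0 > 0"
    and superlinear: "\<And>v. 0 < v \<Longrightarrow> v < \<beta> \<Longrightarrow> v * f1 v > f v"
begin

lemma f_deriv_at: "x > 0 \<Longrightarrow> (f has_real_derivative f1 x) (at x)"
  and f1_deriv_at: "x > 0 \<Longrightarrow> (f1 has_real_derivative f2 x) (at x)"
  using f_deriv[of x] f1_deriv[of x] by (auto simp: at_within_Ici)

lemma f_contS: "S \<subseteq> {0..} \<Longrightarrow> continuous_on S f" and f1_contS: "S \<subseteq> {0..} \<Longrightarrow> continuous_on S f1"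
  by (rule continuous_on_subset[of "{0..}"], rule DERIV_continuous_on[OF f_deriv] DERIV_continuous_on[OF f1_deriv], auto)+

lemma log_deriv_decreasing:
  assumes "0 < x" "x < y" shows "f1 y / f y < f1 x / f x"
proof (rule DERIV_neg_imp_decreasing[OF assms(2), where f = "\<lambda>z. f1 z / f z"])
  fix z assume "x \<le> z" "z \<le> y"
  then have z: "z > 0" using assms by simp
  have "((\<lambda>z. f1 z / f z) has_real_derivative (f2 z * f z - f1 z * f1 z) / (f z * f z)) (at z)"
    using z f_pos[OF z] by (intro DERIV_divide f1_deriv_at f_deriv_at) auto
  moreover have "(f2 z * f z - f1 z * f1 z) / (f z * f z) < 0"
    using log_concave[OF z] f_pos[OF z] by (intro divide_neg_pos) (auto simp: power2_eq_square)
  ultimately show "\<exists>D. ((\<lambda>z. f1 z / f z) has_real_derivative D) (at z) \<and> D < 0" by blast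
qed

text \<open>Otherwise the strictly decreasing \<open>f1 / f\<close> is at most some
  \<open>- c < 0\<close> from \<open>a + 1\<close> on. There \<open>f\<close> decreases towards its
  positive limit, so \<open>f \<ge> f0\<close> and the slope is at most \<open>- c * f0\<close>,
  which eventually makes \<open>f\<close> nonpositive.\<close>

lemma f1_pos:
  assumes a: "a > 0" shows "f1 a > 0"
proof (rule ccontr)
  assume "\<not> f1 a > 0"
  define b where "b = a + 1"
  define c where "c = - (f1 b / f b)"
  have b: "b > 0" "a < b" using a by (auto simp: b_def)
  have "f1 b / f b < f1 a / f a" using log_deriv_decreasing[OF a b(2)] .
  also have "\<dots> \<le> 0" using \<open>\<not> f1 a > 0\<close> f_pos[OF a] by (simp add: divide_nonpos_pos)
  finally have c: "c > 0" by (simp add: c_def)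
  have le: "f1 x \<le> - c * f x" if "x \<ge> b" for x
  proof -
    have "f1 x / f x \<le> - c" using log_deriv_decreasing[OF b(1), of x] that by (cases "x = b") (auto simp: c_def)
    then show ?thesis using f_pos[of x] that b by (simp add: field_simps)
  qed
  have dec: "f y \<le> f x" if "b \<le> x" "x \<le> y" for x y
  proof (rule DERIV_nonpos_imp_nonincreasing[OF that(2)])
    fix z assume "x \<le> z" "z \<le> y"
    then have "z \<ge> b" "z > 0" using that b by auto
    then have "f1 z \<le> - c * f z" "0 < c * f z" using le[of z] f_pos[of z] c by simp_all
    then have "f1 z \<le> 0" by linarith
    then show "\<exists>D. (f has_real_derivative D) (at z) \<and> D \<le> 0" using f_deriv_at[OF \<open>z > 0\<close>] by blast
  qed
  have ge: "f0 \<le> f x" if "x \<ge> b" for x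
    by (rule tendsto_upperbound[OF f_lim]) (use dec[OF that] in \<open>auto simp: eventually_at_top_linorder\<close>)
  \<comment> \<open>A slope of at most \<open>- c * f0\<close> uses up \<open>f b\<close> within
    this length.\<close>
  define t where "t = f b / (c * f0)"
  have t: "t > 0" using f_pos[OF b(1)] c f0_pos by (simp add: t_def)
  have "\<exists>z>b. z < b + t \<and> f (b + t) - f b = (b + t - b) * f1 z"
    using t b by (intro MVT2) (auto intro: f_deriv_at)
  then obtain z where z: "z > b" "f (b + t) - f b = t * f1 z" by auto
  have "f1 z \<le> - c * f z" using z by (intro le) auto
  also have "\<dots> \<le> - c * f0" using ge[of z] z c by simp
  finally have "t * f1 z \<le> t * (- c * f0)" using t by (intro mult_left_mono) auto
  also have "\<dots> = - f b" using c f0_pos by (simp add: t_def)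
  finally have "f (b + t) \<le> 0" using z by simp
  then show False using f_pos[of "b + t"] b t by simp
qed

lemma f_less:
  assumes "0 \<le> x" "x < y" shows "f x < f y"
proof (rule DERIV_pos_imp_increasing_open[OF assms(2)])
  fix z assume "x < z" "z < y"
  then have "z > 0" using assms by simp
  then show "\<exists>D. (f has_real_derivative D) (at z) \<and> D > 0" using f_deriv_at f1_pos by blast
qed (use assms in \<open>auto intro!: f_contS\<close>)

lemma f_mono: "0 \<le> x \<Longrightarrow> x \<le> y \<Longrightarrow> f x \<le> f y"
  using f_less[of x y] by (cases "x = y") auto

lemma f_le: assumes "0 \<le> x" shows "f x \<le> f0"
  by (rule tendsto_lowerbound[OF f_lim]) (use f_mono[OF assms] in \<open>auto simp: eventually_at_top_linorder\<close>)

lemma f1_le: assumes "0 \<le> x" shows "f1 x \<le> f1 \<beta>"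
proof (cases "x \<le> \<beta>")
  case True
  show ?thesis
  proof (cases "x = \<beta>")
    case False
    have "f1 x < f1 \<beta>"
    proof (rule DERIV_pos_imp_increasing_open[of x \<beta> f1])
      fix z assume "x < z" "z < \<beta>"
      then show "\<exists>D. (f1 has_real_derivative D) (at z) \<and> D > 0"
        using f1_deriv_at[of z] convex_part[of z] assms by auto
    qed (use assms True False in \<open>auto intro!: f1_contS\<close>)
    then show ?thesis by simp
  qed simp
next
  case False
  have "f1 x < f1 \<beta>"
  proof (rule DERIV_neg_imp_decreasing_open[of \<beta> x f1])
    fix z assume "\<beta> < z" "z < x"
    then show "\<exists>D. (f1 has_real_derivative D) (at z) \<and> D < 0"
      using f1_deriv_at[of z] concave_part[of z] beta_pos by auto
  qed (use assms False beta_pos in \<open>auto intro!: f1_contS\<close>)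
  then show ?thesis by simp
qed

lemma f2_0_nonneg: "0 \<le> f2 0"
proof (rule tendsto_lowerbound)
  have "continuous (at 0 within {0..}) f2" using f2_cont by (auto simp: continuous_on_eq_continuous_within)
  then show "(f2 \<longlongrightarrow> f2 0) (at_right 0)"
    unfolding continuous_within by (rule tendsto_within_subset) auto
  show "\<forall>\<^sub>F x in at_right 0. 0 \<le> f2 x"
    unfolding eventually_at_right_field using beta_pos convex_part by (auto intro!: exI[of _ \<beta>] less_imp_le)
qed simp

text \<open>The continuation of \<open>f\<close> to negative arguments is \<open>C\<^sup>2\<close> with bounded derivative and nonnegative, so the flow is global
  and solutions stay decreasing after their zero.\<close>
definition F :: "real \<Rightarrow> real" where "F x = (if 0 \<le> x then f x else f2 0 * (1 - cos x))"
definition F1 :: "real \<Rightarrow> real" where "F1 x = (if 0 \<le> x then f1 x else f2 0 * sin x)"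
definition F2 :: "real \<Rightarrow> real" where "F2 x = (if 0 \<le> x then f2 x else f2 0 * cos x)"

lemma F_has_deriv: "(F has_real_derivative F1 x) (at x)"
proof -
  consider "x = 0" | "x > 0" | "x < 0" by linarith
  then show ?thesis
  proof cases
    case 1
    have "((\<lambda>x. if 0 \<le> x then f x else f2 0 * (1 - cos x)) has_real_derivative 0) (at 0)"
      by (rule has_real_derivative_glue_0) (use f_deriv[of 0] f1_0 f_0 in \<open>auto intro!: derivative_eq_intros\<close>)
    then show ?thesis using 1 by (simp add: F_def[abs_def] F1_def f1_0)
  next
    case 2
    show ?thesis by (rule has_field_derivative_transform_within[where d = x and f = f])
        (use 2 f_deriv_at in \<open>auto simp: F_def F1_def dist_real_def\<close>)
  next
    case 3
    show ?thesis by (rule has_field_derivative_transform_within[where d = "-x" and f = "\<lambda>x. f2 0 * (1 - cos x)"])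
        (use 3 in \<open>auto simp: F_def F1_def dist_real_def intro!: derivative_eq_intros\<close>)
  qed
qed

lemma F1_has_deriv: "(F1 has_real_derivative F2 x) (at x)"
proof -
  consider "x = 0" | "x > 0" | "x < 0" by linarith
  then show ?thesis
  proof cases
    case 1
    have "((\<lambda>x. if 0 \<le> x then f1 x else f2 0 * sin x) has_real_derivative f2 0) (at 0)"
      by (rule has_real_derivative_glue_0) (use f1_deriv[of 0] f1_0 in \<open>auto intro!: derivative_eq_intros\<close>)
    then show ?thesis using 1 by (simp add: F1_def[abs_def] F2_def)
  next
    case 2
    show ?thesis by (rule has_field_derivative_transform_within[where d = x and f = f1])
        (use 2 f1_deriv_at in \<open>auto simp: F1_def F2_def dist_real_def\<close>)
  next
    case 3
    show ?thesis by (rule has_field_derivative_transform_within[where d = "-x" and f = "\<lambda>x. f2 0 * sin x"])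
        (use 3 in \<open>auto simp: F1_def F2_def dist_real_def intro!: derivative_eq_intros\<close>)
  qed
qed

lemma F2_cont: "continuous_on S F2"
proof -
  have "continuous_on ({0..} \<union> {..0}) (\<lambda>x. if 0 \<le> x then f2 x else f2 0 * cos x)"
  proof (rule continuous_on_If)
  qed (use f2_cont in \<open>auto intro!: continuous_intros\<close>)
  moreover have "{0..} \<union> {..0} = (UNIV :: real set)" by auto
  ultimately have "continuous_on UNIV F2" unfolding F2_def[abs_def] by simp
  then show ?thesis by (rule continuous_on_subset) simp
qed

text \<open>The first entry of the maximum bounds \<open>f1\<close>, whose largest value is at the
  inflection point \<beta>; the second bounds the sine continuation.\<close>

sublocale radial_flow F F1 "max (f1 \<beta>) (f2 0)"
proof
  show "continuous_on UNIV F1" using F1_has_deriv by (meson DERIV_continuous_on has_field_derivative_at_within)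
  show "\<bar>F1 x\<bar> \<le> max (f1 \<beta>) (f2 0)" for x
  proof (cases "x \<ge> 0")
    case True
    then have "f1 x \<ge> 0" using f1_pos[of x] f1_0 by (cases "x = 0") auto
    then show ?thesis using True f1_le[of x] by (auto simp: F1_def)
  next
    case False
    have "f2 0 * \<bar>sin x\<bar> \<le> f2 0 * 1" using f2_0_nonneg by (intro mult_left_mono) auto
    then show ?thesis using False f2_0_nonneg by (auto simp: F1_def abs_mult)
  qed
qed (use F_has_deriv f_0 in \<open>auto simp: F_def\<close>)

lemma F_nonneg: "0 \<le> F x"
  using f_pos[of x] f_0 f2_0_nonneg by (cases "x = 0") (auto simp: F_def)

lemma F_pos: "0 < x \<Longrightarrow> 0 < F x" using f_pos by (simp add: F_def)

lemma F1_pos: "0 < x \<Longrightarrow> 0 < F1 x" using f1_pos by (simp add: F1_def)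

lemma F1_0: "F1 0 = 0" by (simp add: F1_def f1_0)

section \<open>Solutions decrease through a unique zero\<close>

lemma mult_sol'_cont: "continuous_on {0..T} (\<lambda>r. r * sol' a r)"
  by (intro continuous_intros continuous_on_subset[OF sol'_cont]) auto

lemma mult_sol'_antimono:
  assumes "0 \<le> r" "r \<le> s" shows "s * sol' a s \<le> r * sol' a r"
proof (cases "r = s")
  case False
  show ?thesis
  proof (rule DERIV_nonpos_imp_decreasing_open[of r s])
    fix x assume "r < x" "x < s"
    then have "x > 0" using assms by simp
    then have "((\<lambda>r. r * sol' a r) has_real_derivative - x * F (sol a x)) (at x)" by (rule mult_sol'_deriv)
    moreover have "- x * F (sol a x) \<le> 0" using F_nonneg[of "sol a x"] \<open>x > 0\<close> by simp
    ultimately show "\<exists>D. ((\<lambda>r. r * sol' a r) has_real_derivative D) (at x) \<and> D \<le> 0" by blast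
  qed (use assms in \<open>auto intro: continuous_on_subset[OF mult_sol'_cont[of s]]\<close>)
qed simp

lemma mult_sol'_strict:
  assumes "0 \<le> r" "r < s" and pos: "\<And>x. r < x \<Longrightarrow> x < s \<Longrightarrow> 0 < sol a x"
  shows "s * sol' a s < r * sol' a r"
proof (rule DERIV_neg_imp_decreasing_open[OF assms(2)])
  fix x assume x: "r < x" "x < s"
  then have "x > 0" using assms by simp
  then have "((\<lambda>r. r * sol' a r) has_real_derivative - x * F (sol a x)) (at x)" by (rule mult_sol'_deriv)
  moreover have "- x * F (sol a x) < 0" using F_pos[OF pos[OF x]] \<open>x > 0\<close> by simp
  ultimately show "\<exists>D. ((\<lambda>r. r * sol' a r) has_real_derivative D) (at x) \<and> D < 0" by blast
qed (use assms in \<open>auto intro: continuous_on_subset[OF mult_sol'_cont[of s]]\<close>)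

text \<open>\<open>r * sol' a r\<close> starts at \<open>0\<close>, drops strictly while the
  solution is still positive near the origin, and never rises again because the extended
  \<open>F\<close> is nonnegative everywhere.\<close>

lemma sol'_neg:
  assumes a: "a > 0" and r: "r > 0" shows "sol' a r < 0"
proof -
  have "continuous (at 0 within {0..}) (sol a)" using sol_cont by (auto simp: continuous_on_eq_continuous_within)
  then have "\<forall>\<^sub>F s in at 0 within {0..}. sol a s > 0"
    unfolding continuous_within using a by (auto intro: order_tendstoD)
  then obtain d where d: "d > 0" "\<And>s. s > 0 \<Longrightarrow> s < d \<Longrightarrow> sol a s > 0"
    by (auto simp: eventually_at dist_real_def)
  define s where "s = min r (d/2)"
  have s: "0 < s" "s \<le> r" "s < d" using d r by (auto simp: s_def)
  have "r * sol' a r \<le> s * sol' a s" using s by (intro mult_sol'_antimono) auto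
  also have "\<dots> < 0 * sol' a 0" using s d by (intro mult_sol'_strict) auto
  finally show ?thesis using r by (simp add: mult_less_0_iff)
qed

lemma sol_decreasing:
  assumes "a > 0" "0 \<le> r" "r < s" shows "sol a s < sol a r"
proof (rule DERIV_neg_imp_decreasing_open[OF assms(3)])
  fix x assume "r < x" "x < s"
  then show "\<exists>D. (sol a has_real_derivative D) (at x) \<and> D < 0"
    using assms by (auto intro!: exI[of _ "sol' a x"] sol_deriv sol'_neg)
qed (use assms in \<open>auto intro: continuous_on_subset[OF sol_cont]\<close>)

text \<open>In two dimensions the logarithm is unbounded: from \<open>r = 1\<close> on
  \<open>r * u'\<close> is at most \<open>- c < 0\<close>, so
  \<open>u r \<le> u 1 - c * ln r\<close>.\<close>

lemma sol_zero_ex: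
  assumes a: "a > 0" shows "\<exists>r>0. sol a r = 0"
proof -
  define c where "c = - sol' a 1"
  have c: "c > 0" using sol'_neg[OF a, of 1] by (simp add: c_def)
  define s where "s = exp (\<bar>sol a 1\<bar> / c)"
  have s: "s \<ge> 1" using c by (simp add: s_def)
  have "sol a s + c * ln s \<le> sol a 1 + c * ln 1"
  proof (cases "s = 1")
    case False
    show ?thesis
    proof (rule DERIV_nonpos_imp_decreasing_open[of 1 s])
      fix x :: real assume x: "1 < x" "x < s"
      have "((\<lambda>x. sol a x + c * ln x) has_real_derivative sol' a x + c * (1 / x)) (at x)"
        using x by (intro DERIV_add sol_deriv DERIV_cmult) (auto intro!: derivative_eq_intros)
      moreover have "x * sol' a x \<le> 1 * sol' a 1" using x by (intro mult_sol'_antimono) auto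
      then have "sol' a x + c * (1 / x) \<le> 0" using x by (simp add: c_def field_simps)
      ultimately show "\<exists>D. ((\<lambda>x. sol a x + c * ln x) has_real_derivative D) (at x) \<and> D \<le> 0" by blast
    qed (use s False in \<open>auto intro!: continuous_intros continuous_on_subset[OF sol_cont]\<close>)
  qed simp
  moreover have "c * ln s = \<bar>sol a 1\<bar>" using c by (simp add: s_def)
  ultimately have "sol a s \<le> 0" by simp
  then have "\<exists>r\<ge>0. r \<le> s \<and> sol a r = 0"
    using a s by (intro IVT2' ) (auto intro: sol_contT)
  then show ?thesis using a by (metis order_le_less sol_0)
qed

definition rad :: "real \<Rightarrow> real" where "rad a = (SOME r. r > 0 \<and> sol a r = 0)"

lemma rad: assumes "a > 0" shows rad_pos: "rad a > 0" and sol_rad: "sol a (rad a) = 0"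
proof -
  have "rad a > 0 \<and> sol a (rad a) = 0" unfolding rad_def by (rule someI_ex) (rule sol_zero_ex[OF assms])
  then show "rad a > 0" "sol a (rad a) = 0" by auto
qed

lemma rad_unique: "a > 0 \<Longrightarrow> r \<ge> 0 \<Longrightarrow> sol a r = 0 \<Longrightarrow> r = rad a"
  using sol_decreasing[of a r "rad a"] sol_decreasing[of a "rad a" r] rad[of a]
  by (cases r "rad a" rule: linorder_cases) auto

lemma sol_pos_iff: "a > 0 \<Longrightarrow> r \<ge> 0 \<Longrightarrow> 0 < sol a r \<longleftrightarrow> r < rad a"
  using sol_decreasing[of a r "rad a"] sol_decreasing[of a "rad a" r] rad[of a]
  by (cases r "rad a" rule: linorder_cases) auto

lemma sol_neg_iff: "a > 0 \<Longrightarrow> r \<ge> 0 \<Longrightarrow> sol a r < 0 \<longleftrightarrow> rad a < r"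
  using sol_decreasing[of a r "rad a"] sol_decreasing[of a "rad a" r] rad[of a]
  by (cases r "rad a" rule: linorder_cases) auto

lemma sol_le: "a > 0 \<Longrightarrow> r \<ge> 0 \<Longrightarrow> sol a r \<le> a"
  using sol_decreasing[of a 0 r] by (cases "r = 0") auto

text \<open>At \<open>r = rad a\<close> the integral equation says that \<open>a\<close> is the
  potential of \<open>F (sol a)\<close>, whose density is at most \<open>f a\<close> up to the zero.
  This bound yields both \<open>rad_at_top\<close> and \<open>rad_at_0\<close>.\<close>

lemma rad_lower:
  assumes a: "a > 0" shows "a \<le> f a * (rad a)\<^sup>2"
proof -
  have "\<bar>radial_pot (\<lambda>s. F (sol a s)) (rad a)\<bar> \<le> f a * (rad a)\<^sup>2"
  proof (rule abs_radial_pot_le[OF F_sol_cont(2)])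
    fix s assume s: "0 \<le> s" "s \<le> rad a"
    then have "0 \<le> sol a s" using sol_pos_iff[OF a s(1)] sol_rad[OF a] by (cases "s = rad a") auto
    then show "\<bar>F (sol a s)\<bar> \<le> f a"
      using sol_le[OF a s(1)] F_nonneg[of "sol a s"] by (auto simp: F_def intro: f_mono)
  qed (use rad_pos[OF a] in auto)
  then show ?thesis using sol_eq[of "rad a" a] rad[OF a] by auto
qed

lemma rad_at_top: "filterlim (\<lambda>a. (rad a)\<^sup>2) at_top at_top"
proof (rule filterlim_at_top_mono)
  show "filterlim (\<lambda>a. a / f0) at_top at_top"
    using filterlim_tendsto_pos_mult_at_top[OF tendsto_const _ filterlim_ident, of "1 / f0"] f0_pos by simp
  show "\<forall>\<^sub>F a in at_top. a / f0 \<le> (rad a)\<^sup>2" using eventually_gt_at_top[of 0]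
  proof eventually_elim
    case (elim a)
    have "a \<le> f a * (rad a)\<^sup>2" using rad_lower elim by simp
    also have "\<dots> \<le> f0 * (rad a)\<^sup>2" using f_le[of a] elim by (intro mult_right_mono) auto
    finally show ?case using f0_pos by (simp add: field_simps)
  qed
qed

lemma rad_at_0: "filterlim (\<lambda>a. (rad a)\<^sup>2) at_top (at_right 0)"
proof (rule filterlim_at_top_mono)
  have "((\<lambda>a. (f a - f 0) / (a - 0)) \<longlongrightarrow> f1 0) (at 0 within {0..})"
    using f_deriv[of 0] by (simp add: has_field_derivative_iff)
  then have "((\<lambda>a. f a / a) \<longlongrightarrow> 0) (at 0 within {0..})" by (simp add: f_0 f1_0)
  then have "((\<lambda>a. f a / a) \<longlongrightarrow> 0) (at_right 0)" by (rule tendsto_within_subset) auto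
  moreover have "\<forall>\<^sub>F a in at_right 0. f a / a > 0"
    unfolding eventually_at_right_field using f_pos by (auto intro!: exI[of _ 1])
  ultimately have "filterlim (\<lambda>a. inverse (f a / a)) at_top (at_right 0)"
    by (rule filterlim_inverse_at_top)
  then show "filterlim (\<lambda>a. a / f a) at_top (at_right 0)" by simp
  show "\<forall>\<^sub>F a in at_right 0. a / f a \<le> (rad a)\<^sup>2"
    unfolding eventually_at_right_field
  proof (intro exI[of _ 1] conjI allI impI)
    fix a :: real assume "0 < a" "a < 1"
    then show "a / f a \<le> (rad a)\<^sup>2" using rad_lower[of a] f_pos[of a] by (simp add: field_simps)
  qed simp
qed

text \<open>The signs of \<open>sol b\<close> at the radii \<open>rad a - d\<close> and
  \<open>rad a + d\<close> persist for \<open>b\<close> near \<open>a\<close> and enclose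
  \<open>rad b\<close>.\<close>

lemma isCont_rad:
  assumes a: "a > 0" shows "isCont rad a"
  unfolding isCont_def
proof (rule tendstoI)
  fix e :: real assume "e > 0"
  define d where "d = min (e/2) (rad a / 2)"
  have d: "0 < d" "d < e" "d < rad a" using \<open>e > 0\<close> rad_pos[OF a] by (auto simp: d_def)
  have *: "((\<lambda>b. sol b r) \<longlongrightarrow> sol a r) (at a)" if "r \<ge> 0" for r
    using DERIV_isCont[OF sol_param_deriv[OF that]] by (simp add: isCont_def)
  have "\<forall>\<^sub>F b in at a. 0 < sol b (rad a - d)"
    by (rule order_tendstoD(1)[OF *]) (use d sol_pos_iff[OF a, of "rad a - d"] in auto)
  moreover have "\<forall>\<^sub>F b in at a. sol b (rad a + d) < 0"
    by (rule order_tendstoD(2)[OF *]) (use d sol_neg_iff[OF a, of "rad a + d"] rad_pos[OF a] in auto)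
  moreover have "\<forall>\<^sub>F b in at a. 0 < b" using a by (intro order_tendstoD[OF tendsto_ident_at])
  ultimately show "\<forall>\<^sub>F b in at a. dist (rad b) (rad a) < e"
  proof eventually_elim
    case (elim b)
    then show ?case using sol_pos_iff[of b "rad a - d"] sol_neg_iff[of b "rad a + d"] d rad_pos[OF a]
      by (auto simp: dist_real_def)
  qed
qed

text \<open>Obtained by implicit differentiation of \<open>sol a (rad a) = 0\<close>.\<close>

definition rad' :: "real \<Rightarrow> real" where "rad' a = - var a (rad a) / sol' a (rad a)"

text \<open>The equation \<open>sol b (rad b) = 0\<close> splits into the change of parameter at the
  fixed radius \<open>rad a\<close> and, by the mean value theorem,
  \<open>(rad b - rad a) * sol' b (\<xi> b)\<close>. The intermediate point tends to
  \<open>rad a\<close>, and \<open>sol'\<close> is jointly continuous and nonzero there.\<close>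

lemma rad_deriv:
  assumes a: "a > 0" shows "(rad has_real_derivative rad' a) (at a)"
proof -
  have "\<exists>\<xi>. b > 0 \<longrightarrow> min (rad a) (rad b) \<le> \<xi> \<and> \<xi> \<le> max (rad a) (rad b) \<and>
     sol b (rad b) - sol b (rad a) = (rad b - rad a) * sol' b \<xi>" for b
  proof (cases "b > 0")
    case True
    have "(sol b has_real_derivative sol' b x) (at x)" if "min (rad a) (rad b) \<le> x" for x
      using that rad_pos[OF a] rad_pos[OF True] by (intro sol_deriv) linarith
    then show ?thesis using MVT_between[of "rad a" "rad b" "sol b" "sol' b"] by blast
  qed simp
  then obtain \<xi> where \<xi>: "\<And>b. b > 0 \<Longrightarrow> min (rad a) (rad b) \<le> \<xi> b \<and> \<xi> b \<le> max (rad a) (rad b) \<and>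
     sol b (rad b) - sol b (rad a) = (rad b - rad a) * sol' b (\<xi> b)" by metis
  have ev: "\<forall>\<^sub>F b in at a. 0 < b" using a by (intro order_tendstoD[OF tendsto_ident_at])
  have radlim: "(rad \<longlongrightarrow> rad a) (at a)" using isCont_rad[OF a] by (simp add: isCont_def)
  have "(\<xi> \<longlongrightarrow> rad a) (at a)"
  proof (rule tendsto_sandwich)
    show "((\<lambda>b. min (rad a) (rad b)) \<longlongrightarrow> rad a) (at a)" using tendsto_min[OF tendsto_const radlim, of "rad a"] by simp
    show "((\<lambda>b. max (rad a) (rad b)) \<longlongrightarrow> rad a) (at a)" using tendsto_max[OF tendsto_const radlim, of "rad a"] by simp
  qed (use ev \<xi> in \<open>auto elim: eventually_mono\<close>)
  then have "((\<lambda>b. (b, \<xi> b)) \<longlongrightarrow> (a, rad a)) (at a)" by (intro tendsto_intros)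
  then have "((\<lambda>b. sol' (fst (b, \<xi> b)) (snd (b, \<xi> b))) \<longlongrightarrow> sol' (fst (a, rad a)) (snd (a, rad a))) (at a)"
  proof (rule continuous_on_tendsto_compose[OF sol'_jcont])
    show "\<forall>\<^sub>F b in at a. (b, \<xi> b) \<in> UNIV \<times> {0..}" using ev
    proof eventually_elim
      case (elim b) then show ?case using \<xi>[OF elim] rad_pos[OF a] rad_pos[OF elim] by auto
    qed
  qed (use rad_pos[OF a] in auto)
  then have s': "((\<lambda>b. sol' b (\<xi> b)) \<longlongrightarrow> sol' a (rad a)) (at a)" by simp
  have "((\<lambda>b. (sol b (rad a) - sol a (rad a)) / (b - a)) \<longlongrightarrow> var a (rad a)) (at a)"
    using sol_param_deriv[of "rad a" a] rad_pos[OF a] by (simp add: has_field_derivative_iff)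
  then have "((\<lambda>b. - ((sol b (rad a) - sol a (rad a)) / (b - a)) / sol' b (\<xi> b)) \<longlongrightarrow> rad' a) (at a)"
    unfolding rad'_def using s' sol'_neg[OF a rad_pos[OF a]] by (intro tendsto_intros) auto
  moreover have "\<forall>\<^sub>F b in at a. (rad b - rad a) / (b - a) = - ((sol b (rad a) - sol a (rad a)) / (b - a)) / sol' b (\<xi> b)"
    using ev
  proof eventually_elim
    case (elim b)
    have "sol' b (\<xi> b) < 0" using \<xi>[OF elim] rad_pos[OF a] rad_pos[OF elim] by (intro sol'_neg[OF elim]) auto
    moreover have "- sol b (rad a) = (rad b - rad a) * sol' b (\<xi> b)" using \<xi>[OF elim] sol_rad[OF elim] by simp
    ultimately have "rad b - rad a = - sol b (rad a) / sol' b (\<xi> b)" by (simp add: field_simps)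
    then show ?case using sol_rad[OF a] by simp
  qed
  ultimately have "((\<lambda>b. (rad b - rad a) / (b - a)) \<longlongrightarrow> rad' a) (at a)"
    by (subst tendsto_cong)
  then show ?thesis by (simp add: has_field_derivative_iff)
qed

lemma rad_cont: "continuous_on {0<..} rad"
  using isCont_rad by (intro continuous_at_imp_continuous_on) auto

lemma rad_pair_cont:
  assumes "continuous_on (UNIV \<times> {0..}) (\<lambda>p. h (fst p) (snd p))"
  shows "continuous_on {0<..} (\<lambda>a. h a (rad a))"
proof -
  have "continuous_on {0<..} (\<lambda>a. (\<lambda>p. h (fst p) (snd p)) (a, rad a))"
  proof (rule continuous_on_compose2[OF assms])
    show "continuous_on {0<..} (\<lambda>a. (a, rad a))" by (intro continuous_on_Pair continuous_on_id rad_cont)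
    show "(\<lambda>a. (a, rad a)) ` {0<..} \<subseteq> UNIV \<times> {0..}" using less_imp_le[OF rad_pos] by auto
  qed
  then show ?thesis by simp
qed

lemma rad'_cont: "continuous_on {0<..} rad'"
  unfolding rad'_def[abs_def]
proof (intro continuous_intros rad_pair_cont var_jcont sol'_jcont ballI)
  fix a :: real assume "a \<in> {0<..}"
  then show "sol' a (rad a) \<noteq> 0" using sol'_neg[of a "rad a"] rad_pos[of a] by simp
qed

lemma rad'_sgn:
  assumes "a > 0" shows "rad' a = 0 \<longleftrightarrow> var a (rad a) = 0" "rad' a > 0 \<longleftrightarrow> var a (rad a) > 0"
    "rad' a < 0 \<longleftrightarrow> var a (rad a) < 0"
  using sol'_neg[OF assms rad_pos[OF assms]]
  by (auto simp: rad'_def zero_less_divide_iff divide_less_0_iff)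

section \<open>Wronskians and the sign of the linearized solution\<close>

lemma F_sol_deriv: "r > 0 \<Longrightarrow> ((\<lambda>r. F (sol a r)) has_real_derivative F1 (sol a r) * sol' a r) (at r)"
  by (rule DERIV_chain2[OF F_has_deriv sol_deriv])

lemma F1_sol_deriv: "r > 0 \<Longrightarrow> ((\<lambda>r. F1 (sol a r)) has_real_derivative F2 (sol a r) * sol' a r) (at r)"
  by (rule DERIV_chain2[OF F1_has_deriv sol_deriv])

lemma sol'_contS: "S \<subseteq> {0..} \<Longrightarrow> continuous_on S (sol' a)"
  and sol_contS: "S \<subseteq> {0..} \<Longrightarrow> continuous_on S (sol a)"
  and var_contS: "S \<subseteq> {0..} \<Longrightarrow> continuous_on S (var a)"
  and var'_contS: "S \<subseteq> {0..} \<Longrightarrow> continuous_on S (var' a)"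
  and F_sol_contS: "S \<subseteq> {0..} \<Longrightarrow> continuous_on S (\<lambda>r. F (sol a r))"
  and F1_sol_contS: "S \<subseteq> {0..} \<Longrightarrow> continuous_on S (\<lambda>r. F1 (sol a r))"
  by (erule continuous_on_subset[rotated], rule sol'_cont sol_cont var_cont var'_cont F_sol_cont F1_sol_cont)+

lemma F2_sol_contS: "S \<subseteq> {0..} \<Longrightarrow> continuous_on S (\<lambda>r. F2 (sol a r))"
  by (rule continuous_on_compose2[OF F2_cont[of UNIV] sol_contS]) auto

lemmas flow_cont = sol'_contS sol_contS var_contS var'_contS F_sol_contS F1_sol_contS F2_sol_contS

text \<open>\<open>r\<close> times the Wronskian of \<open>var a\<close> with \<open>r u' + c\<close> here, and with \<open>- u'\<close> in \<open>wronski_radial\<close> below; second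
  derivatives are eliminated by means of the differential equation.\<close>
definition wronski_scaling :: "real \<Rightarrow> real \<Rightarrow> real \<Rightarrow> real" where
  "wronski_scaling a c r = - (r * r * F (sol a r) * var a r) - (r * sol' a r + c) * (r * var' a r)"

lemma wronski_scaling_deriv:
  assumes "r > 0"
  shows "(wronski_scaling a c has_real_derivative r * var a r * (c * F1 (sol a r) - 2 * F (sol a r))) (at r)"
  unfolding wronski_scaling_def[abs_def]
  by (rule DERIV_cong[OF DERIV_diff[OF DERIV_minus[OF DERIV_mult[OF DERIV_mult[OF DERIV_mult[OF DERIV_ident DERIV_ident] F_sol_deriv] var_deriv]]
        DERIV_mult[OF DERIV_add[OF mult_sol'_deriv DERIV_const] mult_var'_deriv]]])
     (use assms in \<open>auto simp: algebra_simps\<close>)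

lemma wronski_scaling_cont: "0 \<le> x \<Longrightarrow> continuous_on {x..y} (wronski_scaling a c)"
  unfolding wronski_scaling_def[abs_def] by (intro continuous_intros flow_cont) auto

definition wronski_radial :: "real \<Rightarrow> real \<Rightarrow> real" where
  "wronski_radial a r = - ((r * var' a r) * sol' a r) - var a r * (sol' a r + r * F (sol a r))"

text \<open>Differentiating the equation in \<open>r\<close> shows that \<open>u'\<close> solves the
  linearized equation up to the right-hand side \<open>u' / r\<^sup>2\<close>; after weighting with
  \<open>r\<close> this is the one term left.\<close>

lemma wronski_radial_deriv:
  assumes "r > 0"
  shows "(wronski_radial a has_real_derivative var a r * sol' a r / r) (at r)"
  unfolding wronski_radial_def[abs_def]
  by (rule DERIV_cong[OF DERIV_diff[OF DERIV_minus[OF DERIV_mult[OF mult_var'_deriv sol'_deriv]]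
        DERIV_mult[OF var_deriv DERIV_add[OF sol'_deriv DERIV_mult[OF DERIV_ident F_sol_deriv]]]]])
     (use assms in \<open>auto simp: field_simps\<close>)

lemma wronski_radial_neg:
  assumes a: "a > 0" and r: "0 < r" and pos: "\<And>s. 0 \<le> s \<Longrightarrow> s < r \<Longrightarrow> 0 < var a s"
  shows "wronski_radial a r < 0"
proof -
  have "wronski_radial a r < wronski_radial a 0"
  proof (rule DERIV_neg_imp_decreasing_open[OF r])
    fix x assume x: "0 < x" "x < r"
    have "var a x * sol' a x / x < 0"
      using pos[of x] sol'_neg[OF a] x by (simp add: divide_neg_pos mult_pos_neg)
    then show "\<exists>D. (wronski_radial a has_real_derivative D) (at x) \<and> D < 0"
      using wronski_radial_deriv[of x a] x by blast
  next
    show "continuous_on {0..r} (wronski_radial a)"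
      unfolding wronski_radial_def[abs_def] by (intro continuous_intros flow_cont) auto
  qed
  then show ?thesis by (simp add: wronski_radial_def)
qed

text \<open>Where \<open>w = var a\<close> vanishes, the Wronskian reduces to
  \<open>- r * w' * u'\<close>; it is negative and so is \<open>u'\<close>.\<close>

lemma var'_neg_at_zero:
  assumes a: "a > 0" and r: "0 < r" and pos: "\<And>s. 0 \<le> s \<Longrightarrow> s < r \<Longrightarrow> 0 < var a s" and 0: "var a r = 0"
  shows "var' a r < 0"
proof -
  have "wronski_radial a r < 0" using wronski_radial_neg[OF a r pos] .
  then have "0 < r * (var' a r * sol' a r)" by (simp add: wronski_radial_def 0 mult_ac)
  then show ?thesis using sol'_neg[OF a r] r by (simp add: zero_less_mult_iff)
qed

lemma var_ratio_decreasing: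
  assumes a: "a > 0" and pos: "\<And>s. 0 \<le> s \<Longrightarrow> s < t \<Longrightarrow> 0 < var a s" and rs: "0 < r" "r < s" "s < t"
  shows "var a s / (- sol' a s) < var a r / (- sol' a r)"
proof (rule DERIV_neg_imp_decreasing[OF rs(2), where f = "\<lambda>x. var a x / (- sol' a x)"])
  fix x assume x: "r \<le> x" "x \<le> s"
  then have x0: "x > 0" using rs by simp
  have s0: "sol' a x < 0" using sol'_neg[OF a x0] .
  have "((\<lambda>x. var a x / (- sol' a x)) has_real_derivative wronski_radial a x / (x * (sol' a x * sol' a x))) (at x)"
    by (rule DERIV_cong[OF DERIV_divide[OF var_deriv[OF x0] DERIV_minus[OF sol'_deriv[OF x0]]]])
       (use s0 x0 in \<open>auto simp: wronski_radial_def field_simps\<close>)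
  moreover have "wronski_radial a x < 0" using pos x rs by (intro wronski_radial_neg a x0) auto
  then have "wronski_radial a x / (x * (sol' a x * sol' a x)) < 0"
    using x0 s0 by (intro divide_neg_pos) (auto simp: mult_neg_neg)
  ultimately show "\<exists>D. ((\<lambda>x. var a x / (- sol' a x)) has_real_derivative D) (at x) \<and> D < 0" by blast
qed

text \<open>Two sign changes have to be placed at the same radius \<open>q\<close>: that of
  \<open>r * u' + c\<close>, which forces \<open>c = - q * u' q\<close>, and that of
  \<open>c * F1 u - 2 * F u\<close>. So \<open>q\<close> is sought as a zero of the second
  expression with this value of \<open>c\<close> inserted. The signs on either side follow because
  \<open>r * u'\<close> decreases up to the zero of \<open>u\<close> and \<open>F1 / F\<close>
  decreases in \<open>u\<close>, hence increases in \<open>r\<close>.\<close>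

lemma balance_point:
  assumes a: "a > 0"
  obtains q c where "0 < q" "q < rad a" "c > 0"
    "\<And>r. 0 < r \<Longrightarrow> r < q \<Longrightarrow> c * F1 (sol a r) < 2 * F (sol a r)"
    "\<And>r. q < r \<Longrightarrow> r < rad a \<Longrightarrow> 2 * F (sol a r) < c * F1 (sol a r)"
    "\<And>r. 0 \<le> r \<Longrightarrow> r \<le> q \<Longrightarrow> 0 \<le> r * sol' a r + c"
    "\<And>r. q < r \<Longrightarrow> r \<le> rad a \<Longrightarrow> r * sol' a r + c < 0"
proof -
  define R where "R = rad a"
  have R: "R > 0" "sol a R = 0" using rad[OF a] by (auto simp: R_def)
  \<comment> \<open>Negative at \<open>0\<close>, where it equals \<open>- 2 * F a\<close>. Near the
    zero of \<open>u\<close>, \<open>- r * u'\<close> stays away from \<open>0\<close> while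
    \<open>u\<close> is small; together with \<open>u * f1 u > f u\<close> this makes it
    positive.\<close>
  define \<psi> where "\<psi> r = - (r * sol' a r) * F1 (sol a r) - 2 * F (sol a r)" for r
  have cont: "isCont (sol a) R" "isCont (sol' a) R"
    using DERIV_isCont[OF sol_deriv] DERIV_isCont[OF sol'_deriv] R by auto
  have "((\<lambda>r. - (r * sol' a r) - 2 * sol a r) \<longlongrightarrow> - (R * sol' a R) - 2 * sol a R) (at R)"
    using cont unfolding isCont_def by (intro tendsto_intros)
  then have "\<forall>\<^sub>F r in at R. 0 < - (r * sol' a r) - 2 * sol a r"
    by (rule order_tendstoD) (use R sol'_neg[OF a R(1)] in \<open>auto simp: mult_pos_neg\<close>)
  moreover have "\<forall>\<^sub>F r in at R. sol a r < \<beta>"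
    by (rule order_tendstoD) (use R cont beta_pos in \<open>auto simp: isCont_def\<close>)
  moreover have "\<forall>\<^sub>F r in at R. 0 < r" using R by (intro order_tendstoD[OF tendsto_ident_at])
  ultimately have "\<forall>\<^sub>F r in at R. 0 < - (r * sol' a r) - 2 * sol a r \<and> sol a r < \<beta> \<and> 0 < r"
    by eventually_elim simp
  then have "\<forall>\<^sub>F r in at_left R. 0 < - (r * sol' a r) - 2 * sol a r \<and> sol a r < \<beta> \<and> 0 < r"
    by (simp add: eventually_at_split)
  moreover have "\<forall>\<^sub>F r in at_left R. r < R" by (simp add: eventually_at_filter)
  ultimately have "\<forall>\<^sub>F r in at_left R. 0 < - (r * sol' a r) - 2 * sol a r \<and> sol a r < \<beta> \<and> 0 < r \<and> r < R"
    by eventually_elim simp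
  from eventually_happens'[OF trivial_limit_at_left_real this]
  obtain r1 where "0 < - (r1 * sol' a r1) - 2 * sol a r1" and r1: "sol a r1 < \<beta>" "0 < r1" "r1 < R" by blast
  then have r1': "2 * sol a r1 < - (r1 * sol' a r1)" by linarith
  have s1: "0 < sol a r1" using sol_pos_iff[OF a, of r1] r1 by (simp add: R_def)
  have "2 * F (sol a r1) < 2 * (sol a r1 * F1 (sol a r1))"
    using superlinear[OF s1 r1(1)] s1 by (simp add: F_def F1_def)
  also have "\<dots> \<le> - (r1 * sol' a r1) * F1 (sol a r1)"
    using mult_right_mono[OF less_imp_le[OF r1'], of "F1 (sol a r1)"] F1_pos[OF s1] by simp
  finally have \<psi>1: "\<psi> r1 > 0" by (simp add: \<psi>_def)
  have \<psi>0: "\<psi> 0 < 0" using F_pos[OF a] by (simp add: \<psi>_def)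
  have "\<exists>q\<ge>0. q \<le> r1 \<and> \<psi> q = 0"
  proof (rule IVT')
    show "continuous_on {0..r1} \<psi>" unfolding \<psi>_def[abs_def] by (intro continuous_intros flow_cont) auto
  qed (use \<psi>0 \<psi>1 r1 in auto)
  then obtain q where q: "0 \<le> q" "q \<le> r1" "\<psi> q = 0" by blast
  have q0: "0 < q" using q \<psi>0 by (cases "q = 0") auto
  have qR: "q < R" using q r1 by simp
  define c where "c = - (q * sol' a q)"
  have c: "c > 0" using q0 sol'_neg[OF a q0] by (simp add: c_def mult_pos_neg)
  have sq: "sol a q > 0" using sol_pos_iff[OF a, of q] q0 qR by (simp add: R_def)
  have bal: "c * f1 (sol a q) = 2 * f (sol a q)" using q(3) sq by (simp add: \<psi>_def c_def F_def F1_def)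
  have ratio: "f1 (sol a q) / f (sol a q) = 2 / c" using bal c f_pos[OF sq] by (simp add: field_simps)
  show ?thesis
  proof (rule that[OF q0 qR[unfolded R_def] c])
    fix r assume r: "0 < r" "r < q"
    have "sol a q < sol a r" using r a by (intro sol_decreasing) auto
    from log_deriv_decreasing[OF sq this] show "c * F1 (sol a r) < 2 * F (sol a r)"
      using ratio c sq \<open>sol a q < sol a r\<close> f_pos[of "sol a r"] by (simp add: F_def F1_def field_simps)
  next
    fix r assume r: "q < r" "r < rad a"
    have "sol a r < sol a q" "0 < sol a r" using r a q0 sol_pos_iff[OF a, of r] by (auto intro: sol_decreasing)
    then show "2 * F (sol a r) < c * F1 (sol a r)"
      using log_deriv_decreasing[of "sol a r" "sol a q"] ratio c f_pos[of "sol a r"] by (simp add: F_def F1_def field_simps)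
  next
    fix r assume r: "0 \<le> r" "r \<le> q"
    show "0 \<le> r * sol' a r + c" using mult_sol'_antimono[OF r, of a] by (simp add: c_def)
  next
    fix r assume r: "q < r" "r \<le> rad a"
    have "r * sol' a r < q * sol' a q"
      using r q0 sol_pos_iff[OF a] by (intro mult_sol'_strict) auto
    then show "r * sol' a r + c < 0" by (simp add: c_def)
  qed
qed

text \<open>The multiplier \<open>z = r u' + c\<close> satisfies \<open>L z = c F1 u - 2 F u\<close> for the linearization \<open>L\<close> at \<open>u\<close>. Since
  \<open>F1 / F\<close> is decreasing, a suitable \<open>c\<close> makes \<open>z\<close> and \<open>L z\<close> change sign at the same radius
  with opposite signs, so Sturm comparison leaves room for at most one zero of \<open>var a\<close>
  on \<open>[0, rad a]\<close>.\<close>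
lemma var_pos:
  assumes a: "a > 0" and end_nonneg: "0 \<le> var a (rad a)" and r: "0 \<le> r" "r < rad a"
  shows "0 < var a r"
proof (rule ccontr)
  assume "\<not> 0 < var a r"
  then have "var a r \<le> 0" by simp
  obtain q c where qc: "0 < q" "q < rad a" "c > 0"
    "\<And>r. 0 < r \<Longrightarrow> r < q \<Longrightarrow> c * F1 (sol a r) < 2 * F (sol a r)"
    "\<And>r. q < r \<Longrightarrow> r < rad a \<Longrightarrow> 2 * F (sol a r) < c * F1 (sol a r)"
    "\<And>r. 0 \<le> r \<Longrightarrow> r \<le> q \<Longrightarrow> 0 \<le> r * sol' a r + c"
    "\<And>r. q < r \<Longrightarrow> r \<le> rad a \<Longrightarrow> r * sol' a r + c < 0"
    by (rule balance_point[OF a]) blast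
  obtain \<rho> where \<rho>: "0 < \<rho>" "\<rho> \<le> r" "var a \<rho> = 0" "\<And>x. 0 \<le> x \<Longrightarrow> x < \<rho> \<Longrightarrow> 0 < var a x"
    using first_zero[of 0 r "var a"] r \<open>var a r \<le> 0\<close> var_contT[of r a] by auto
  have v': "var' a \<rho> < 0" by (rule var'_neg_at_zero[OF a \<rho>(1) \<rho>(4) \<rho>(3)])
  have W\<rho>: "wronski_scaling a c \<rho> = - ((\<rho> * sol' a \<rho> + c) * (\<rho> * var' a \<rho>))"
    by (simp add: wronski_scaling_def \<rho>)
  show False
  proof (cases "\<rho> \<le> q")
    \<comment> \<open>The first zero lies where \<open>z \<ge> 0\<close>. The Wronskian starts at
      \<open>0\<close> and decreases up to it, yet its value there is nonnegative as
      \<open>w' < 0\<close>.\<close>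
    case True
    have "wronski_scaling a c \<rho> < wronski_scaling a c 0"
    proof (rule DERIV_neg_imp_decreasing_open[OF \<rho>(1)])
      fix x assume x: "0 < x" "x < \<rho>"
      have "x * var a x * (c * F1 (sol a x) - 2 * F (sol a x)) < 0"
        using x \<rho>(4)[of x] qc(4)[of x] True by (intro mult_pos_neg mult_pos_pos) auto
      then show "\<exists>D. (wronski_scaling a c has_real_derivative D) (at x) \<and> D < 0"
        using wronski_scaling_deriv[OF x(1)] by blast
    qed (rule wronski_scaling_cont, simp)
    then have "wronski_scaling a c \<rho> < 0" by (simp add: wronski_scaling_def)
    moreover have "(\<rho> * sol' a \<rho> + c) * (\<rho> * var' a \<rho>) \<le> 0"
      using qc(6)[of \<rho>] True \<rho>(1) v' by (intro mult_nonneg_nonpos) (auto simp: mult_le_0_iff)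
    ultimately show False using W\<rho> by simp
  next
    \<comment> \<open>The first zero lies where \<open>z < 0\<close>. As \<open>w\<close> is
      nonnegative at the end, it returns to zero at some \<open>t\<close>. The Wronskian is negative
      at the first zero, decreases while \<open>w < 0\<close>, and yet is nonnegative at
      \<open>t\<close>.\<close>
    case False
    have z\<rho>: "\<rho> * sol' a \<rho> + c < 0" using qc(7)[of \<rho>] False \<rho> r by simp
    have "\<exists>d>0. \<forall>h>0. h < d \<longrightarrow> var a (\<rho> + h) < var a \<rho>"
      by (rule DERIV_neg_dec_right[OF var_deriv[OF \<rho>(1)] v'])
    then obtain d where d: "d > 0" "\<And>h. h > 0 \<Longrightarrow> h < d \<Longrightarrow> var a (\<rho> + h) < 0" using \<rho>(3) by auto
    define h where "h = min (d/2) ((rad a - \<rho>)/2)"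
    have h: "0 < h" "h < d" "\<rho> + h < rad a" using d r \<rho> by (auto simp: h_def min_def field_simps)
    have vc: "continuous_on {\<rho> + h..rad a} (\<lambda>x. - var a x)"
      by (intro continuous_intros flow_cont) (use \<rho>(1) h in auto)
    obtain t where t: "\<rho> + h < t" "t \<le> rad a" "- var a t = 0" "\<And>x. \<rho> + h \<le> x \<Longrightarrow> x < t \<Longrightarrow> 0 < - var a x"
      by (rule first_zero[OF vc]) (use h d(2)[of h] end_nonneg in auto)
    have neg: "var a x < 0" if "\<rho> < x" "x < t" for x
      using t(4)[of x] d(2)[of "x - \<rho>"] that h by (cases "x < \<rho> + h") auto
    have "((\<lambda>x. - var a x) has_real_derivative - var' a t) (at t)"
      using t h \<rho> by (intro DERIV_minus var_deriv) auto
    from deriv_nonpos_at_zero[OF this t(3,1,4)] have vt: "0 \<le> var' a t" by simp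
    have "wronski_scaling a c t < wronski_scaling a c \<rho>"
    proof (rule DERIV_neg_imp_decreasing_open[of \<rho> t "wronski_scaling a c"])
      fix x assume x: "\<rho> < x" "x < t"
      have "x * var a x * (c * F1 (sol a x) - 2 * F (sol a x)) < 0"
        using x neg[OF x] qc(5)[of x] t(2) False \<rho>(1) by (intro mult_neg_pos mult_pos_neg) auto
      then show "\<exists>D. (wronski_scaling a c has_real_derivative D) (at x) \<and> D < 0"
        using wronski_scaling_deriv[of x a c] x \<rho>(1) by auto
    qed (use h t \<rho>(1) in \<open>auto intro!: wronski_scaling_cont\<close>)
    moreover have "wronski_scaling a c \<rho> < 0"
      using mult_neg_neg[OF z\<rho>, of "\<rho> * var' a \<rho>"] \<rho>(1) v' by (simp add: W\<rho> mult_pos_neg)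
    moreover have "wronski_scaling a c t = - ((t * sol' a t + c) * (t * var' a t))"
      using t(3) by (simp add: wronski_scaling_def)
    moreover have "(t * sol' a t + c) * (t * var' a t) \<le> 0"
      using qc(7)[of t] False t h \<rho>(1) vt by (intro mult_nonpos_nonneg) auto
    ultimately show False by simp
  qed
qed

section \<open>Sign information at critical points\<close>

lemma F2_sol_identity:
  assumes a: "a > 0"
  shows "((\<lambda>r. r * var a r * F2 (sol a r) * (sol' a r * sol' a r)) has_integral 0) {0..rad a}"
proof -
  \<comment> \<open>\<open>r\<close> times the Wronskian of \<open>var a\<close> and
    \<open>F u\<close>. By the equation for \<open>u\<close>, the linearized operator maps
    \<open>F u\<close> to \<open>F2 u * (u')\<^sup>2\<close>. At \<open>rad a\<close> both
    \<open>F u\<close> and \<open>F1 u\<close> vanish, so the identity holds whether or not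
    \<open>a\<close> is critical.\<close>
  define Q where "Q r = var a r * F1 (sol a r) * (r * sol' a r) - F (sol a r) * (r * var' a r)" for r
  have "((\<lambda>r. r * var a r * F2 (sol a r) * (sol' a r * sol' a r)) has_integral Q (rad a) - Q 0) {0..rad a}"
  proof (rule fundamental_theorem_of_calculus_interior)
    show "continuous_on {0..rad a} Q" unfolding Q_def[abs_def] by (intro continuous_intros flow_cont) auto
    fix r assume "r \<in> {0<..<rad a}"
    then have r: "r > 0" by simp
    have "(Q has_real_derivative r * var a r * F2 (sol a r) * (sol' a r * sol' a r)) (at r)"
      unfolding Q_def[abs_def]
      by (rule DERIV_cong[OF DERIV_diff[OF DERIV_mult[OF DERIV_mult[OF var_deriv[OF r] F1_sol_deriv[OF r]] mult_sol'_deriv[OF r]]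
            DERIV_mult[OF F_sol_deriv[OF r] mult_var'_deriv[OF r]]]])
         (simp add: algebra_simps)
    then show "(Q has_vector_derivative r * var a r * F2 (sol a r) * (sol' a r * sol' a r)) (at r)"
      by (simp add: has_real_derivative_iff_has_vector_derivative)
  qed (use rad_pos[OF a] in simp)
  moreover have "Q (rad a) = 0" "Q 0 = 0" using sol_rad[OF a] by (auto simp: Q_def F1_0 F_0)
  ultimately show ?thesis by simp
qed

text \<open>By the previous identity one may subtract \<open>k\<^sup>2 (u')\<^sup>2\<close> from \<open>(var a)\<^sup>2\<close>; choosing \<open>k\<close> such that
  this changes sign where \<open>u = \<beta>\<close> makes the integrand negative.\<close>
lemma critical_F2_integral:
  assumes a: "a > 0" and crit: "var a (rad a) = 0"
  shows "integral {0..rad a} (\<lambda>r. r * F2 (sol a r) * var a r ^ 3) < 0"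
proof -
  define R where "R = rad a"
  have R: "R > 0" "sol a R = 0" using rad[OF a] by (auto simp: R_def)
  have vp: "0 < var a r" if "0 \<le> r" "r < R" for r using var_pos[OF a] crit that by (simp add: R_def)
  have sp: "0 < sol a r" if "0 \<le> r" "r < R" for r using sol_pos_iff[OF a] that by (simp add: R_def)
  have id: "((\<lambda>r. r * var a r * F2 (sol a r) * (sol' a r * sol' a r)) has_integral 0) {0..R}"
    using F2_sol_identity[OF a] by (simp add: R_def)
  \<comment> \<open>If \<open>u\<close> stayed in the convex range, the integrand of
    \<open>id\<close> would be positive inside and could not integrate to \<open>0\<close>; hence
    \<open>u\<close> takes the value \<beta>.\<close>
  have "\<beta> < a"
  proof (rule ccontr)
    assume "\<not> \<beta> < a"
    have "integral {0..R} (\<lambda>_. 0) < integral {0..R} (\<lambda>r. r * var a r * F2 (sol a r) * (sol' a r * sol' a r))"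
    proof (rule integral_less_real)
      fix r assume r: "r \<in> {0<..<R}"
      have "sol a r < \<beta>" using sol_decreasing[OF a, of 0 r] r \<open>\<not> \<beta> < a\<close> by simp
      then have "F2 (sol a r) > 0" using convex_part[of "sol a r"] sp[of r] r by (simp add: F2_def)
      then show "0 < r * var a r * F2 (sol a r) * (sol' a r * sol' a r)"
        using r vp[of r] mult_neg_neg[OF sol'_neg sol'_neg, OF a _ a, of r r] by simp
    qed (use R in \<open>auto intro!: continuous_intros flow_cont\<close>)
    then show False using integral_unique[OF id] by simp
  qed
  have "\<exists>x\<ge>0. x \<le> R \<and> sol a x = \<beta>"
    by (rule IVT2') (use \<open>\<beta> < a\<close> R beta_pos in \<open>auto intro: sol_contT\<close>)
  then obtain m where m: "0 \<le> m" "m \<le> R" "sol a m = \<beta>" by blast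
  have m0: "0 < m" using m \<open>\<beta> < a\<close> by (cases "m = 0") auto
  have mR: "m < R" using m R beta_pos by (cases "m = R") auto
  define k where "k = var a m / (- sol' a m)"
  define G where "G r = r * F2 (sol a r) * var a r * (var a r * var a r - k\<^sup>2 * (sol' a r * sol' a r))" for r
  have k: "k > 0" unfolding k_def using vp[of m] m0 mR sol'_neg[OF a m0] by (intro divide_pos_pos) auto
  have Gc: "continuous_on {x..y} G" if "0 \<le> x" for x y
    unfolding G_def[abs_def] using that by (intro continuous_intros flow_cont) auto
  have fact: "var a r * var a r - k\<^sup>2 * (sol' a r * sol' a r) = (var a r - k * (- sol' a r)) * (var a r + k * (- sol' a r))" for r
    by (simp add: algebra_simps power2_eq_square)
  have plus: "0 < var a r + k * (- sol' a r)" if "0 < r" "r < R" for r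
    using vp[of r] that sol'_neg[OF a that(1)] k by (intro add_pos_pos mult_pos_pos) auto
  have G1: "G r < 0" if "0 < r" "r < m" for r
  proof -
    have "k < var a r / (- sol' a r)" unfolding k_def by (rule var_ratio_decreasing[OF a vp that mR])
    then have "0 < var a r - k * (- sol' a r)" using sol'_neg[OF a that(1)] by (simp add: field_simps)
    then have "0 < var a r * var a r - k\<^sup>2 * (sol' a r * sol' a r)"
      unfolding fact using plus[of r] that mR by (intro mult_pos_pos) auto
    moreover have "\<beta> < sol a r" using sol_decreasing[OF a, of r m] that m by simp
    then have "F2 (sol a r) < 0" using concave_part[of "sol a r"] beta_pos by (simp add: F2_def)
    ultimately show ?thesis unfolding G_def using that vp[of r] mR
      by (intro mult_neg_pos mult_pos_neg) auto
  qed
  have G2: "G r < 0" if "m < r" "r < R" for r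
  proof -
    have r0: "0 < r" using that m0 by simp
    have "var a r / (- sol' a r) < k" unfolding k_def by (rule var_ratio_decreasing[OF a vp m0 that])
    then have "var a r - k * (- sol' a r) < 0" using sol'_neg[OF a r0] by (simp add: field_simps)
    then have "var a r * var a r - k\<^sup>2 * (sol' a r * sol' a r) < 0"
      unfolding fact using plus[of r] that r0 by (intro mult_neg_pos) auto
    moreover have "sol a r < \<beta>" "0 < sol a r" using sol_decreasing[OF a, of m r] that m sp[of r] by auto
    then have "F2 (sol a r) > 0" using convex_part[of "sol a r"] by (simp add: F2_def)
    ultimately show ?thesis unfolding G_def using that vp[of r] r0
      by (intro mult_pos_neg mult_pos_pos) auto
  qed
  have "integral {0..m} G < integral {0..m} (\<lambda>_. 0)"
    by (rule integral_less_real) (use m0 G1 in \<open>auto intro: Gc\<close>)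
  moreover have "integral {m..R} G < integral {m..R} (\<lambda>_. 0)"
    by (rule integral_less_real) (use m0 mR G2 in \<open>auto intro: Gc\<close>)
  moreover have "integral {0..m} G + integral {m..R} G = integral {0..R} G"
    by (rule Henstock_Kurzweil_Integration.integral_combine) (use m0 mR in \<open>auto intro!: integrable_continuous_real Gc\<close>)
  ultimately have neg: "integral {0..R} G < 0" by simp
  have "((\<lambda>r. G r + k\<^sup>2 * (r * var a r * F2 (sol a r) * (sol' a r * sol' a r))) has_integral integral {0..R} G + k\<^sup>2 * 0) {0..R}"
    by (intro has_integral_add has_integral_mult_right id integrable_integral integrable_continuous_real Gc) simp
  moreover have "(\<lambda>r. G r + k\<^sup>2 * (r * var a r * F2 (sol a r) * (sol' a r * sol' a r))) = (\<lambda>r. r * F2 (sol a r) * var a r ^ 3)"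
    by (auto simp: fun_eq_iff G_def algebra_simps power3_eq_cube)
  ultimately show ?thesis using neg by (simp add: R_def integral_unique)
qed

text \<open>Differentiating \<open>var b (rad a)\<close> in \<open>b\<close> at a critical point is done through the Wronskian of
  \<open>var b\<close> and \<open>var a\<close>; no second parameter derivative of the flow is needed.\<close>
lemma critical_transversal:
  assumes a: "a > 0" and crit: "var a (rad a) = 0"
  obtains \<kappa> where "\<kappa> > 0" "((\<lambda>b. var b (rad b) / (b - a)) \<longlongrightarrow> \<kappa>) (at a)"
proof -
  define R where "R = rad a"
  have R: "R > 0" "sol a R = 0" using rad[OF a] by (auto simp: R_def)
  have vp: "0 < var a r" if "0 \<le> r" "r < R" for r using var_pos[OF a] crit that by (simp add: R_def)
  have v': "var' a R < 0" using var'_neg_at_zero[OF a R(1) vp] crit by (simp add: R_def)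
  \<comment> \<open>Two parameters are kept apart: \<open>c\<close> enters through the flow in the
    coefficient, \<open>b\<close> through \<open>var b\<close>. Only \<open>c\<close> is
    differentiated; in \<open>b\<close> continuity is enough.\<close>
  define J where "J c b = integral (cbox 0 R) (\<lambda>r. r * (F2 (sol c r) * var c r) * (var b r * var a r))" for c b
  define \<Psi> where "\<Psi> c b = integral (cbox 0 R) (\<lambda>r. r * (F1 (sol c r) - F1 (sol a r)) * (var b r * var a r))" for c b
  have F2j: "continuous_on (UNIV \<times> {0..}) (\<lambda>p. F2 (sol (fst p) (snd p)))"
    by (rule continuous_on_compose2[OF F2_cont[of UNIV] sol_jcont]) auto
  have Jc: "continuous_on UNIV (\<lambda>p. J (fst p) (snd p))" unfolding J_def
  proof (rule integral_continuous_on_param)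
    note c = joint_continuity_subst[OF F2j, of fst R] joint_continuity_subst[OF var_jcont, of fst R] joint_continuity_subst[OF var_jcont, of snd R]
      joint_continuity_subst[OF var_jcont, of "\<lambda>_ :: real \<times> real. a" R]
    have "continuous_on (UNIV \<times> {0..R}) (\<lambda>q :: (real \<times> real) \<times> real. snd q * ((case q of (p, r) \<Rightarrow> F2 (sol (fst p) r)) * (case q of (p, r) \<Rightarrow> var (fst p) r))
        * ((case q of (p, r) \<Rightarrow> var (snd p) r) * (case q of (p, r) \<Rightarrow> var a r)))"
      by (intro continuous_on_mult continuous_on_snd continuous_on_id c continuous_on_fst continuous_on_const)
    then show "continuous_on (UNIV \<times> cbox 0 R) (\<lambda>(p, r). r * (F2 (sol (fst p) r) * var (fst p) r) * (var (snd p) r * var a r))"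
      by (simp add: case_prod_beta')
  qed
  have \<Psi>d: "((\<lambda>c. \<Psi> c b) has_real_derivative J c b) (at c)" for c b
  proof -
    have "((\<lambda>c. \<Psi> c b) has_real_derivative J c b) (at c within UNIV)"
      unfolding \<Psi>_def J_def
    proof (rule leibniz_rule_field_derivative)
      fix c r :: real assume "r \<in> cbox 0 R"
      then have "((\<lambda>c. F1 (sol c r)) has_real_derivative F2 (sol c r) * var c r) (at c)"
        by (intro DERIV_chain2[OF F1_has_deriv sol_param_deriv]) auto
      from DERIV_cong[OF DERIV_mult[OF DERIV_mult[OF DERIV_const[of r] DERIV_diff[OF this DERIV_const[of "F1 (sol a r)"]]] DERIV_const[of "var b r * var a r"]] refl]
      show "((\<lambda>c. r * (F1 (sol c r) - F1 (sol a r)) * (var b r * var a r)) has_real_derivative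
          r * (F2 (sol c r) * var c r) * (var b r * var a r)) (at c within UNIV)" by (simp add: mult_ac)
    next
      fix c show "(\<lambda>r. r * (F1 (sol c r) - F1 (sol a r)) * (var b r * var a r)) integrable_on cbox 0 R"
        unfolding cbox_interval by (intro integrable_continuous_real continuous_intros flow_cont) auto
    next
      note c = joint_continuity_subst[OF F2j, of "\<lambda>p. p" R] joint_continuity_subst[OF var_jcont, of "\<lambda>p. p" R]
        joint_continuity_subst[OF var_jcont, of "\<lambda>_ :: real. a" R] joint_continuity_subst[OF var_jcont, of "\<lambda>_ :: real. b" R]
      have "continuous_on (UNIV \<times> {0..R}) (\<lambda>q :: real \<times> real. snd q * ((case q of (p, r) \<Rightarrow> F2 (sol p r)) * (case q of (p, r) \<Rightarrow> var p r))
          * ((case q of (p, r) \<Rightarrow> var b r) * (case q of (p, r) \<Rightarrow> var a r)))"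
        by (intro continuous_on_mult continuous_on_snd continuous_on_id c continuous_on_const)
      then show "continuous_on (UNIV \<times> cbox 0 R) (\<lambda>(c, r). r * (F2 (sol c r) * var c r) * (var b r * var a r))"
        by (simp add: case_prod_beta')
    qed auto
    then show ?thesis by simp
  qed
  \<comment> \<open>Since \<open>var a\<close> vanishes at \<open>R\<close>, the Wronskian there
    contains \<open>var b R\<close> times a fixed nonzero factor; so the growth of
    \<open>var b R\<close> in \<open>b\<close> can be read off \<open>\<Psi> b b\<close>.\<close>
  have wron: "var b R * (R * var' a R) = \<Psi> b b" for b
  proof -
    define M where "M r = var b r * (r * var' a r) - var a r * (r * var' b r)" for r
    have "((\<lambda>r. r * (F1 (sol b r) - F1 (sol a r)) * (var b r * var a r)) has_integral M R - M 0) {0..R}"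
    proof (rule fundamental_theorem_of_calculus_interior)
      show "continuous_on {0..R} M" unfolding M_def[abs_def] by (intro continuous_intros flow_cont) auto
      fix r assume "r \<in> {0<..<R}"
      then have r: "r > 0" by simp
      have "(M has_real_derivative r * (F1 (sol b r) - F1 (sol a r)) * (var b r * var a r)) (at r)"
        unfolding M_def[abs_def]
        by (rule DERIV_cong[OF DERIV_diff[OF DERIV_mult[OF var_deriv[OF r] mult_var'_deriv[OF r]] DERIV_mult[OF var_deriv[OF r] mult_var'_deriv[OF r]]]])
           (simp add: algebra_simps)
      then show "(M has_vector_derivative r * (F1 (sol b r) - F1 (sol a r)) * (var b r * var a r)) (at r)"
        by (simp add: has_real_derivative_iff_has_vector_derivative)
    qed (use R in simp)
    then have "\<Psi> b b = M R - M 0" by (simp add: \<Psi>_def integral_unique)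
    then show ?thesis using crit by (simp add: M_def R_def)
  qed
  have "\<exists>\<xi>. min a b \<le> \<xi> \<and> \<xi> \<le> max a b \<and> \<Psi> b b - \<Psi> a b = (b - a) * J \<xi> b" for b
    using MVT_between[of a b "\<lambda>c. \<Psi> c b" "\<lambda>c. J c b"] \<Psi>d by metis
  then obtain \<xi> where \<xi>: "\<And>b. min a b \<le> \<xi> b" "\<And>b. \<xi> b \<le> max a b" "\<And>b. \<Psi> b b - \<Psi> a b = (b - a) * J (\<xi> b) b"
    by metis
  have idl: "((\<lambda>b. b) \<longlongrightarrow> a) (at a)" by (rule tendsto_ident_at)
  have \<xi>l: "(\<xi> \<longlongrightarrow> a) (at a)"
  proof (rule tendsto_sandwich)
    show "((\<lambda>b. min a b) \<longlongrightarrow> a) (at a)" using tendsto_min[OF tendsto_const idl, of a] by simp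
    show "((\<lambda>b. max a b) \<longlongrightarrow> a) (at a)" using tendsto_max[OF tendsto_const idl, of a] by simp
  qed (use \<xi> in auto)
  then have "((\<lambda>b. (\<xi> b, b)) \<longlongrightarrow> (a, a)) (at a)" by (intro tendsto_intros)
  from continuous_on_tendsto_compose[OF Jc this] have Jl: "((\<lambda>b. J (\<xi> b) b) \<longlongrightarrow> J a a) (at a)" by simp
  have \<Psi>0: "\<Psi> a b = 0" for b by (simp add: \<Psi>_def)
  have "((\<lambda>b. J (\<xi> b) b / (R * var' a R)) \<longlongrightarrow> J a a / (R * var' a R)) (at a)"
    using R v' by (intro tendsto_divide Jl tendsto_const) auto
  moreover have "\<forall>\<^sub>F b in at a. J (\<xi> b) b / (R * var' a R) = var b R / (b - a)"
    unfolding eventually_at_filter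
  proof (rule always_eventually, intro allI impI)
    fix b assume "b \<noteq> a"
    have "var b R * (R * var' a R) = (b - a) * J (\<xi> b) b" using \<xi>(3)[of b] wron[of b] \<Psi>0 by simp
    then show "J (\<xi> b) b / (R * var' a R) = var b R / (b - a)" using \<open>b \<noteq> a\<close> R v' by (simp add: field_simps)
  qed
  ultimately have l1: "((\<lambda>b. var b R / (b - a)) \<longlongrightarrow> J a a / (R * var' a R)) (at a)"
    by (rule Lim_transform_eventually)
  have "(\<lambda>r. r * (F2 (sol a r) * var a r) * (var a r * var a r)) = (\<lambda>r. r * F2 (sol a r) * var a r ^ 3)"
    by (auto simp: fun_eq_iff power3_eq_cube)
  then have "J a a < 0" using critical_F2_integral[OF a crit] by (simp add: J_def R_def)
  then have pos: "J a a / (R * var' a R) > 0" using R v' by (intro divide_neg_neg) (auto simp: mult_pos_neg)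
  have ev: "\<forall>\<^sub>F b in at a. 0 < b" using a by (intro order_tendstoD[OF idl])
  have "\<exists>\<zeta>. b > 0 \<longrightarrow> min R (rad b) \<le> \<zeta> \<and> \<zeta> \<le> max R (rad b) \<and>
     var b (rad b) - var b R = (rad b - R) * var' b \<zeta>" for b
  proof (cases "b > 0")
    case True
    have "(var b has_real_derivative var' b x) (at x)" if "min R (rad b) \<le> x" for x
      using that R(1) rad_pos[OF True] by (intro var_deriv) linarith
    then show ?thesis using MVT_between[of R "rad b" "var b" "var' b"] by blast
  qed simp
  then obtain \<zeta> where \<zeta>: "\<And>b. b > 0 \<Longrightarrow> min R (rad b) \<le> \<zeta> b \<and> \<zeta> b \<le> max R (rad b) \<and>
     var b (rad b) - var b R = (rad b - R) * var' b (\<zeta> b)" by metis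
  have radlim: "(rad \<longlongrightarrow> R) (at a)" using isCont_rad[OF a] by (simp add: isCont_def R_def)
  have "(\<zeta> \<longlongrightarrow> R) (at a)"
  proof (rule tendsto_sandwich)
    show "((\<lambda>b. min R (rad b)) \<longlongrightarrow> R) (at a)" using tendsto_min[OF tendsto_const radlim, of R] by simp
    show "((\<lambda>b. max R (rad b)) \<longlongrightarrow> R) (at a)" using tendsto_max[OF tendsto_const radlim, of R] by simp
  qed (use ev \<zeta> in \<open>auto elim: eventually_mono\<close>)
  then have "((\<lambda>b. (b, \<zeta> b)) \<longlongrightarrow> (a, R)) (at a)" by (intro tendsto_intros)
  then have "((\<lambda>b. var' (fst (b, \<zeta> b)) (snd (b, \<zeta> b))) \<longlongrightarrow> var' (fst (a, R)) (snd (a, R))) (at a)"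
  proof (rule continuous_on_tendsto_compose[OF var'_jcont])
    show "\<forall>\<^sub>F b in at a. (b, \<zeta> b) \<in> UNIV \<times> {0..}" using ev
    proof eventually_elim
      case (elim b) then show ?case using \<zeta>[OF elim] R rad_pos[OF elim] by auto
    qed
  qed (use R in auto)
  then have vl: "((\<lambda>b. var' b (\<zeta> b)) \<longlongrightarrow> var' a R) (at a)" by simp
  \<comment> \<open>At a critical point the radius is stationary, so replacing the fixed
    \<open>R\<close> by \<open>rad b\<close> changes \<open>var b\<close> only by o(b - a) and
    leaves the limit as it is.\<close>
  have "rad' a = 0" using crit by (simp add: rad'_def)
  then have "((\<lambda>b. (rad b - R) / (b - a)) \<longlongrightarrow> 0) (at a)"
    using rad_deriv[OF a] by (simp add: has_field_derivative_iff R_def)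
  then have "((\<lambda>b. var b R / (b - a) + (rad b - R) / (b - a) * var' b (\<zeta> b)) \<longlongrightarrow> J a a / (R * var' a R) + 0 * var' a R) (at a)"
    by (intro tendsto_add tendsto_mult l1 vl)
  moreover have "\<forall>\<^sub>F b in at a. var b R / (b - a) + (rad b - R) / (b - a) * var' b (\<zeta> b) = var b (rad b) / (b - a)"
    using ev
  proof eventually_elim
    case (elim b)
    have "var b (rad b) = var b R + (rad b - R) * var' b (\<zeta> b)" using \<zeta>[OF elim] by simp
    then show ?case by (simp add: add_divide_distrib)
  qed
  ultimately have "((\<lambda>b. var b (rad b) / (b - a)) \<longlongrightarrow> J a a / (R * var' a R)) (at a)"
    using Lim_transform_eventually by fastforce
  then show ?thesis using that pos by blast
qed

section \<open>The radius as a function of the initial value: one minimum\<close>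

lemma var_rad_cont: "continuous_on {0<..} (\<lambda>a. var a (rad a))"
  by (rule rad_pair_cont[OF var_jcont])

lemma critical_local_sign:
  assumes "a > 0" "var a (rad a) = 0"
  obtains d where "d > 0" "\<And>b. a - d < b \<Longrightarrow> b < a \<Longrightarrow> var b (rad b) < 0"
    "\<And>b. a < b \<Longrightarrow> b < a + d \<Longrightarrow> 0 < var b (rad b)"
proof -
  obtain \<kappa> where \<kappa>: "\<kappa> > 0" "((\<lambda>b. var b (rad b) / (b - a)) \<longlongrightarrow> \<kappa>) (at a)"
    using critical_transversal[OF assms] .
  have "\<forall>\<^sub>F b in at a. 0 < var b (rad b) / (b - a)" by (rule order_tendstoD(1)[OF \<kappa>(2,1)])
  then obtain d where d: "d > 0" "\<And>b. b \<noteq> a \<Longrightarrow> \<bar>b - a\<bar> < d \<Longrightarrow> 0 < var b (rad b) / (b - a)"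
    by (auto simp: eventually_at dist_real_def)
  show ?thesis
  proof (rule that[OF d(1)])
    show "var b (rad b) < 0" if "a - d < b" "b < a" for b
      using d(2)[of b] that by (auto simp: zero_less_divide_iff)
    show "0 < var b (rad b)" if "a < b" "b < a + d" for b
      using d(2)[of b] that by (auto simp: zero_less_divide_iff)
  qed
qed

text \<open>The first zero after \<open>p\<close> would be approached through positive values,
  whereas every zero of \<open>var a (rad a)\<close> is crossed upwards.\<close>

lemma critical_after:
  assumes "0 < p" "p < q" "0 < var p (rad p)" "var q (rad q) \<le> 0"
  shows False
proof -
  obtain \<rho> where \<rho>: "p < \<rho>" "\<rho> \<le> q" "var \<rho> (rad \<rho>) = 0" "\<And>x. p \<le> x \<Longrightarrow> x < \<rho> \<Longrightarrow> 0 < var x (rad x)"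
  proof (rule first_zero[of p q "\<lambda>a. var a (rad a)"])
    show "continuous_on {p..q} (\<lambda>a. var a (rad a))"
      by (rule continuous_on_subset[OF var_rad_cont]) (use assms in auto)
  qed (use assms in auto)
  obtain d where d: "d > 0" "\<And>b. \<rho> - d < b \<Longrightarrow> b < \<rho> \<Longrightarrow> var b (rad b) < 0"
    using critical_local_sign[of \<rho>] \<rho> assms by (metis less_trans)
  define b where "b = max p (\<rho> - d/2)"
  have "\<rho> - d < b" "b < \<rho>" "p \<le> b" using d \<rho>(1) by (auto simp: b_def)
  then show False using d(2)[of b] \<rho>(4)[of b] by auto
qed

text \<open>The radius is large at both ends, so on a suitable interval around the reference value
  \<open>1\<close> its minimum is interior, and \<open>rad'\<close> vanishes there.\<close>

lemma critical_exists: "\<exists>a>0. var a (rad a) = 0"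
proof -
  have "\<forall>\<^sub>F x in at_right 0. (rad 1)\<^sup>2 + 1 \<le> (rad x)\<^sup>2"
    using rad_at_0 by (simp add: filterlim_at_top)
  moreover have "\<forall>\<^sub>F x in at_right (0::real). x < 1"
    by (rule order_tendstoD(2)[OF tendsto_ident_at]) simp
  moreover have "\<forall>\<^sub>F x in at_right (0::real). 0 < x" by (simp add: eventually_at_filter)
  ultimately have "\<forall>\<^sub>F x in at_right 0. (rad 1)\<^sup>2 + 1 \<le> (rad x)\<^sup>2 \<and> x < 1 \<and> 0 < x"
    by eventually_elim simp
  from eventually_happens'[OF trivial_limit_at_right_real this]
  obtain x where x: "(rad 1)\<^sup>2 + 1 \<le> (rad x)\<^sup>2" "x < 1" "0 < x" by blast
  have "\<forall>\<^sub>F y in at_top. (rad 1)\<^sup>2 + 1 \<le> (rad y)\<^sup>2"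
    using rad_at_top by (simp add: filterlim_at_top)
  moreover have "\<forall>\<^sub>F y in at_top. (1::real) < y" by (rule eventually_gt_at_top)
  ultimately have "\<forall>\<^sub>F y in at_top. (rad 1)\<^sup>2 + 1 \<le> (rad y)\<^sup>2 \<and> 1 < y" by eventually_elim simp
  from eventually_happens'[OF trivial_limit_at_top_linorder this]
  obtain y where y: "(rad 1)\<^sup>2 + 1 \<le> (rad y)\<^sup>2" "1 < y" by blast
  have "continuous_on {x..y} rad" by (rule continuous_on_subset[OF rad_cont]) (use x in auto)
  then obtain a where a: "a \<in> {x..y}" "\<And>z. z \<in> {x..y} \<Longrightarrow> rad a \<le> rad z"
    using continuous_attains_inf[of "{x..y}" rad] x y by auto
  have a0: "a > 0" using a x by auto
  have "rad a \<le> rad 1" using a(2)[of 1] x y by auto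
  then have "(rad a)\<^sup>2 \<le> (rad 1)\<^sup>2" using rad_pos[OF a0] by (intro power_mono) auto
  then have "a \<noteq> x" "a \<noteq> y" using x y by auto
  then have "x < a" "a < y" using a by auto
  define d where "d = min (a - x) (y - a)"
  have "rad' a = 0"
  proof (rule DERIV_local_min[OF rad_deriv[OF a0]])
    show "0 < d" using \<open>x < a\<close> \<open>a < y\<close> by (simp add: d_def)
    show "\<forall>z. \<bar>a - z\<bar> < d \<longrightarrow> rad a \<le> rad z" using a(2) by (auto simp: d_def abs_less_iff)
  qed
  then show ?thesis using rad'_sgn(1)[OF a0] a0 by blast
qed

text \<open>The choice is unique by \<open>var_rad_pos\<close> and
  \<open>var_rad_neg\<close>.\<close>

definition crit :: real where "crit = (SOME a. a > 0 \<and> var a (rad a) = 0)"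

lemma crit_pos: "crit > 0" and var_crit: "var crit (rad crit) = 0"
proof -
  have "crit > 0 \<and> var crit (rad crit) = 0" unfolding crit_def by (rule someI_ex) (rule critical_exists)
  then show "crit > 0" "var crit (rad crit) = 0" by auto
qed

lemma var_rad_pos: assumes "crit < a" shows "0 < var a (rad a)"
proof (rule ccontr)
  assume neg: "\<not> 0 < var a (rad a)"
  obtain d where d: "d > 0" "\<And>b. crit < b \<Longrightarrow> b < crit + d \<Longrightarrow> 0 < var b (rad b)"
    using critical_local_sign[OF crit_pos var_crit] by metis
  define p where "p = min ((crit + a) / 2) (crit + d/2)"
  have p: "crit < p" "p < crit + d" "p < a" using assms d by (auto simp: p_def min_def field_simps)
  show False using critical_after[of p a] p d(2)[of p] neg crit_pos by auto
qed

lemma var_rad_neg: assumes "0 < a" "a < crit" shows "var a (rad a) < 0"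
proof (rule ccontr)
  assume pos: "\<not> var a (rad a) < 0"
  obtain d where d: "d > 0" "\<And>b. crit - d < b \<Longrightarrow> b < crit \<Longrightarrow> var b (rad b) < 0"
    using critical_local_sign[OF crit_pos var_crit] by metis
  obtain e where e: "e > 0" "var a (rad a) = 0 \<Longrightarrow> (\<forall>b. a < b \<longrightarrow> b < a + e \<longrightarrow> 0 < var b (rad b))"
    using critical_local_sign[OF assms(1)] zero_less_one by metis
  \<comment> \<open>\<open>critical_after\<close> needs a strictly positive value; if
    \<open>a\<close> itself is a zero, a point slightly to its right provides one.\<close>
  define a1 where "a1 = (if var a (rad a) = 0 then min (a + e/2) ((a + crit)/2) else a)"
  have a1: "a \<le> a1" "a1 < crit" "0 < var a1 (rad a1)"
    using e assms pos by (auto simp: a1_def min_def field_simps)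
  define q where "q = max ((a1 + crit)/2) (crit - d/2)"
  have q: "a1 < q" "q < crit" "crit - d < q" using a1 d by (auto simp: q_def max_def field_simps)
  show False using critical_after[of a1 q] a1 q d(2)[of q] assms by auto
qed

lemma rad_decreasing: assumes "0 < a" "a < b" "b \<le> crit" shows "rad b < rad a"
proof (rule DERIV_neg_imp_decreasing_open[OF assms(2)])
  fix x assume "a < x" "x < b"
  then show "\<exists>D. (rad has_real_derivative D) (at x) \<and> D < 0"
    using rad_deriv[of x] rad'_sgn(3)[of x] var_rad_neg[of x] assms by auto
qed (use assms in \<open>auto intro: continuous_on_subset[OF rad_cont]\<close>)

lemma rad_increasing: assumes "crit \<le> a" "a < b" shows "rad a < rad b"
proof (rule DERIV_pos_imp_increasing_open[OF assms(2)])
  fix x assume "a < x" "x < b"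
  then show "\<exists>D. (rad has_real_derivative D) (at x) \<and> 0 < D"
    using rad_deriv[of x] rad'_sgn(2)[of x] var_rad_pos[of x] assms crit_pos by auto
qed (use assms crit_pos in \<open>auto intro: continuous_on_subset[OF rad_cont]\<close>)

lemma rad_crit_less: "0 < a \<Longrightarrow> a \<noteq> crit \<Longrightarrow> rad crit < rad a"
  using rad_decreasing[of a crit] rad_increasing[of crit a] by (cases "a < crit") auto

text \<open>Here and in \<open>upper_sol\<close> the values are initial values, on the decreasing
  and on the increasing part of \<open>rad\<close>; the branches themselves are
  \<open>V (lower_sol \<eta>)\<close> and \<open>V (upper_sol \<eta>)\<close>.\<close>

definition lower_sol :: "real \<Rightarrow> real" where "lower_sol \<eta> = (SOME a. 0 < a \<and> a \<le> crit \<and> (rad a)\<^sup>2 = \<eta>)"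
definition upper_sol :: "real \<Rightarrow> real" where "upper_sol \<eta> = (SOME a. crit \<le> a \<and> (rad a)\<^sup>2 = \<eta>)"

lemma lower_sol:
  assumes "(rad crit)\<^sup>2 \<le> \<eta>"
  shows "0 < lower_sol \<eta>" "lower_sol \<eta> \<le> crit" "(rad (lower_sol \<eta>))\<^sup>2 = \<eta>"
proof -
  have "\<forall>\<^sub>F x in at_right 0. \<eta> \<le> (rad x)\<^sup>2" using rad_at_0 by (simp add: filterlim_at_top)
  moreover have "\<forall>\<^sub>F x in at_right (0::real). x < crit"
    by (rule order_tendstoD(2)[OF tendsto_ident_at]) (rule crit_pos)
  moreover have "\<forall>\<^sub>F x in at_right (0::real). 0 < x" by (simp add: eventually_at_filter)
  ultimately have "\<forall>\<^sub>F x in at_right 0. \<eta> \<le> (rad x)\<^sup>2 \<and> x < crit \<and> 0 < x" by eventually_elim simp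
  from eventually_happens'[OF trivial_limit_at_right_real this]
  obtain x where x: "\<eta> \<le> (rad x)\<^sup>2" "x < crit" "0 < x" by blast
  have "\<exists>a\<ge>x. a \<le> crit \<and> (rad a)\<^sup>2 = \<eta>"
    by (rule IVT2') (use x assms in \<open>auto intro!: continuous_intros continuous_on_subset[OF rad_cont]\<close>)
  then obtain a where "x \<le> a" "a \<le> crit" "(rad a)\<^sup>2 = \<eta>" by blast
  then have "\<exists>a. 0 < a \<and> a \<le> crit \<and> (rad a)\<^sup>2 = \<eta>" using x(3) by (intro exI[of _ a]) simp
  then have "0 < lower_sol \<eta> \<and> lower_sol \<eta> \<le> crit \<and> (rad (lower_sol \<eta>))\<^sup>2 = \<eta>"
    unfolding lower_sol_def by (rule someI_ex)
  then show "0 < lower_sol \<eta>" "lower_sol \<eta> \<le> crit" "(rad (lower_sol \<eta>))\<^sup>2 = \<eta>" by auto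
qed

lemma upper_sol:
  assumes "(rad crit)\<^sup>2 \<le> \<eta>"
  shows "crit \<le> upper_sol \<eta>" "(rad (upper_sol \<eta>))\<^sup>2 = \<eta>"
proof -
  have "\<forall>\<^sub>F x in at_top. \<eta> \<le> (rad x)\<^sup>2" using rad_at_top by (simp add: filterlim_at_top)
  moreover have "\<forall>\<^sub>F x in at_top. crit < x" by (rule eventually_gt_at_top)
  ultimately have "\<forall>\<^sub>F x in at_top. \<eta> \<le> (rad x)\<^sup>2 \<and> crit < x" by eventually_elim simp
  from eventually_happens'[OF trivial_limit_at_top_linorder this]
  obtain x where x: "\<eta> \<le> (rad x)\<^sup>2" "crit < x" by blast
  have "\<exists>a\<ge>crit. a \<le> x \<and> (rad a)\<^sup>2 = \<eta>"
    by (rule IVT') (use x assms crit_pos in \<open>auto intro!: continuous_intros continuous_on_subset[OF rad_cont]\<close>)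
  then have "\<exists>a. crit \<le> a \<and> (rad a)\<^sup>2 = \<eta>" by blast
  then have "crit \<le> upper_sol \<eta> \<and> (rad (upper_sol \<eta>))\<^sup>2 = \<eta>"
    unfolding upper_sol_def by (rule someI_ex)
  then show "crit \<le> upper_sol \<eta>" "(rad (upper_sol \<eta>))\<^sup>2 = \<eta>" by auto
qed

lemma rad_sq_eq_iff: "0 < a \<Longrightarrow> 0 < b \<Longrightarrow> (rad a)\<^sup>2 = (rad b)\<^sup>2 \<longleftrightarrow> rad a = rad b"
  using rad_pos[of a] rad_pos[of b] by (simp add: power2_eq_iff_nonneg)

lemma rad_sq_less_iff: "0 < a \<Longrightarrow> 0 < b \<Longrightarrow> (rad a)\<^sup>2 < (rad b)\<^sup>2 \<longleftrightarrow> rad a < rad b"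
  using rad_pos[of a] rad_pos[of b] by (auto intro: power2_less_imp_less power_strict_mono)

lemma lower_sol_rad: assumes "0 < a" "a \<le> crit" shows "lower_sol ((rad a)\<^sup>2) = a"
proof -
  have "(rad crit)\<^sup>2 \<le> (rad a)\<^sup>2"
    using rad_crit_less[OF assms(1)] rad_sq_less_iff[OF crit_pos assms(1)] by (cases "a = crit") auto
  note lo = lower_sol[OF this]
  have "rad (lower_sol ((rad a)\<^sup>2)) = rad a" using lo assms by (simp add: rad_sq_eq_iff)
  then show ?thesis using rad_decreasing[of a "lower_sol ((rad a)\<^sup>2)"] rad_decreasing[of "lower_sol ((rad a)\<^sup>2)" a] lo assms
    by (cases a "lower_sol ((rad a)\<^sup>2)" rule: linorder_cases) auto
qed

lemma upper_sol_rad: assumes "crit \<le> a" shows "upper_sol ((rad a)\<^sup>2) = a"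
proof -
  have a: "0 < a" using assms crit_pos by simp
  have "(rad crit)\<^sup>2 \<le> (rad a)\<^sup>2"
    using rad_crit_less[OF a] rad_sq_less_iff[OF crit_pos a] by (cases "a = crit") auto
  note hi = upper_sol[OF this]
  have "rad (upper_sol ((rad a)\<^sup>2)) = rad a" using hi a crit_pos by (simp add: rad_sq_eq_iff)
  then show ?thesis using rad_increasing[of a "upper_sol ((rad a)\<^sup>2)"] rad_increasing[of "upper_sol ((rad a)\<^sup>2)" a] hi assms
    by (cases a "upper_sol ((rad a)\<^sup>2)" rule: linorder_cases) auto
qed

section \<open>The solution curve rescaled to the unit interval\<close>

definition V :: "real \<Rightarrow> real \<Rightarrow> real" where "V a r = sol a (rad a * r)"
definition Vr :: "real \<Rightarrow> real \<Rightarrow> real" where "Vr a r = rad a * sol' a (rad a * r)"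
text \<open>The total derivative of \<open>V\<close> in \<open>a\<close>: the second summand
  accounts for the moving radius.\<close>

definition Vs :: "real \<Rightarrow> real \<Rightarrow> real" where "Vs a r = var a (rad a * r) + sol' a (rad a * r) * (rad' a * r)"

lemma V_0 [simp]: "V a 0 = a" by (simp add: V_def)

lemma V_1: "a > 0 \<Longrightarrow> V a 1 = 0" using sol_rad by (simp add: V_def)

lemma V_pos: "a > 0 \<Longrightarrow> 0 \<le> r \<Longrightarrow> r < 1 \<Longrightarrow> 0 < V a r"
  using sol_pos_iff[of a "rad a * r"] rad_pos[of a] by (simp add: V_def)

lemma V_nonneg: "a > 0 \<Longrightarrow> 0 \<le> r \<Longrightarrow> r \<le> 1 \<Longrightarrow> 0 \<le> V a r"
  using V_pos[of a r] V_1[of a] by (cases "r = 1") auto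

lemma V_decreasing: "a > 0 \<Longrightarrow> 0 \<le> r \<Longrightarrow> r < s \<Longrightarrow> V a s < V a r"
  unfolding V_def using rad_pos[of a] by (intro sol_decreasing) auto

lemma V_deriv_r: "a > 0 \<Longrightarrow> 0 < r \<Longrightarrow> (V a has_real_derivative Vr a r) (at r)"
  unfolding V_def[abs_def] Vr_def using rad_pos[of a]
  by (intro DERIV_cong[OF DERIV_chain2[OF sol_deriv DERIV_cmult[OF DERIV_ident]]]) auto

lemma V_deriv_s:
  assumes a: "a > 0" and r: "0 \<le> r"
  shows "((\<lambda>b. V b r) has_real_derivative Vs a r) (at a)"
proof (cases "r = 0")
  case True then show ?thesis by (simp add: Vs_def)
next
  case False
  have "((\<lambda>b. rad b * r) has_real_derivative rad' a * r) (at a)"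
    using DERIV_mult[OF rad_deriv[OF a] DERIV_const[of r]] by simp
  from sol_chain[OF this] show ?thesis unfolding V_def Vs_def using False r rad_pos[OF a] by simp
qed

lemma rad_fst_cont: "continuous_on ({0<..} \<times> S) (\<lambda>p. rad (fst p))"
  by (rule continuous_on_compose2[OF rad_cont continuous_on_fst[OF continuous_on_id]]) auto

lemma rad'_fst_cont: "continuous_on ({0<..} \<times> S) (\<lambda>p. rad' (fst p))"
  by (rule continuous_on_compose2[OF rad'_cont continuous_on_fst[OF continuous_on_id]]) auto

lemma rad_mult_jcont:
  assumes "continuous_on (UNIV \<times> {0..}) (\<lambda>p. h (fst p) (snd p))"
  shows "continuous_on ({0<..} \<times> {0..1}) (\<lambda>p. h (fst p) (rad (fst p) * snd p))"
proof -
  have "continuous_on ({0<..} \<times> {0..1}) (\<lambda>p. (\<lambda>p. h (fst p) (snd p)) (fst p, rad (fst p) * snd p))"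
  proof (rule continuous_on_compose2[OF assms])
    show "continuous_on ({0<..} \<times> {0..1}) (\<lambda>p. (fst p, rad (fst p) * snd p))"
      by (intro continuous_on_Pair continuous_on_mult rad_fst_cont continuous_on_fst continuous_on_snd continuous_on_id)
    show "(\<lambda>p. (fst p, rad (fst p) * snd p)) ` ({0<..} \<times> {0..1}) \<subseteq> UNIV \<times> {0..}"
      using less_imp_le[OF rad_pos] by auto
  qed
  then show ?thesis by simp
qed

lemma Vs_cont: "continuous_on ({0<..} \<times> {0..1}) (\<lambda>p. Vs (fst p) (snd p))"
  unfolding Vs_def
  by (intro continuous_on_add continuous_on_mult rad_mult_jcont[OF var_jcont] rad_mult_jcont[OF sol'_jcont] rad'_fst_cont
      continuous_on_snd continuous_on_id)

lemma Vr_cont: "continuous_on ({0<..} \<times> {0..1}) (\<lambda>p. Vr (fst p) (snd p))"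
  unfolding Vr_def by (intro continuous_on_mult rad_mult_jcont[OF sol'_jcont] rad_fst_cont)

lemma V_cont_r: "a > 0 \<Longrightarrow> continuous_on {0..} (V a)"
  unfolding V_def[abs_def] using rad_pos[of a]
  by (intro continuous_on_compose2[OF sol_cont] continuous_intros) auto

section \<open>Monotonicity and order of the branches\<close>

lemma Vs_pos:
  assumes a: "crit < a" and r: "0 \<le> r" "r < 1"
  shows "0 < Vs a r"
proof (cases "r = 0")
  case True then show ?thesis by (simp add: Vs_def)
next
  case False
  define R where "R = rad a"
  define s where "s = R * r"
  have a0: "a > 0" using a crit_pos by simp
  have R: "R > 0" using rad_pos[OF a0] by (simp add: R_def)
  have s: "0 < s" "s < R" using False r R by (auto simp: s_def)
  have wp: "0 < var a x" if "0 \<le> x" "x \<le> R" for x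
    using var_pos[OF a0, of x] var_rad_pos[OF a] that by (cases "x = R") (auto simp: R_def)
  \<comment> \<open>With \<open>w = var a\<close> and \<open>s = R * r\<close> one has
    \<open>Vs a r = w s + \<kappa> * s * u' s\<close>. By the formula for \<open>rad'\<close>, the
    quotient \<open>\<kappa> * s * u' s / w s\<close> equals \<open>- 1\<close> at
    \<open>s = R\<close>. It decreases strictly, since its derivative has the sign of
    \<open>wronski_scaling a 0\<close>, so it exceeds \<open>- 1\<close> inside.\<close>
  define \<kappa> where "\<kappa> = rad' a / R"
  have \<kappa>: "\<kappa> > 0" using rad'_sgn(2)[OF a0] var_rad_pos[OF a] R by (simp add: \<kappa>_def)
  have W: "wronski_scaling a 0 x < 0" if x: "0 < x" "x \<le> R" for x
  proof -
    have "wronski_scaling a 0 x < wronski_scaling a 0 0"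
    proof (rule DERIV_neg_imp_decreasing_open[of 0 x "wronski_scaling a 0"])
      fix t assume t: "0 < t" "t < x"
      have "0 < F (sol a t)" using sol_pos_iff[OF a0, of t] t x by (intro F_pos) (auto simp: R_def)
      then have "t * var a t * (0 * F1 (sol a t) - 2 * F (sol a t)) < 0"
        using wp[of t] t x by (intro mult_pos_neg mult_pos_pos) auto
      then show "\<exists>D. (wronski_scaling a 0 has_real_derivative D) (at t) \<and> D < 0"
        using wronski_scaling_deriv[OF t(1)] by blast
    qed (use x in \<open>auto intro: wronski_scaling_cont\<close>)
    then show ?thesis by (simp add: wronski_scaling_def)
  qed
  have "R * sol' a R / var a R < s * sol' a s / var a s"
  proof (rule DERIV_neg_imp_decreasing[OF s(2), where f = "\<lambda>x. x * sol' a x / var a x"])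
    fix x assume "s \<le> x" "x \<le> R"
    then have x: "0 < x" "x \<le> R" using s by auto
    have v: "0 < var a x" using wp x by simp
    have "((\<lambda>x. x * sol' a x / var a x) has_real_derivative wronski_scaling a 0 x / (x * (var a x * var a x))) (at x)"
      by (rule DERIV_cong[OF DERIV_divide[OF mult_sol'_deriv[OF x(1)] var_deriv[OF x(1)]]])
         (use v x in \<open>auto simp: wronski_scaling_def field_simps\<close>)
    moreover have "wronski_scaling a 0 x / (x * (var a x * var a x)) < 0"
      using W[OF x] v x by (intro divide_neg_pos) auto
    ultimately show "\<exists>D. ((\<lambda>x. x * sol' a x / var a x) has_real_derivative D) (at x) \<and> D < 0" by blast
  qed
  moreover have "\<kappa> * (R * sol' a R / var a R) = - 1"
    using sol'_neg[OF a0 R] R wp[of R] by (simp add: \<kappa>_def rad'_def flip: R_def)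
  ultimately have "- 1 < \<kappa> * (s * sol' a s / var a s)"
    using mult_strict_left_mono[OF _ \<kappa>] by metis
  then have "0 < var a s + \<kappa> * (s * sol' a s)" using wp[of s] s by (simp add: field_simps)
  moreover have "Vs a r = var a s + \<kappa> * (s * sol' a s)"
    using R by (simp add: Vs_def \<kappa>_def s_def R_def)
  ultimately show ?thesis by simp
qed

lemma V_cont_s: "0 \<le> r \<Longrightarrow> continuous_on {0<..} (\<lambda>a. V a r)"
  by (rule continuous_at_imp_continuous_on) (auto intro!: DERIV_isCont[OF V_deriv_s])

lemma V_increasing:
  assumes "crit \<le> a" "a < b" "0 \<le> r" "r < 1"
  shows "V a r < V b r"
proof (rule DERIV_pos_imp_increasing_open[OF assms(2), where f = "\<lambda>a. V a r"])
  fix x assume "a < x" "x < b"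
  then show "\<exists>D. ((\<lambda>a. V a r) has_real_derivative D) (at x) \<and> 0 < D"
    using V_deriv_s[of x r] Vs_pos[of x r] assms crit_pos by auto
qed (use assms crit_pos in \<open>auto intro!: continuous_on_subset[OF V_cont_s]\<close>)

text \<open>\<open>V b - V a\<close> is superharmonic as long as it is nonnegative, because \<open>F\<close> is increasing.\<close>
lemma V_diff_superharmonic:
  assumes ab: "0 < a" "a < b" "rad a \<le> rad b" and le: "\<And>r. 0 \<le> r \<Longrightarrow> r \<le> 1 \<Longrightarrow> V a r \<le> V b r"
  shows "0 \<le> r \<Longrightarrow> r < 1 \<Longrightarrow> V a r < V b r" and "Vr b 1 < Vr a 1"
proof -
  have b0: "b > 0" using ab by simp
  define m where "m r = r * Vr b r - r * Vr a r" for r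
  have md: "(m has_real_derivative - r * (rad b)\<^sup>2 * F (V b r) + r * (rad a)\<^sup>2 * F (V a r)) (at r)" if r: "r > 0" for r
  proof -
    have "((\<lambda>r. r * Vr c r) has_real_derivative - r * (rad c)\<^sup>2 * F (V c r)) (at r)" if c: "c > 0" for c
    proof -
      have p: "rad c * r > 0" using rad_pos[OF c] r by simp
      have "((\<lambda>r. (rad c * r) * sol' c (rad c * r)) has_real_derivative - (rad c * r) * F (sol c (rad c * r)) * (rad c * 1)) (at r)"
        by (rule DERIV_chain2[OF mult_sol'_deriv[OF p] DERIV_cmult[OF DERIV_ident]])
      then show ?thesis by (simp add: Vr_def V_def mult_ac power2_eq_square)
    qed
    from DERIV_diff[OF this[OF b0] this[OF ab(1)]] show ?thesis unfolding m_def[abs_def] by simp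
  qed
  have F_le: "(rad a)\<^sup>2 * F (V a r) \<le> (rad b)\<^sup>2 * F (V b r)" if "0 \<le> r" "r \<le> 1" for r
  proof -
    have "F (V a r) \<le> F (V b r)" using le[OF that] V_nonneg[OF ab(1) that] f_mono by (simp add: F_def)
    then show ?thesis using ab rad_pos[OF ab(1)] F_nonneg by (intro mult_mono power_mono) auto
  qed
  have F_less: "(rad a)\<^sup>2 * F (V a r) < (rad b)\<^sup>2 * F (V b r)" if "0 \<le> r" "r \<le> 1" "V a r < V b r" for r
  proof -
    have "(rad a)\<^sup>2 * F (V a r) \<le> (rad b)\<^sup>2 * F (V a r)"
      using ab rad_pos[OF ab(1)] F_nonneg by (intro mult_right_mono power_mono) auto
    also have "\<dots> < (rad b)\<^sup>2 * F (V b r)"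
      using that V_nonneg[OF ab(1) that(1,2)] V_nonneg[OF b0 that(1,2)] f_less rad_pos[OF b0]
      by (intro mult_strict_left_mono) (auto simp: F_def)
    finally show ?thesis .
  qed
  have mc: "continuous_on {x..y} m" if "0 \<le> x" for x y
    unfolding m_def[abs_def] Vr_def using that rad_pos[OF ab(1)] rad_pos[OF b0]
    by (intro continuous_intros continuous_on_compose2[OF sol'_cont]) auto
  \<comment> \<open>Strictness has to be gained only near \<open>0\<close>, where the difference is
    close to \<open>b - a > 0\<close>; from there on it suffices that \<open>m\<close> does not
    increase.\<close>
  have "continuous (at 0 within {0..}) (\<lambda>r. V b r - V a r)"
    using continuous_on_diff[OF V_cont_r[OF b0] V_cont_r[OF ab(1)]] by (auto simp: continuous_on_eq_continuous_within)
  then have "\<forall>\<^sub>F r in at 0 within {0..}. 0 < V b r - V a r"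
    unfolding continuous_within by (rule order_tendstoD(1)) (use ab in simp)
  then obtain d where d: "d > 0" "\<And>r. 0 < r \<Longrightarrow> r < d \<Longrightarrow> V a r < V b r"
    by (auto simp: eventually_at dist_real_def)
  have m_neg: "m r < 0" if r: "0 < r" "r \<le> 1" for r
  proof -
    define e where "e = min r (d/2)"
    have e: "0 < e" "e \<le> r" "e < d" using d r by (auto simp: e_def)
    have "m e < m 0"
    proof (rule DERIV_neg_imp_decreasing_open[OF e(1)])
      fix x assume x: "0 < x" "x < e"
      have "x * ((rad a)\<^sup>2 * F (V a x)) < x * ((rad b)\<^sup>2 * F (V b x))"
        using F_less[of x] d(2)[of x] x e r by (intro mult_strict_left_mono) auto
      then have "- x * (rad b)\<^sup>2 * F (V b x) + x * (rad a)\<^sup>2 * F (V a x) < 0" by (simp add: mult_ac)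
      then show "\<exists>D. (m has_real_derivative D) (at x) \<and> D < 0" using md[OF x(1)] by blast
    qed (auto intro: mc)
    moreover have "m r \<le> m e"
    proof (cases "e = r")
      case False
      show ?thesis
      proof (rule DERIV_nonpos_imp_decreasing_open[of e r m])
        fix x assume x: "e < x" "x < r"
        have "x * ((rad a)\<^sup>2 * F (V a x)) \<le> x * ((rad b)\<^sup>2 * F (V b x))"
          using F_le[of x] x e r by (intro mult_left_mono) auto
        then have "- x * (rad b)\<^sup>2 * F (V b x) + x * (rad a)\<^sup>2 * F (V a x) \<le> 0" by (simp add: mult_ac)
        then show "\<exists>D. (m has_real_derivative D) (at x) \<and> D \<le> 0" using md[of x] x e by auto
      qed (use e in \<open>auto intro: mc\<close>)
    qed simp
    ultimately show ?thesis by (simp add: m_def)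
  qed
  have Vr_less: "Vr b r < Vr a r" if "0 < r" "r \<le> 1" for r
    using m_neg[OF that] that by (simp add: m_def)
  then show "Vr b 1 < Vr a 1" by simp
  show "V a r < V b r" if r: "0 \<le> r" "r < 1"
  proof -
    have "V b 1 - V a 1 < V b r - V a r"
    proof (rule DERIV_neg_imp_decreasing_open[OF r(2), where f = "\<lambda>r. V b r - V a r"])
      fix x assume x: "r < x" "x < 1"
      then have "((\<lambda>r. V b r - V a r) has_real_derivative Vr b x - Vr a x) (at x)"
        using r ab b0 by (intro DERIV_diff V_deriv_r) auto
      moreover have "Vr b x - Vr a x < 0" using Vr_less[of x] x r by simp
      ultimately show "\<exists>D. ((\<lambda>r. V b r - V a r) has_real_derivative D) (at x) \<and> D < 0" by blast
    qed (use r ab b0 in \<open>auto intro!: continuous_intros continuous_on_subset[OF V_cont_r]\<close>)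
    then show ?thesis using V_1 ab b0 by simp
  qed
qed

text \<open>Sweep \<open>a\<close> downwards from \<open>b\<close>. The quotient \<open>e a r = (V b r - V a r) / (1 - r)\<close> extends continuously to \<open>r = 1\<close>,
  so the parameters for which it fails to be positive form a compact set; at its maximum
  superharmonicity gives a contradiction.\<close>
lemma V_lower_less_upper:
  assumes c: "0 < c" "c < crit" and b: "crit < b" and eq: "rad c = rad b" and r: "0 \<le> r" "r < 1"
  shows "V c r < V b r"
proof -
  have b0: "b > 0" using b crit_pos by simp
  \<comment> \<open>\<open>rad\<close> falls on \<open>{c..crit}\<close> and rises on
    \<open>{crit..b}\<close>, with equal values at both ends.\<close>
  have rad_le: "rad a \<le> rad b" if "c \<le> a" "a \<le> b" for a
  proof (cases "a \<le> crit")
    case True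
    then show ?thesis using rad_decreasing[of c a] that c eq by (cases "a = c") auto
  next
    case False
    then show ?thesis using rad_increasing[of a b] that by (cases "a = b") auto
  qed
  \<comment> \<open>The quotient written as an average of the slope difference over
    \<open>{r..1}\<close>. It makes sense and is jointly continuous at \<open>r = 1\<close> too,
    where it is the difference of the boundary slopes.\<close>
  define e where "e a r = integral (cbox 0 1) (\<lambda>t. Vr a (r + t * (1 - r)) - Vr b (r + t * (1 - r)))" for a r
  have in01: "r + t * (1 - r) \<in> {0..1}" if "0 \<le> r" "r \<le> 1" "0 \<le> t" "t \<le> 1" for r t :: real
  proof -
    have "t * (1 - r) \<le> 1 * (1 - r)" "0 \<le> t * (1 - r)" using that by (intro mult_right_mono mult_nonneg_nonneg; simp)+
    then show ?thesis using that by simp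
  qed
  have e_eq: "(1 - r) * e a r = V b r - V a r" if a: "a > 0" and r: "0 \<le> r" "r < 1" for a r
  proof -
    have "((\<lambda>t. (1 - r) * (Vr a (r + t * (1 - r)) - Vr b (r + t * (1 - r)))) has_integral
       (V a (r + 1 * (1 - r)) - V b (r + 1 * (1 - r))) - (V a (r + 0 * (1 - r)) - V b (r + 0 * (1 - r)))) {0..1}"
    proof (rule fundamental_theorem_of_calculus_interior)
      have *: "continuous_on {0..1} (\<lambda>t. V q (r + t * (1 - r)))" if "q > 0" for q
        by (rule continuous_on_compose2[OF V_cont_r[OF that]]) (use r in \<open>auto intro!: continuous_intros\<close>)
      show "continuous_on {0..1} (\<lambda>t. V a (r + t * (1 - r)) - V b (r + t * (1 - r)))"
        by (intro continuous_on_diff * a b0)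
      fix t :: real assume t: "t \<in> {0<..<1}"
      have p: "0 < r + t * (1 - r)" using r t by (intro add_nonneg_pos mult_pos_pos) auto
      have i: "((\<lambda>t. r + t * (1 - r)) has_real_derivative (1 - r)) (at t)"
        by (auto intro!: derivative_eq_intros)
      have "((\<lambda>t. V a (r + t * (1 - r)) - V b (r + t * (1 - r))) has_real_derivative
        Vr a (r + t * (1 - r)) * (1 - r) - Vr b (r + t * (1 - r)) * (1 - r)) (at t)"
        by (intro DERIV_diff DERIV_chain2[OF V_deriv_r i] a b0 p)
      then show "((\<lambda>t. V a (r + t * (1 - r)) - V b (r + t * (1 - r))) has_vector_derivative
        (1 - r) * (Vr a (r + t * (1 - r)) - Vr b (r + t * (1 - r)))) (at t)"
        by (simp add: has_real_derivative_iff_has_vector_derivative algebra_simps)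
    qed simp
    note hi = integral_unique[OF this]
    show ?thesis using hi V_1[OF a] V_1[OF b0] by (simp add: e_def)
  qed
  have e_1: "e a 1 = Vr a 1 - Vr b 1" for a by (simp add: e_def)
  have e_cont: "continuous_on ({0<..} \<times> {0..1}) (\<lambda>p. e (fst p) (snd p))"
    unfolding e_def
  proof (rule integral_continuous_on_param)
    have *: "continuous_on (({0<..} \<times> {0..1}) \<times> {0..1}) (\<lambda>q :: (real \<times> real) \<times> real. snd (fst q) + snd q * (1 - snd (fst q)))"
      by (intro continuous_intros)
    have A: "continuous_on (({0<..} \<times> {0..1}) \<times> cbox 0 1) (\<lambda>q. (\<lambda>p. Vr (fst p) (snd p)) (fst (fst q), snd (fst q) + snd q * (1 - snd (fst q))))"
      by (rule continuous_on_compose2[OF Vr_cont]) (use in01 in \<open>auto intro!: continuous_on_Pair * continuous_on_fst continuous_on_id\<close>)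
    have B: "continuous_on (({0<..} \<times> {0..1}) \<times> cbox 0 1) (\<lambda>q :: (real \<times> real) \<times> real. (\<lambda>p. Vr (fst p) (snd p)) (b, snd (fst q) + snd q * (1 - snd (fst q))))"
      by (rule continuous_on_compose2[OF Vr_cont]) (use in01 b0 in \<open>auto intro!: continuous_on_Pair * continuous_on_const\<close>)
    show "continuous_on (({0<..} \<times> {0..1}) \<times> cbox 0 1) (\<lambda>(p, t). Vr (fst p) (snd p + t * (1 - snd p)) - Vr b (snd p + t * (1 - snd p)))"
      using continuous_on_diff[OF A B] by (simp add: case_prod_beta')
  qed
  have e_pos: "0 < e a r" if a: "c \<le> a" "a < b" and le: "\<And>r. 0 \<le> r \<Longrightarrow> r \<le> 1 \<Longrightarrow> V a r \<le> V b r" and r: "0 \<le> r" "r \<le> 1" for a r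
  proof (cases "r = 1")
    case True
    then show ?thesis using V_diff_superharmonic(2)[OF _ a(2) rad_le le] a c e_1 by simp
  next
    case False
    have "V a r < V b r" using V_diff_superharmonic(1)[OF _ a(2) rad_le le] a c r False by simp
    then have "0 < (1 - r) * e a r" using e_eq[of a r] a c r False by simp
    then show ?thesis using r False by (simp add: zero_less_mult_iff)
  qed
  define S where "S = fst ` (({c..crit} \<times> {0..1}) \<inter> (\<lambda>p. e (fst p) (snd p)) -` {..0})"
  have box: "compact ({c..crit} \<times> {0..1::real})" by (intro compact_Times compact_Icc)
  have "closed (({c..crit} \<times> {0..1::real}) \<inter> (\<lambda>p. e (fst p) (snd p)) -` {..0})"
  proof (rule continuous_closed_preimage)
    show "continuous_on ({c..crit} \<times> {0..1}) (\<lambda>p. e (fst p) (snd p))"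
      by (rule continuous_on_subset[OF e_cont]) (use c in auto)
  qed (use box in \<open>auto intro: compact_imp_closed\<close>)
  from compact_Int_closed[OF box this]
  have "compact (({c..crit} \<times> {0..1::real}) \<inter> (\<lambda>p. e (fst p) (snd p)) -` {..0})" by simp
  then have Sc: "compact S" unfolding S_def by (intro compact_continuous_image continuous_on_fst continuous_on_id)
  have "S = {}"
  proof (rule ccontr)
    assume "S \<noteq> {}"
    then obtain s where s: "s \<in> S" "\<And>a. a \<in> S \<Longrightarrow> a \<le> s" using compact_attains_sup[OF Sc] by blast
    then obtain t where t: "c \<le> s" "s \<le> crit" "0 \<le> t" "t \<le> 1" "e s t \<le> 0" by (auto simp: S_def)
    have above: "V a r \<le> V b r" if a: "s < a" "a < b" and r: "0 \<le> r" "r \<le> 1" for a r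
    proof (cases "r = 1")
      case True then show ?thesis using V_1[of a] V_1[OF b0] a t c by simp
    next
      case False
      show ?thesis
      proof (cases "a \<le> crit")
        case True
        have "a \<notin> S" using s(2)[of a] a by auto
        then have "0 < e a r" using True a t r unfolding S_def by force
        then have "0 \<le> (1 - r) * e a r" using r by simp
        then show ?thesis using e_eq[of a r] a t c r False by simp
      next
        case False
        then show ?thesis using V_increasing[of a b r] a r \<open>r \<noteq> 1\<close> by simp
      qed
    qed
    \<comment> \<open>Letting \<open>a\<close> decrease to \<open>s\<close> keeps only the weak
      inequality, but that is all that \<open>V_diff_superharmonic\<close> requires; it returns
      strict inequalities, including one for the boundary slopes.\<close>
    have le: "V s r \<le> V b r" if r: "0 \<le> r" "r \<le> 1" for r
    proof (rule tendsto_upperbound)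
      have "isCont (\<lambda>a. V a r) s" using DERIV_isCont[OF V_deriv_s[of s r]] t c r by simp
      then show "((\<lambda>a. V a r) \<longlongrightarrow> V s r) (at_right s)"
        unfolding isCont_def by (rule tendsto_within_subset) simp
      show "\<forall>\<^sub>F a in at_right s. V a r \<le> V b r"
        unfolding eventually_at_right_field using above[OF _ _ r] t b by (intro exI[of _ b]) auto
    qed simp
    show False using e_pos[OF t(1) _ le t(3,4)] t b by simp
  qed
  then have "\<not> e c r \<le> 0" using c r unfolding S_def by force
  then have "0 < (1 - r) * e c r" using r by simp
  then show ?thesis using e_eq[of c r] c r by simp
qed

section \<open>Behaviour of the branches for large parameters\<close>

lemma V_lower_bound:
  assumes a: "a > 0" and r: "0 < r" "r < 1"
  shows "F (V a r) * (r\<^sup>2 / 2 * ln (1 / r)) * (rad a)\<^sup>2 \<le> V a r"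
proof -
  define R where "R = rad a"
  define s where "s = R * r"
  have R: "R > 0" "sol a R = 0" using rad[OF a] by (auto simp: R_def)
  have s: "0 < s" "s < R" using r R by (auto simp: s_def)
  \<comment> \<open>The flux at radius \<open>s\<close>. It is at least
    \<open>F (sol a s) * s\<^sup>2 / 2\<close> because the solution is larger inside. Further out
    \<open>- t * u' t\<close> is at least \<open>K\<close>, and integrating
    \<open>- u' \<ge> K / t\<close> from \<open>s\<close> to \<open>R\<close> gives
    \<open>K * ln (R / s) \<le> sol a s\<close>, where \<open>R / s = 1 / r\<close>.\<close>
  define K where "K = - (s * sol' a s)"
  have "s * sol' a s + F (sol a s) * s\<^sup>2 / 2 \<le> 0 * sol' a 0 + F (sol a s) * 0\<^sup>2 / 2"
  proof (rule DERIV_nonpos_imp_decreasing_open[OF less_imp_le[OF s(1)], where f = "\<lambda>t. t * sol' a t + F (sol a s) * t\<^sup>2 / 2"])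
    fix t assume t: "0 < t" "t < s"
    have "((\<lambda>t. F (sol a s) * t\<^sup>2 / 2) has_real_derivative F (sol a s) * t) (at t)"
      by (auto intro!: derivative_eq_intros)
    from DERIV_add[OF mult_sol'_deriv[OF t(1)] this]
    have "((\<lambda>t. t * sol' a t + F (sol a s) * t\<^sup>2 / 2) has_real_derivative - t * F (sol a t) + F (sol a s) * t) (at t)" .
    moreover have "F (sol a s) \<le> F (sol a t)"
      using sol_decreasing[OF a, of t s] sol_pos_iff[OF a, of s] t s by (auto simp: F_def R_def intro!: f_mono)
    then have "- t * F (sol a t) + F (sol a s) * t \<le> 0" using mult_left_mono[of "F (sol a s)" "F (sol a t)" t] t by (simp add: mult_ac)
    ultimately show "\<exists>D. ((\<lambda>t. t * sol' a t + F (sol a s) * t\<^sup>2 / 2) has_real_derivative D) (at t) \<and> D \<le> 0" by blast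
  qed (auto intro!: continuous_intros flow_cont)
  then have K: "F (sol a s) * s\<^sup>2 / 2 \<le> K" by (simp add: K_def)
  have "sol a R + K * ln R \<le> sol a s + K * ln s"
  proof (rule DERIV_nonpos_imp_decreasing_open[OF less_imp_le[OF s(2)], where f = "\<lambda>t. sol a t + K * ln t"])
    fix t assume t: "s < t" "t < R"
    then have t0: "0 < t" using s by simp
    have "((\<lambda>t. sol a t + K * ln t) has_real_derivative sol' a t + K * (1 / t)) (at t)"
      using t0 by (intro DERIV_add sol_deriv DERIV_cmult) (auto intro!: derivative_eq_intros)
    moreover have "t * sol' a t \<le> s * sol' a s" using t s by (intro mult_sol'_antimono) auto
    then have "sol' a t + K * (1 / t) \<le> 0" using t0 by (simp add: K_def field_simps)
    ultimately show "\<exists>D. ((\<lambda>t. sol a t + K * ln t) has_real_derivative D) (at t) \<and> D \<le> 0" by blast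
  qed (use s in \<open>auto intro!: continuous_intros flow_cont\<close>)
  then have "K * (ln R - ln s) \<le> sol a s" using R by (simp add: algebra_simps)
  moreover have "ln R - ln s = ln (1 / r)" using R r by (simp add: s_def ln_mult ln_div)
  ultimately have "K * ln (1 / r) \<le> sol a s" by simp
  moreover have "F (sol a s) * s\<^sup>2 / 2 * ln (1 / r) \<le> K * ln (1 / r)"
    using K r by (intro mult_right_mono) auto
  ultimately show ?thesis by (simp add: V_def s_def R_def power_mult_distrib mult_ac)
qed

lemma V_upper_at_top:
  assumes r: "0 \<le> r" "r < 1"
  shows "filterlim (\<lambda>\<eta>. V (upper_sol \<eta>) r) at_top at_top"
proof -
  \<comment> \<open>The factor \<open>r\<^sup>2 * ln (1 / r)\<close> in \<open>V_lower_bound\<close>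
    is of no use at \<open>r = 0\<close>; so the estimate is made at a positive radius
    \<open>q \<ge> r\<close> and carried back to \<open>r\<close>, as solutions decrease in the
    radius.\<close>
  define q where "q = max r (1/2)"
  have q: "0 < q" "q < 1" "r \<le> q" using r by (auto simp: q_def)
  define k where "k = F (V crit q) * (q\<^sup>2 / 2 * ln (1 / q))"
  have k: "k > 0" unfolding k_def using q V_pos[OF crit_pos, of q] by (intro mult_pos_pos F_pos) auto
  show ?thesis
  proof (rule filterlim_at_top_mono)
    show "filterlim (\<lambda>\<eta>. k * \<eta>) at_top at_top"
      by (rule filterlim_tendsto_pos_mult_at_top[OF tendsto_const k filterlim_ident])
    show "\<forall>\<^sub>F \<eta> in at_top. k * \<eta> \<le> V (upper_sol \<eta>) r"
      using eventually_ge_at_top[of "(rad crit)\<^sup>2"]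
    proof eventually_elim
      case (elim \<eta>)
      note hi = upper_sol[OF elim]
      have h0: "upper_sol \<eta> > 0" using hi crit_pos by simp
      have "V crit q \<le> V (upper_sol \<eta>) q"
        using V_increasing[of crit "upper_sol \<eta>" q] hi q by (cases "upper_sol \<eta> = crit") auto
      then have "F (V crit q) \<le> F (V (upper_sol \<eta>) q)"
        using V_pos[OF crit_pos, of q] q by (auto simp: F_def intro: f_mono)
      then have "F (V crit q) * (q\<^sup>2 / 2 * ln (1 / q)) * (rad (upper_sol \<eta>))\<^sup>2
          \<le> F (V (upper_sol \<eta>) q) * (q\<^sup>2 / 2 * ln (1 / q)) * (rad (upper_sol \<eta>))\<^sup>2"
        using q by (intro mult_right_mono) auto
      then have "k * \<eta> \<le> F (V (upper_sol \<eta>) q) * (q\<^sup>2 / 2 * ln (1 / q)) * (rad (upper_sol \<eta>))\<^sup>2"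
        unfolding k_def hi(2) .
      also have "\<dots> \<le> V (upper_sol \<eta>) q" by (rule V_lower_bound[OF h0 q(1,2)])
      also have "\<dots> \<le> V (upper_sol \<eta>) r" using V_decreasing[OF h0 r(1), of q] q by (cases "r = q") auto
      finally show ?case .
    qed
  qed
qed

lemma lower_sol_tendsto: "(lower_sol \<longlongrightarrow> 0) at_top"
proof (rule tendstoI)
  fix e :: real assume "e > 0"
  define x where "x = min e crit"
  have x: "0 < x" "x \<le> e" "x \<le> crit" using \<open>e > 0\<close> crit_pos by (auto simp: x_def)
  show "\<forall>\<^sub>F \<eta> in at_top. dist (lower_sol \<eta>) 0 < e"
    using eventually_gt_at_top[of "(rad x)\<^sup>2"]
  proof eventually_elim
    case (elim \<eta>)
    have "(rad crit)\<^sup>2 \<le> (rad x)\<^sup>2"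
      using rad_crit_less[OF x(1)] rad_sq_less_iff[OF crit_pos x(1)] by (cases "x = crit") auto
    then have lo: "0 < lower_sol \<eta>" "lower_sol \<eta> \<le> crit" "(rad (lower_sol \<eta>))\<^sup>2 = \<eta>" using lower_sol[of \<eta>] elim by auto
    have "rad x < rad (lower_sol \<eta>)" using elim lo rad_sq_less_iff[OF x(1) lo(1)] by simp
    then have "lower_sol \<eta> < x" using rad_decreasing[of x "lower_sol \<eta>"] x lo by (cases x "lower_sol \<eta>" rule: linorder_cases) auto
    then show ?case using lo x by (simp add: dist_real_def)
  qed
qed

section \<open>Correspondence with the boundary value problem and its linearization\<close>

lemma is_pos_solution_V:
  assumes a: "a > 0" shows "is_pos_solution f ((rad a)\<^sup>2) (V a)"
proof -
  define R where "R = rad a"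
  have R: "R > 0" using rad_pos[OF a] by (simp add: R_def)
  have d1: "(V a has_real_derivative Vr a r) (at r within {0..1})" if r: "r \<in> {0..1}" for r
  proof -
    have "(sol a has_real_derivative sol' a (R * r)) (at (R * r) within {0..R * 1})"
      by (rule has_field_derivative_subset[OF sol_deriv_within]) (use R r in auto)
    from has_real_derivative_scale[OF this] R show ?thesis by (simp add: V_def[abs_def] Vr_def R_def mult.commute)
  qed
  define v'' where "v'' r = R * ((- F (sol a (R * r)) - sol' a (R * r) / (R * r)) * (R * 1))" for r
  have d2: "(Vr a has_real_derivative v'' r) (at r)" and e: "v'' r + Vr a r / r + R\<^sup>2 * f (V a r) = 0" if r: "r \<in> {0<..<1}" for r
  proof -
    have p: "R * r > 0" using R r by simp
    show "(Vr a has_real_derivative v'' r) (at r)"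
      unfolding Vr_def[abs_def] v''_def R_def[symmetric]
      by (intro DERIV_cmult DERIV_chain2[OF sol'_deriv[OF p] DERIV_cmult[OF DERIV_ident]])
    have "F (sol a (R * r)) = f (V a r)" using V_pos[OF a, of r] r by (simp add: F_def V_def R_def)
    then show "v'' r + Vr a r / r + R\<^sup>2 * f (V a r) = 0"
      using R r by (simp add: v''_def Vr_def R_def[symmetric] field_simps power2_eq_square)
  qed
  have "is_solution f ((rad a)\<^sup>2) (V a)"
    unfolding is_solution_def R_def[symmetric]
    by (rule exI[of _ "Vr a"], rule exI[of _ v'']) (use d1 d2 e V_1[OF a] in \<open>auto simp: Vr_def\<close>)
  then show ?thesis using V_pos[OF a] by (auto simp: is_pos_solution_def)
qed

text \<open>Stretched to radius \<open>sqrt \<eta>\<close>, \<open>v\<close> satisfies the integral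
  equation with initial value \<open>v 0\<close>, so \<open>sol_unique\<close> applies; its zero at
  the end of the interval must then be \<open>rad (v 0)\<close>.\<close>

lemma pos_solution_is_V:
  assumes v: "is_pos_solution f \<eta> v" and \<eta>: "\<eta> > 0"
  shows "0 < v 0" "(rad (v 0))\<^sup>2 = \<eta>" "\<And>r. r \<in> {0..1} \<Longrightarrow> v r = V (v 0) r"
proof -
  obtain v' v'' where d: "\<And>r. r \<in> {0..1} \<Longrightarrow> (v has_real_derivative v' r) (at r within {0..1})"
    "\<And>r. r \<in> {0<..<1} \<Longrightarrow> (v' has_real_derivative v'' r) (at r)"
    "\<And>r. r \<in> {0<..<1} \<Longrightarrow> v'' r + v' r / r + \<eta> * f (v r) = 0" "v' 0 = 0" "v 1 = 0"
    using v unfolding is_pos_solution_def is_solution_def by blast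
  have pos: "v r > 0" if "0 \<le> r" "r < 1" for r using v that by (auto simp: is_pos_solution_def)
  have nn: "v r \<ge> 0" if "r \<in> {0..1}" for r using pos[of r] d(5) that by (cases "r = 1") auto
  have vc: "continuous_on {0..1} v" using d(1) by (meson DERIV_continuous_on)
  show a: "0 < v 0" using pos by simp
  define R where "R = sqrt \<eta>"
  have R: "R > 0" "R\<^sup>2 = \<eta>" using \<eta> by (auto simp: R_def)
  define x where "x s = v (s / R)" for s
  have i: "s / R \<in> {0..1}" if "s \<in> {0..R}" for s using that R by (auto simp: field_simps)
  have x: "x s = v 0 - radial_pot (\<lambda>s. F (x s)) s" if s: "s \<in> {0..R}" for s
    unfolding x_def
  proof (rule scaled_radial_ode_imp_pot[where g = "\<lambda>r. F (v r)", OF R(1) _ d(1,2) _ d(4) s])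
    show "continuous_on {0..1} (\<lambda>r. F (v r))" by (rule continuous_on_compose2[OF F_cont[of UNIV] vc]) auto
    show "v'' r + v' r / r + R\<^sup>2 * F (v r) = 0" if "r \<in> {0<..<1}" for r
      using d(3)[OF that] nn[of r] that R by (simp add: F_def)
  qed auto
  have xc: "continuous_on {0..R} x" unfolding x_def
    by (rule continuous_on_compose2[OF vc]) (use i R in \<open>auto intro!: continuous_intros\<close>)
  have xs: "x s = sol (v 0) s" if "s \<in> {0..R}" for s by (rule sol_unique[OF xc x that])
  have "sol (v 0) R = 0" using xs[of R] R d(5) by (simp add: x_def)
  then have Rr: "R = rad (v 0)" using rad_unique[OF a, of R] R by simp
  then show "(rad (v 0))\<^sup>2 = \<eta>" using R by simp
  show "v r = V (v 0) r" if "r \<in> {0..1}" for r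
  proof -
    have "R * r \<in> {0..R}" using that R by (auto simp: mult_left_le)
    from xs[OF this] show ?thesis using R by (simp add: x_def V_def Rr[symmetric])
  qed
qed

text \<open>Regularity at \<open>0\<close> leaves only the constant \<open>w 0\<close> free. So the
  linearized solutions form a space of dimension at most one, and a nontrivial one forces
  \<open>var a (rad a) = 0\<close>.\<close>

lemma lin_solution_is_var:
  assumes a: "a > 0" and w: "lin_solution f1 ((rad a)\<^sup>2) (V a) w" and r: "r \<in> {0..1}"
  shows "w r = w 0 * var a (rad a * r)"
proof -
  define R where "R = rad a"
  have R: "R > 0" using rad_pos[OF a] by (simp add: R_def)
  obtain w' w'' where d: "\<And>r. r \<in> {0..1} \<Longrightarrow> (w has_real_derivative w' r) (at r within {0..1})"
    "\<And>r. r \<in> {0<..<1} \<Longrightarrow> (w' has_real_derivative w'' r) (at r)"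
    "\<And>r. r \<in> {0<..<1} \<Longrightarrow> w'' r + w' r / r + R\<^sup>2 * f1 (V a r) * w r = 0" "w' 0 = 0" "w 1 = 0"
    using w unfolding lin_solution_def R_def by blast
  have wc: "continuous_on {0..1} w" using d(1) by (meson DERIV_continuous_on)
  define x where "x s = w (s / R)" for s
  have i: "s / R \<in> {0..1}" if "s \<in> {0..R}" for s using that R by (auto simp: field_simps)
  have x: "x s = w 0 - radial_pot (\<lambda>s. F1 (sol a s) * x s) s" if s: "s \<in> {0..R}" for s
  proof -
    have "x s = w 0 - radial_pot (\<lambda>s. F1 (sol a (R * (s / R))) * w (s / R)) s" unfolding x_def
    proof (rule scaled_radial_ode_imp_pot[where g = "\<lambda>r. F1 (sol a (R * r)) * w r", OF R(1) _ d(1,2) _ d(4) s])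
      show "continuous_on {0..1} (\<lambda>r. F1 (sol a (R * r)) * w r)"
        by (intro continuous_on_mult wc continuous_on_compose2[OF F1_sol_cont(1)]) (use R in \<open>auto intro!: continuous_intros\<close>)
      show "w'' r + w' r / r + R\<^sup>2 * (F1 (sol a (R * r)) * w r) = 0" if "r \<in> {0<..<1}" for r
        using d(3)[OF that] V_pos[OF a, of r] that by (simp add: F1_def V_def R_def)
    qed auto
    then show ?thesis using R by (simp add: x_def)
  qed
  have xc: "continuous_on {0..R} x" unfolding x_def
    by (rule continuous_on_compose2[OF wc]) (use i R in \<open>auto intro!: continuous_intros\<close>)
  have "R * r \<in> {0..R}" using r R by (auto simp: mult_left_le)
  from var_unique[OF xc x this] show ?thesis using R by (simp add: x_def R_def)
qed

lemma lin_solution_var: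
  assumes a: "a > 0" and 0: "var a (rad a) = 0"
  shows "lin_solution f1 ((rad a)\<^sup>2) (V a) (\<lambda>r. var a (rad a * r))"
proof -
  define R where "R = rad a"
  have R: "R > 0" using rad_pos[OF a] by (simp add: R_def)
  define w' where "w' r = R * var' a (R * r)" for r
  have d1: "((\<lambda>r. var a (R * r)) has_real_derivative w' r) (at r within {0..1})" if r: "r \<in> {0..1}" for r
  proof -
    have "(var a has_real_derivative var' a (R * r)) (at (R * r) within {0..R * 1})"
      by (rule has_field_derivative_subset[OF var_deriv_within]) (use R r in auto)
    from has_real_derivative_scale[OF this] R show ?thesis by (simp add: w'_def mult.commute)
  qed
  define w'' where "w'' r = R * ((- F1 (sol a (R * r)) * var a (R * r) - var' a (R * r) / (R * r)) * (R * 1))" for r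
  have d2: "(w' has_real_derivative w'' r) (at r)" and e: "w'' r + w' r / r + R\<^sup>2 * f1 (V a r) * var a (R * r) = 0" if r: "r \<in> {0<..<1}" for r
  proof -
    have p: "R * r > 0" using R r by simp
    show "(w' has_real_derivative w'' r) (at r)"
      unfolding w'_def[abs_def] w''_def
      by (intro DERIV_cmult DERIV_chain2[OF var'_deriv[OF p] DERIV_cmult[OF DERIV_ident]])
    have "F1 (sol a (R * r)) = f1 (V a r)" using V_pos[OF a, of r] r by (simp add: F1_def V_def R_def)
    then show "w'' r + w' r / r + R\<^sup>2 * f1 (V a r) * var a (R * r) = 0"
      using R r by (simp add: w''_def w'_def field_simps power2_eq_square)
  qed
  show ?thesis
    unfolding lin_solution_def R_def[symmetric]
    by (rule exI[of _ w'], rule exI[of _ w'']) (use d1 d2 e 0 in \<open>auto simp: w'_def R_def\<close>)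
qed

lemma is_critical_point_iff:
  assumes a: "a > 0"
  shows "is_critical_point f1 ((rad a)\<^sup>2) (V a) \<longleftrightarrow> a = crit"
proof
  assume "is_critical_point f1 ((rad a)\<^sup>2) (V a)"
  then obtain w r where w: "lin_solution f1 ((rad a)\<^sup>2) (V a) w" "r \<in> {0..1}" "w r \<noteq> 0"
    by (auto simp: is_critical_point_def nontrivial_on01_def)
  have "w 1 = 0" using w(1) by (auto simp: lin_solution_def)
  moreover have "w 0 \<noteq> 0" using lin_solution_is_var[OF a w(1,2)] w(3) by auto
  ultimately have "var a (rad a) = 0" using lin_solution_is_var[OF a w(1), of 1] by simp
  then show "a = crit" using var_rad_neg[OF a] var_rad_pos[of a] by (cases a crit rule: linorder_cases) auto
next
  assume "a = crit"
  then have "var a (rad a) = 0" using var_crit by simp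
  from lin_solution_var[OF a this] show "is_critical_point f1 ((rad a)\<^sup>2) (V a)"
    unfolding is_critical_point_def nontrivial_on01_def by (intro exI conjI bexI[of _ 0]) auto
qed

lemma nondegenerate_crit: "nondegenerate_critical_point f f1 f2 ((rad crit)\<^sup>2) (V crit)"
proof -
  define R where "R = rad crit"
  have R: "R > 0" using rad_pos[OF crit_pos] by (simp add: R_def)
  define w0 where "w0 r = var crit (R * r)" for r
  have lin: "lin_solution f1 (R\<^sup>2) (V crit) w0"
    using lin_solution_var[OF crit_pos var_crit] by (simp add: R_def w0_def[abs_def])
  have vp: "0 < var crit s" if "0 \<le> s" "s < R" for s
    using var_pos[OF crit_pos] var_crit that by (simp add: R_def)
  have Vc: "continuous_on {0..1} (V crit)" by (rule continuous_on_subset[OF V_cont_r[OF crit_pos]]) auto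
  have wc: "continuous_on {0..1} w0" unfolding w0_def
    by (rule continuous_on_compose2[OF var_cont]) (use R in \<open>auto intro!: continuous_intros\<close>)
  have fc: "continuous_on {0..1} (\<lambda>r. f (V crit r))"
    by (rule continuous_on_compose2[OF f_contS[of "{0..}"] Vc]) (use V_nonneg[OF crit_pos] in auto)
  have "integral {0..1} (\<lambda>_ :: real. 0) < integral {0..1} (\<lambda>r. f (V crit r) * w0 r * r)"
  proof (rule integral_less_real)
    show "continuous_on {0..1} (\<lambda>r. f (V crit r) * w0 r * r)" by (intro continuous_intros fc wc)
    show "0 < f (V crit r) * w0 r * r" if "r \<in> {0<..<1}" for r
      unfolding w0_def using that R V_pos[OF crit_pos, of r] by (intro mult_pos_pos vp f_pos) auto
  qed auto
  then have i1: "integral {0..1} (\<lambda>r. f (V crit r) * w0 r * r) \<noteq> 0" by simp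
  define G where "G r = r * F2 (sol crit r) * var crit r ^ 3" for r
  have "continuous_on {0..R} G" unfolding G_def[abs_def] by (intro continuous_intros flow_cont) auto
  then have "(G has_integral integral {0..R} G) {0..R}" by (intro integrable_integral integrable_continuous_real)
  \<comment> \<open>Substituting \<open>s = R * r\<close> and converting the weight \<open>r\<close>
    produce the factor \<open>1 / R\<^sup>2\<close>, which does not affect the sign.\<close>
  from has_integral_stretch_real[OF this, of R] R
  have "((\<lambda>r. G (R * r)) has_integral (1 / R) * integral {0..R} G) {0..1}" by simp
  then have "((\<lambda>r. (1 / R) * G (R * r)) has_integral (1 / R) * ((1 / R) * integral {0..R} G)) {0..1}"
    by (rule has_integral_mult_right)
  moreover have "(1 / R) * G (R * r) = f2 (V crit r) * w0 r ^ 3 * r" if "r \<in> {0..1}" for r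
    using that V_nonneg[OF crit_pos, of r] R by (simp add: G_def w0_def F2_def V_def R_def)
  ultimately have "((\<lambda>r. f2 (V crit r) * w0 r ^ 3 * r) has_integral (1 / R) * ((1 / R) * integral {0..R} G)) {0..1}"
    by (rule has_integral_eq[rotated])
  moreover have "integral {0..R} G < 0" using critical_F2_integral[OF crit_pos var_crit] by (simp add: G_def[abs_def] R_def)
  ultimately have i2: "integral {0..1} (\<lambda>r. f2 (V crit r) * w0 r ^ 3 * r) \<noteq> 0" using R by (simp add: integral_unique)
  show ?thesis unfolding nondegenerate_critical_point_def
  proof (intro exI conjI allI impI)
    show "lin_solution f1 ((rad crit)\<^sup>2) (V crit) w0" using lin by (simp add: R_def)
    show "nontrivial_on01 w0" unfolding nontrivial_on01_def by (rule bexI[of _ 0]) (auto simp: w0_def)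
    show "\<forall>r\<in>{0..1}. w r = w 0 * w0 r" if "lin_solution f1 ((rad crit)\<^sup>2) (V crit) w" for w
      using lin_solution_is_var[OF crit_pos that] unfolding w0_def R_def by blast
  qed (use i1 i2 in auto)
qed

text \<open>Parametrized by the central value \<open>a\<close> instead of the parameter of the
  problem, the curve passes the turning point regularly: at \<open>r = 0\<close> one has
  \<open>V a 0 = a\<close> and \<open>Vs a 0 = 1\<close>, which gives a nonzero tangent and
  injectivity.\<close>

lemma smooth_curve: "smooth_solution_curve {0<..} (\<lambda>a. (rad a)\<^sup>2) V"
  unfolding smooth_solution_curve_def
proof (intro conjI exI)
  show "\<forall>s\<in>{0<..}. ((\<lambda>a. (rad a)\<^sup>2) has_real_derivative 2 * rad s * rad' s) (at s)"
    by (auto intro!: derivative_eq_intros rad_deriv)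
  show "continuous_on {0<..} (\<lambda>s. 2 * rad s * rad' s)" by (intro continuous_intros rad_cont rad'_cont)
  show "\<forall>s\<in>{0<..}. \<forall>r\<in>{0..1}. ((\<lambda>t. V t r) has_real_derivative Vs s r) (at s)"
    using V_deriv_s by simp
  show "continuous_on ({0<..} \<times> {0..1}) (\<lambda>p. Vs (fst p) (snd p))" by (rule Vs_cont)
  show "\<forall>s\<in>{0<..}. 2 * rad s * rad' s \<noteq> 0 \<or> (\<exists>r\<in>{0..1}. Vs s r \<noteq> 0)"
    by (auto simp: Vs_def intro!: bexI[of _ 0])
  show "\<forall>s\<in>{0<..}. \<forall>t\<in>{0<..}. s \<noteq> t \<longrightarrow> (rad s)\<^sup>2 \<noteq> (rad t)\<^sup>2 \<or> (\<exists>r\<in>{0..1}. V s r \<noteq> V t r)"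
    by (auto intro!: bexI[of _ 0])
  show "is_interval {0 :: real<..}" by (auto simp: is_interval_1)
  show "{0 :: real<..} \<noteq> {}" by auto
qed simp

lemma solutions_param:
  assumes "\<eta> > 0"
  shows "(\<lambda>v. restrict v {0..1}) ` {v. is_pos_solution f \<eta> v} = (\<lambda>a. restrict (V a) {0..1}) ` {a. 0 < a \<and> (rad a)\<^sup>2 = \<eta>}"
proof (intro equalityI subsetI)
  fix u assume "u \<in> (\<lambda>v. restrict v {0..1}) ` {v. is_pos_solution f \<eta> v}"
  then obtain v where v: "is_pos_solution f \<eta> v" "u = restrict v {0..1}" by blast
  note p = pos_solution_is_V[OF v(1) assms]
  have "u = restrict (V (v 0)) {0..1}" unfolding v(2) by (rule restrict_ext) (rule p(3))
  then show "u \<in> (\<lambda>a. restrict (V a) {0..1}) ` {a. 0 < a \<and> (rad a)\<^sup>2 = \<eta>}" using p by blast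
next
  fix u assume "u \<in> (\<lambda>a. restrict (V a) {0..1}) ` {a. 0 < a \<and> (rad a)\<^sup>2 = \<eta>}"
  then show "u \<in> (\<lambda>v. restrict v {0..1}) ` {v. is_pos_solution f \<eta> v}" using is_pos_solution_V by blast
qed

text \<open>Solutions are arbitrary outside \<open>{0..1}\<close>, hence the restriction before
  counting; the value at \<open>0\<close> then recovers the initial value, so counting solutions is
  counting points in a level set of \<open>rad\<close>.\<close>

lemma card_solutions:
  assumes "\<eta> > 0"
  shows "card ((\<lambda>v. restrict v {0..1}) ` {v. is_pos_solution f \<eta> v}) = card {a. 0 < a \<and> (rad a)\<^sup>2 = \<eta>}"
  unfolding solutions_param[OF assms]
proof (rule card_image, rule inj_onI)
  fix a b assume "restrict (V a) {0..1::real} = restrict (V b) {0..1}"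
  then have "restrict (V a) {0..1} (0::real) = restrict (V b) {0..1} 0" by simp
  then show "a = b" by simp
qed

lemma rad_level_set:
  assumes "(rad crit)\<^sup>2 \<le> \<eta>"
  shows "{a. 0 < a \<and> (rad a)\<^sup>2 = \<eta>} = {lower_sol \<eta>, upper_sol \<eta>}"
proof -
  have "a = lower_sol \<eta> \<or> a = upper_sol \<eta>" if "0 < a" "(rad a)\<^sup>2 = \<eta>" for a
    using lower_sol_rad[of a] upper_sol_rad[of a] that by (cases "a \<le> crit") auto
  then show ?thesis using lower_sol[OF assms] upper_sol[OF assms] crit_pos by auto
qed

lemma sols_at_crit: "lower_sol ((rad crit)\<^sup>2) = crit" "upper_sol ((rad crit)\<^sup>2) = crit"
  using lower_sol_rad[of crit] upper_sol_rad[of crit] crit_pos by auto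

lemma sols_above_crit:
  assumes "(rad crit)\<^sup>2 < \<eta>"
  shows "lower_sol \<eta> < crit" "crit < upper_sol \<eta>"
proof -
  have "lower_sol \<eta> \<noteq> crit" "upper_sol \<eta> \<noteq> crit"
    using lower_sol(3)[of \<eta>] upper_sol(2)[of \<eta>] assms by auto
  then show "lower_sol \<eta> < crit" "crit < upper_sol \<eta>"
    using lower_sol(2)[of \<eta>] upper_sol(1)[of \<eta>] assms by auto
qed

end

theorem theorem4p1:
  fixes f f1 f2 :: "real \<Rightarrow> real" and \<beta> f0 :: real
  assumes f_deriv: "\<And>x. x \<ge> 0 \<Longrightarrow> (f has_real_derivative f1 x) (at x within {0..})"
    and f1_deriv: "\<And>x. x \<ge> 0 \<Longrightarrow> (f1 has_real_derivative f2 x) (at x within {0..})"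
    and f2_cont: "continuous_on {0..} f2"
    and f_0: "f 0 = 0" and f1_0: "f1 0 = 0"
    and f_pos: "\<And>v. v > 0 \<Longrightarrow> f v > 0"
    and log_concave: "\<And>v. v > 0 \<Longrightarrow> f2 v * f v - (f1 v)\<^sup>2 < 0"
    and beta_pos: "\<beta> > 0"
    and convex_part: "\<And>v. 0 < v \<Longrightarrow> v < \<beta> \<Longrightarrow> f2 v > 0"
    and concave_part: "\<And>v. v > \<beta> \<Longrightarrow> f2 v < 0"
    and f_lim: "(f \<longlongrightarrow> f0) at_top" and f0_pos: "f0 > 0"
    and superlinear: "\<And>v. 0 < v \<Longrightarrow> v < \<beta> \<Longrightarrow> v * f1 v > f v"
  shows "\<exists>\<eta>0 > 0.
     (\<forall>\<eta>. 0 < \<eta> \<and> \<eta> < \<eta>0 \<longrightarrow> \<not> (\<exists>v. is_pos_solution f \<eta> v)) \<and>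
     card ((\<lambda>v. restrict v {0..1}) ` {v. is_pos_solution f \<eta>0 v}) = 1 \<and>
     (\<forall>\<eta>. \<eta> > \<eta>0 \<longrightarrow> card ((\<lambda>v. restrict v {0..1}) ` {v. is_pos_solution f \<eta> v}) = 2) \<and>
     (\<exists>(I :: real set) etac V s0 vminus vplus.
        smooth_solution_curve I etac V \<and> s0 \<in> I \<and> etac s0 = \<eta>0 \<and>
        (\<forall>s\<in>I. is_pos_solution f (etac s) (V s)) \<and>
        (\<forall>\<eta> v. \<eta> > 0 \<and> is_pos_solution f \<eta> v \<longrightarrow>
            (\<exists>s\<in>I. etac s = \<eta> \<and> (\<forall>r\<in>{0..1}. v r = V s r))) \<and>
        (\<forall>s\<in>I. s < s0 \<longrightarrow> etac s > \<eta>0 \<and> (\<forall>r\<in>{0..1}. V s r = vminus (etac s) r)) \<and>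
        (\<forall>s\<in>I. s > s0 \<longrightarrow> etac s > \<eta>0 \<and> (\<forall>r\<in>{0..1}. V s r = vplus (etac s) r)) \<and>
        (\<forall>\<eta>. \<eta> > \<eta>0 \<longrightarrow> is_pos_solution f \<eta> (vminus \<eta>) \<and> is_pos_solution f \<eta> (vplus \<eta>) \<and>
             (\<forall>r\<in>{0..<1}. vminus \<eta> r < vplus \<eta> r)) \<and>
        (\<forall>r\<in>{0..1}. vminus \<eta>0 r = V s0 r \<and> vplus \<eta>0 r = V s0 r) \<and>
        (\<forall>\<eta>1 \<eta>2. \<eta>0 < \<eta>1 \<and> \<eta>1 < \<eta>2 \<longrightarrow> (\<forall>r\<in>{0..<1}. vplus \<eta>1 r < vplus \<eta>2 r)) \<and>
        (\<forall>r\<in>{0..<1}. filterlim (\<lambda>\<eta>. vplus \<eta> r) at_top at_top) \<and>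
        ((\<lambda>\<eta>. vminus \<eta> 0) \<longlongrightarrow> 0) at_top \<and>
        (\<forall>s\<in>I. is_critical_point f1 (etac s) (V s) \<longleftrightarrow> s = s0) \<and>
        nondegenerate_critical_point f f1 f2 \<eta>0 (V s0))"
proof -
  interpret log_concave_problem f f1 f2 \<beta> f0
    by unfold_locales (fact assms)+
  show ?thesis (is "\<exists>\<eta>0>0. ?none \<eta>0 \<and> ?one \<eta>0 \<and> ?two \<eta>0 \<and> ?curve \<eta>0")
  proof (rule exI[of _ "(rad crit)\<^sup>2"], intro conjI)
    let ?\<eta>0 = "(rad crit)\<^sup>2"
    have above: "?\<eta>0 < (rad a)\<^sup>2" if "0 < a" "a \<noteq> crit" for a
      using rad_crit_less[OF that] rad_sq_less_iff[OF crit_pos that(1)] by simp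
    show \<eta>0: "0 < ?\<eta>0" using rad_pos[OF crit_pos] by simp
    show "\<forall>\<eta>. 0 < \<eta> \<and> \<eta> < ?\<eta>0 \<longrightarrow> \<not> (\<exists>v. is_pos_solution f \<eta> v)"
    proof (intro allI impI notI, elim conjE exE)
      fix \<eta> v assume *: "0 < \<eta>" "\<eta> < ?\<eta>0" "is_pos_solution f \<eta> v"
      show False using pos_solution_is_V(1,2)[OF *(3,1)] above[of "v 0"] *(2) by (cases "v 0 = crit") auto
    qed
    show "card ((\<lambda>v. restrict v {0..1}) ` {v. is_pos_solution f ?\<eta>0 v}) = 1"
      using card_solutions[OF \<eta>0] rad_level_set[of ?\<eta>0] by (simp add: sols_at_crit)
    show "\<forall>\<eta>. \<eta> > ?\<eta>0 \<longrightarrow> card ((\<lambda>v. restrict v {0..1}) ` {v. is_pos_solution f \<eta> v}) = 2"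
    proof (intro allI impI)
      fix \<eta> assume \<eta>: "?\<eta>0 < \<eta>"
      then have "0 < \<eta>" using \<eta>0 by linarith
      then show "card ((\<lambda>v. restrict v {0..1}) ` {v. is_pos_solution f \<eta> v}) = 2"
        using card_solutions[of \<eta>] rad_level_set[of \<eta>] sols_above_crit[OF \<eta>] \<eta> by simp
    qed
    show "?curve ?\<eta>0"
    \<comment> \<open>Both branch functions return \<open>V crit\<close> at the critical parameter
      by \<open>sols_at_crit\<close>, so they meet at the turning point.\<close>
    proof (rule exI[of _ "{0<..}"], rule exI[of _ "\<lambda>a. (rad a)\<^sup>2"], rule exI[of _ V], rule exI[of _ crit],
        rule exI[of _ "\<lambda>\<eta>. V (lower_sol \<eta>)"], rule exI[of _ "\<lambda>\<eta>. V (upper_sol \<eta>)"], intro conjI)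
      show "smooth_solution_curve {0<..} (\<lambda>a. (rad a)\<^sup>2) V" by (rule smooth_curve)
      show "\<forall>s\<in>{0<..}. is_pos_solution f ((rad s)\<^sup>2) (V s)" using is_pos_solution_V by simp
      show "\<forall>\<eta> v. \<eta> > 0 \<and> is_pos_solution f \<eta> v \<longrightarrow> (\<exists>s\<in>{0<..}. (rad s)\<^sup>2 = \<eta> \<and> (\<forall>r\<in>{0..1}. v r = V s r))"
      proof (intro allI impI, elim conjE)
        fix \<eta> v assume "0 < \<eta>" "is_pos_solution f \<eta> v"
        note p = pos_solution_is_V[OF this(2,1)]
        show "\<exists>s\<in>{0<..}. (rad s)\<^sup>2 = \<eta> \<and> (\<forall>r\<in>{0..1}. v r = V s r)"
          by (intro bexI[of _ "v 0"] conjI ballI p) (use p(1) in auto)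
      qed
      show "\<forall>s\<in>{0<..}. s < crit \<longrightarrow> (rad s)\<^sup>2 > ?\<eta>0 \<and> (\<forall>r\<in>{0..1}. V s r = V (lower_sol ((rad s)\<^sup>2)) r)"
        using above lower_sol_rad by simp
      show "\<forall>s\<in>{0<..}. s > crit \<longrightarrow> (rad s)\<^sup>2 > ?\<eta>0 \<and> (\<forall>r\<in>{0..1}. V s r = V (upper_sol ((rad s)\<^sup>2)) r)"
        using above upper_sol_rad by simp
      show "\<forall>\<eta>. \<eta> > ?\<eta>0 \<longrightarrow> is_pos_solution f \<eta> (V (lower_sol \<eta>)) \<and> is_pos_solution f \<eta> (V (upper_sol \<eta>)) \<and>
               (\<forall>r\<in>{0..<1}. V (lower_sol \<eta>) r < V (upper_sol \<eta>) r)"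
      proof (intro allI impI)
        fix \<eta> assume \<eta>: "?\<eta>0 < \<eta>"
        have le: "?\<eta>0 \<le> \<eta>" using \<eta> by simp
        note lo = lower_sol[OF le] and hi = upper_sol[OF le] and ab = sols_above_crit[OF \<eta>]
        have h0: "0 < upper_sol \<eta>" using hi crit_pos by simp
        have "rad (lower_sol \<eta>) = rad (upper_sol \<eta>)" using lo hi rad_sq_eq_iff[OF lo(1) h0] by simp
        then show "is_pos_solution f \<eta> (V (lower_sol \<eta>)) \<and> is_pos_solution f \<eta> (V (upper_sol \<eta>)) \<and>
               (\<forall>r\<in>{0..<1}. V (lower_sol \<eta>) r < V (upper_sol \<eta>) r)"
          using is_pos_solution_V[OF lo(1)] is_pos_solution_V[OF h0] lo hi V_lower_less_upper[OF lo(1) ab] by auto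
      qed
      show "\<forall>r\<in>{0..1}. V (lower_sol ?\<eta>0) r = V crit r \<and> V (upper_sol ?\<eta>0) r = V crit r" by (simp add: sols_at_crit)
      show "\<forall>\<eta>1 \<eta>2. ?\<eta>0 < \<eta>1 \<and> \<eta>1 < \<eta>2 \<longrightarrow> (\<forall>r\<in>{0..<1}. V (upper_sol \<eta>1) r < V (upper_sol \<eta>2) r)"
      proof (intro allI impI ballI, elim conjE)
        fix \<eta>1 \<eta>2 r assume *: "?\<eta>0 < \<eta>1" "\<eta>1 < \<eta>2" "r \<in> {0..<1::real}"
        note h1 = upper_sol[of \<eta>1] and h2 = upper_sol[of \<eta>2]
        have "upper_sol \<eta>1 < upper_sol \<eta>2"
        proof (rule ccontr)
          assume "\<not> upper_sol \<eta>1 < upper_sol \<eta>2"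
          then have "rad (upper_sol \<eta>2) \<le> rad (upper_sol \<eta>1)"
            using rad_increasing[of "upper_sol \<eta>2" "upper_sol \<eta>1"] h2 * by (cases "upper_sol \<eta>1 = upper_sol \<eta>2") auto
          then have "(rad (upper_sol \<eta>2))\<^sup>2 \<le> (rad (upper_sol \<eta>1))\<^sup>2"
            using rad_pos[of "upper_sol \<eta>2"] h2 * crit_pos by (intro power_mono) auto
          then show False using h1 h2 * by simp
        qed
        then show "V (upper_sol \<eta>1) r < V (upper_sol \<eta>2) r" using * h1 by (intro V_increasing) auto
      qed
      show "\<forall>r\<in>{0..<1}. filterlim (\<lambda>\<eta>. V (upper_sol \<eta>) r) at_top at_top" using V_upper_at_top by simp
      show "((\<lambda>\<eta>. V (lower_sol \<eta>) 0) \<longlongrightarrow> 0) at_top" using lower_sol_tendsto by simp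
      show "\<forall>s\<in>{0<..}. is_critical_point f1 ((rad s)\<^sup>2) (V s) \<longleftrightarrow> s = crit" using is_critical_point_iff by simp
      show "nondegenerate_critical_point f f1 f2 ?\<eta>0 (V crit)" by (rule nondegenerate_crit)
    qed (use crit_pos in auto)
  qed
qed

end
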